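(* Let $S\subseteq\{\neg,\overline{\ \ },\wedge,\vee,\Box,\Diamond,\mathit{true},\mathit{false}\}$. If $S$ contains $\{\wedge,\vee,\Box,\Diamond,\mathit{false}\}$, then $\mathcal{L}(S)$ satisfiability is PSPACE-complete.
   Context: For $S$ a subset of the operators $\{\neg,\overline{\ \ },\wedge,\vee,\Box,\Diamond,\mathit{true},\mathit{false}\}$, $\mathcal{L}(S)$ is the set of modal formulas built from a countably infinite set of propositional variables using only operators in $S$. Here $\neg$ is general negation (applicable to any formula), $\overline{\ \ }$ is atomic negation (applicable only to propositional variables, giving $\overline{p}$), and $\mathit{true},\mathit{false}$ are constants. Semantics is standard Kripke semantics: a model $\langle W,R,\pi\rangle$ with $W$ non-empty, $R\subseteq W\times W$, $\pi$ a valuation; $\Box\phi$ holds at $w$ iff $\phi$ holds at all $R$-successors of $w$, $\Diamond\phi$ iff at some $R$-successor. $\mathcal{L}(S)$ satisfiability is the problem of deciding, given an $\mathcal{L}(S)$ formula, whether it is true at some world of some model (over the class of all frames). *)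

theory Defs
  imports Main "HOL-Computational_Algebra.Polynomial" "HOL-Library.Countable_Set"
begin

section \<open>Modal formulas\<close>

datatype connective = NEG | ATNEG | AND | OR | BOX | DIA | TRUE | FALSE

datatype fm =
    Var nat
  | NVar nat
  | Neg fm
  | Conj fm fm
  | Disj fm fm
  | Box fm
  | Dia fm
  | Tru
  | Fls

fun connectives :: "fm \<Rightarrow> connective set" where
  "connectives (Var p) = {}"
| "connectives (NVar p) = {ATNEG}"
| "connectives (Neg a) = insert NEG (connectives a)"
| "connectives (Conj a b) = insert AND (connectives a \<union> connectives b)"
| "connectives (Disj a b) = insert OR (connectives a \<union> connectives b)"
| "connectives (Box a) = insert BOX (connectives a)"
| "connectives (Dia a) = insert DIA (connectives a)"
| "connectives Tru = {TRUE}"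
| "connectives Fls = {FALSE}"

definition modal_lang :: "connective set \<Rightarrow> fm set" where
  "modal_lang S = {a. connectives a \<subseteq> S}"


section \<open>Kripke semantics\<close>

definition kripke_model :: "'w set \<Rightarrow> ('w \<times> 'w) set \<Rightarrow> (nat \<Rightarrow> 'w set) \<Rightarrow> bool" where
  "kripke_model W R V \<longleftrightarrow> W \<noteq> {} \<and> R \<subseteq> W \<times> W \<and> (\<forall>p. V p \<subseteq> W)"

fun holds :: "('w \<times> 'w) set \<Rightarrow> (nat \<Rightarrow> 'w set) \<Rightarrow> 'w \<Rightarrow> fm \<Rightarrow> bool" where
  "holds R V w (Var p) \<longleftrightarrow> w \<in> V p"
| "holds R V w (NVar p) \<longleftrightarrow> w \<notin> V p"
| "holds R V w (Neg a) \<longleftrightarrow> \<not> holds R V w a"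
| "holds R V w (Conj a b) \<longleftrightarrow> holds R V w a \<and> holds R V w b"
| "holds R V w (Disj a b) \<longleftrightarrow> holds R V w a \<or> holds R V w b"
| "holds R V w (Box a) \<longleftrightarrow> (\<forall>v. (w, v) \<in> R \<longrightarrow> holds R V v a)"
| "holds R V w (Dia a) \<longleftrightarrow> (\<exists>v. (w, v) \<in> R \<and> holds R V v a)"
| "holds R V w Tru \<longleftrightarrow> True"
| "holds R V w Fls \<longleftrightarrow> False"

definition satisfiable :: "'w itself \<Rightarrow> fm \<Rightarrow> bool" where
  "satisfiable (_ :: 'w itself) a \<longleftrightarrow>
     (\<exists>(W :: 'w set) R V. kripke_model W R V \<and> (\<exists>w\<in>W. holds R V w a))"

text \<open>
  The worlds of a model form a set of elements of some type. By the following lemma every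
  infinite type yields the same notion, namely satisfiability in a model over any type
  whatsoever.
\<close>

instance fm :: countable by countable_datatype

lemma satisfiable_transfer:
  assumes sat: "satisfiable TYPE('a) a" and inf: "infinite (UNIV :: 'w set)"
  shows "satisfiable TYPE('w) a"
proof -
  obtain W :: "'a set" and R V w0 where m: "kripke_model W R V" and w0: "w0 \<in> W"
    and h0: "holds R V w0 a"
    using sat unfolding satisfiable_def by blast
  define wit where "wit v b = (if \<exists>u. (v, u) \<in> R \<and> holds R V u b
      then SOME u. (v, u) \<in> R \<and> holds R V u b else v)" for v b
  define X where "X = range (foldl wit w0)"
  have wit: "(v, wit v b) \<in> R \<and> holds R V (wit v b) b" if "(v, u) \<in> R" "holds R V u b" for u v b
    using someI_ex[of "\<lambda>u. (v, u) \<in> R \<and> holds R V u b"] that unfolding wit_def by auto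
  have "foldl wit w0 [] \<in> X" unfolding X_def by (rule rangeI)
  then have w0X: "w0 \<in> X" by simp
  have witX: "wit v b \<in> X" if "v \<in> X" for v b
  proof -
    obtain l where "v = foldl wit w0 l" using \<open>v \<in> X\<close> unfolding X_def by blast
    then have "wit v b = foldl wit w0 (l @ [b])" by simp
    then show ?thesis unfolding X_def by blast
  qed
  have "countable X" unfolding X_def by simp
  then obtain f :: "'a \<Rightarrow> nat" where f: "inj_on f X" using countableE by blast
  obtain e :: "nat \<Rightarrow> 'w" where e: "inj e" using infinite_countable_subset[OF inf] by blast
  define g where "g = e \<circ> f"
  have g: "inj_on g X" unfolding g_def using f e by (simp add: comp_inj_on inj_on_subset)
  define R' where "R' = {(g u, g v) | u v. u \<in> X \<and> v \<in> X \<and> (u, v) \<in> R}"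
  define V' where "V' p = g ` (V p \<inter> X)" for p
  have R': "(g v, z) \<in> R' \<longleftrightarrow> (\<exists>u\<in>X. z = g u \<and> (v, u) \<in> R)" if "v \<in> X" for v z
    using that g unfolding R'_def by (auto dest: inj_onD)
  have V': "g v \<in> V' p \<longleftrightarrow> v \<in> V p" if "v \<in> X" for v p
    using that g unfolding V'_def by (auto dest: inj_onD)
  have eq: "holds R' V' (g v) b \<longleftrightarrow> holds R V v b" if "v \<in> X" for v b
    using that
  proof (induction b arbitrary: v)
    case (Box b)
    have "holds R' V' (g v) (Box b) \<longleftrightarrow> (\<forall>u\<in>X. (v, u) \<in> R \<longrightarrow> holds R V u b)"
      using Box by (auto simp: R')
    also have "\<dots> \<longleftrightarrow> holds R V v (Box b)"
      using wit[of v _ "Neg b"] witX[OF Box.prems, of "Neg b"] by fastforce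
    finally show ?case .
  next
    case (Dia b)
    have "holds R' V' (g v) (Dia b) \<longleftrightarrow> (\<exists>u\<in>X. (v, u) \<in> R \<and> holds R V u b)"
      using Dia by (auto simp: R')
    also have "\<dots> \<longleftrightarrow> holds R V v (Dia b)"
      using wit[of v _ b] witX[OF Dia.prems, of b] by fastforce
    finally show ?case .
  qed (simp_all add: V')
  have "kripke_model (g ` X) R' V'"
    using w0X unfolding kripke_model_def R'_def V'_def by auto
  then show ?thesis
    using eq[OF w0X] h0 w0X unfolding satisfiable_def by blast
qed


section \<open>Formulas as bit strings\<close>

text \<open>
  Polish notation. Each node is a four-bit tag; the index of a variable follows in binary,
  least significant digit first, each digit preceded by \<open>True\<close> and the whole closed by
  \<open>False\<close>.
\<close>

fun enc_nat :: "nat \<Rightarrow> bool list" where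
  "enc_nat n = (if n = 0 then [False] else True # odd n # enc_nat (n div 2))"

declare enc_nat.simps [simp del]

fun enc :: "fm \<Rightarrow> bool list" where
  "enc (Var p) = [False, False, False, False] @ enc_nat p"
| "enc (NVar p) = [False, False, False, True] @ enc_nat p"
| "enc (Neg a) = [False, False, True, False] @ enc a"
| "enc (Conj a b) = [False, False, True, True] @ enc a @ enc b"
| "enc (Disj a b) = [False, True, False, False] @ enc a @ enc b"
| "enc (Box a) = [False, True, False, True] @ enc a"
| "enc (Dia a) = [False, True, True, False] @ enc a"
| "enc Tru = [False, True, True, True]"
| "enc Fls = [True, False, False, False]"

lemma enc_nat_cancel: "enc_nat m @ xs = enc_nat n @ ys \<Longrightarrow> m = n \<and> xs = ys"
proof (induction m arbitrary: n rule: less_induct)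
  case (less m)
  have z: "enc_nat 0 = [False]" by (simp add: enc_nat.simps)
  have nz: "enc_nat k = True # odd k # enc_nat (k div 2)" if "k \<noteq> 0" for k
    using that by (subst enc_nat.simps) simp
  show ?case
  proof (cases "m = 0 \<or> n = 0")
    case True
    then show ?thesis
      using less.prems z nz[of m] nz[of n] by (cases "m = 0"; cases "n = 0") simp_all
  next
    case False
    then have par: "odd m = odd n" and rest: "enc_nat (m div 2) @ xs = enc_nat (n div 2) @ ys"
      using less.prems nz[of m] nz[of n] by simp_all
    have "m div 2 < m" using False by simp
    from less.IH[OF this rest] have "m div 2 = n div 2" "xs = ys" by simp_all
    moreover from this(1) par have "m = n" by presburger
    ultimately show ?thesis by simp
  qed
qed

lemma enc_cancel: "enc a @ xs = enc b @ ys \<Longrightarrow> a = b \<and> xs = ys"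
proof (induction a arbitrary: b xs ys)
  case (Conj a1 a2)
  from Conj.prems obtain b1 b2 where b: "b = Conj b1 b2" by (cases b) simp_all
  with Conj.prems have "enc a1 @ enc a2 @ xs = enc b1 @ enc b2 @ ys" by simp
  from Conj.IH(1)[OF this] have "a1 = b1" "enc a2 @ xs = enc b2 @ ys" by simp_all
  moreover from Conj.IH(2)[OF this(2)] have "a2 = b2" "xs = ys" by simp_all
  ultimately show ?case using b by blast
next
  case (Disj a1 a2)
  from Disj.prems obtain b1 b2 where b: "b = Disj b1 b2" by (cases b) simp_all
  with Disj.prems have "enc a1 @ enc a2 @ xs = enc b1 @ enc b2 @ ys" by simp
  from Disj.IH(1)[OF this] have "a1 = b1" "enc a2 @ xs = enc b2 @ ys" by simp_all
  moreover from Disj.IH(2)[OF this(2)] have "a2 = b2" "xs = ys" by simp_all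
  ultimately show ?case using b by blast
next
  case (Var p)
  then show ?case by (cases b) (auto dest: enc_nat_cancel)
next
  case (NVar p)
  then show ?case by (cases b) (auto dest: enc_nat_cancel)
next
  case (Neg a)
  from Neg.prems show ?case by (cases b) (auto dest: Neg.IH)
next
  case (Box a)
  from Box.prems show ?case by (cases b) (auto dest: Box.IH)
next
  case (Dia a)
  from Dia.prems show ?case by (cases b) (auto dest: Dia.IH)
next
  case Tru
  then show ?case by (cases b) simp_all
next
  case Fls
  then show ?case by (cases b) simp_all
qed

lemma inj_enc: "inj enc"
  using enc_cancel[of _ "[]" _ "[]"] by (auto intro: injI)

definition sat_problem :: "'w itself \<Rightarrow> connective set \<Rightarrow> bool list set" where
  "sat_problem T S = enc ` {a \<in> modal_lang S. satisfiable T a}"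


section \<open>Turing machines\<close>

text \<open>
  Deterministic machines with any fixed number of two-way infinite tapes. The states are
  \<open>0, \<dots>, states M - 1\<close>, where 0 is initial, 1 accepts and 2 rejects. The tape
  symbols are \<open>0, \<dots>, symbols M - 1\<close>, where 0 is the blank and 1 and 2 represent the
  bits \<open>False\<close> and \<open>True\<close>. The transition function receives the symbols
  under the heads and prescribes, for each tape, a symbol to write and a head movement.
\<close>

datatype move = Left | Stay | Right

record tm =
  tapes :: nat
  states :: nat
  symbols :: nat
  delta :: "nat \<Rightarrow> nat list \<Rightarrow> nat \<times> (nat \<times> move) list"

definition wf_tm :: "tm \<Rightarrow> bool" where
  "wf_tm M \<longleftrightarrow> tapes M \<ge> 1 \<and> states M \<ge> 3 \<and> symbols M \<ge> 3 \<and>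
     (\<forall>q < states M. \<forall>as. length as = tapes M \<and> set as \<subseteq> {..<symbols M} \<longrightarrow>
        (case delta M q as of (q', acts) \<Rightarrow>
           q' < states M \<and> length acts = tapes M \<and> fst ` set acts \<subseteq> {..<symbols M}))"

type_synonym tape = "int \<Rightarrow> nat"

type_synonym config = "nat \<times> (tape \<times> int) list"  \<comment> \<open>state; contents and head position of each tape\<close>

definition halted :: "config \<Rightarrow> bool" where
  "halted c \<longleftrightarrow> fst c \<in> {1, 2}"

fun shift :: "move \<Rightarrow> int \<Rightarrow> int" where
  "shift Left h = h - 1"
| "shift Stay h = h"
| "shift Right h = h + 1"

definition step :: "tm \<Rightarrow> config \<Rightarrow> config" where
  "step M c = (if halted c then c else
     (let (q, ts) = c; (q', acts) = delta M q (map (\<lambda>(t, h). t h) ts)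
      in (q', map2 (\<lambda>(t, h) (b, m). (t(h := b), shift m h)) ts acts)))"

definition tape_of :: "bool list \<Rightarrow> tape" where
  "tape_of x = (\<lambda>i. if 0 \<le> i \<and> i < int (length x) then (if x ! nat i then 2 else 1) else 0)"

definition init :: "tm \<Rightarrow> bool list \<Rightarrow> config" where
  "init M x = (0, (tape_of x, 0) # replicate (tapes M - 1) (tape_of [], 0))"

definition run :: "tm \<Rightarrow> bool list \<Rightarrow> nat \<Rightarrow> config" where
  "run M x t = (step M ^^ t) (init M x)"


section \<open>Polynomial space and polynomial-time reductions\<close>

definition decides :: "tm \<Rightarrow> bool list set \<Rightarrow> bool" where
  "decides M A \<longleftrightarrow> (\<forall>x. \<exists>t. fst (run M x t) = (if x \<in> A then 1 else 2))"

text \<open>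
  The space bound \<open>s\<close> depends on the length of the input and confines every head to the cells
  \<open>-s, \<dots>, s\<close> throughout the run.
\<close>

definition runs_in_space :: "tm \<Rightarrow> (nat \<Rightarrow> nat) \<Rightarrow> bool" where
  "runs_in_space M s \<longleftrightarrow>
     (\<forall>x t. \<forall>(_, h) \<in> set (snd (run M x t)). \<bar>h\<bar> \<le> int (s (length x)))"

definition PSPACE :: "bool list set set" where
  "PSPACE = {A. \<exists>M (p :: nat poly). wf_tm M \<and> decides M A \<and> runs_in_space M (poly p)}"

text \<open>The input is on the first tape; the output has to be left on the last one.\<close>

definition computes_in_time :: "tm \<Rightarrow> (bool list \<Rightarrow> bool list) \<Rightarrow> (nat \<Rightarrow> nat) \<Rightarrow> bool" where
  "computes_in_time M f s \<longleftrightarrow>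
     (\<forall>x. let c = run M x (s (length x)) in halted c \<and> fst (last (snd c)) = tape_of (f x))"

definition polytime_computable :: "(bool list \<Rightarrow> bool list) \<Rightarrow> bool" where
  "polytime_computable f \<longleftrightarrow> (\<exists>M (p :: nat poly). wf_tm M \<and> computes_in_time M f (poly p))"

definition polytime_reducible :: "bool list set \<Rightarrow> bool list set \<Rightarrow> bool" (infix \<open>\<le>\<^sub>p\<close> 50) where
  "A \<le>\<^sub>p B \<longleftrightarrow> (\<exists>f. polytime_computable f \<and> (\<forall>x. x \<in> A \<longleftrightarrow> f x \<in> B))"

definition PSPACE_hard :: "bool list set \<Rightarrow> bool" where
  "PSPACE_hard B \<longleftrightarrow> (\<forall>A \<in> PSPACE. A \<le>\<^sub>p B)"

definition PSPACE_complete :: "bool list set \<Rightarrow> bool" where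
  "PSPACE_complete B \<longleftrightarrow> B \<in> PSPACE \<and> PSPACE_hard B"

end

theory Submission
  imports Defs
begin

text \<open>
  Hardness. A deterministic machine in polynomial space halts within \<open>2\<^sup>m\<close> steps, where \<open>m\<close> is
  polynomial. A model of the formula produced from an input contains a binary tree of depth \<open>m\<close> whose node at height
  \<open>l\<close> stores two configurations that are \<open>2\<^sup>l\<close> steps apart and the one in the middle; its
  children are responsible for the two halves, as in Savitch's theorem. Only the bits that hold of the true
  configurations are forced, so all constraints are Horn clauses. As there is no negation, a bit \<open>j\<close> is the existence
  of a successor that starts a path of length \<open>j + 2\<close> to a dead end; \<open>true\<close> is replaced by
  a variable, because satisfiability of a formula without negation is not affected by making all variables true everywhere.

  Membership. The input is translated into negation normal form over two modalities without variables; a literal becomes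
  a sequence of diamonds or boxes that spells out its index, so that complementary literals clash like modal formulas.
  Satisfiability is then a game: one player resolves disjunctions, the other one chooses the diamond to follow. Each move
  consumes a symbol, hence linearly many alternating choices suffice, and a backtracking search over all choice sequences
  needs linear space.
\<close>

section \<open>Stack programs and their simulation by Turing machines\<close>

text \<open>The two literals of a bit exclude each other in every model, but a model may satisfy
  neither. An implication is therefore a disjunction of a literal to be refuted and a conclusion,
  and soundness only ever derives that a literal holds or that its opposite fails. A fact about a
  middle or last configuration must travel from a child to its parent, which a modal formula can
  only say contrapositively; this is why the induction over the tree ends in the failure of a
  negative literal, and why the rejecting state is excluded by a negative literal at the root.

  The reduction has to be carried out by an actual machine. Since bits are lengths of modal chains,
  all numbers in the formula are unary and \<open>Var 0\<close> is its only variable, so nested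
  counting loops can print it. One compiler yields this machine and the decision procedure: its
  semantics counts steps and stack heights at once.

  For membership, the number of rounds of the game depends only on the length of the formula and
  need not be exact, because surplus choices are never read. Hence one quantifier prefix serves all
  plays.\<close>

text \<open>
  Stack 0 holds the input with its first bit on top, so it is a tape whose top cell moves to the right when it is popped. The
  other stacks grow to the right from cell 0; their heads start on cell -1. A push takes two steps, and \<open>Wr\<close>
  is the second of them.
\<close>

type_synonym store = "nat \<Rightarrow> nat list"

fun hd0 :: "nat list \<Rightarrow> nat" where
  "hd0 [] = 0"
| "hd0 (a # _) = a"

datatype com =
    Skip
  | Push nat nat
  | Wr nat nat
  | Pop nat
  | Seq com com (infixr \<open>;;\<close> 60)
  | Case nat "nat \<Rightarrow> com"
  | While nat "nat set" com

text \<open>Zero is never pushed, so reading it means that the stack is empty, and no bottom marker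
  is needed. Branches of \<open>Case\<close> are checked for all \<open>a < s\<close>, also for
  symbols that cannot occur.\<close>

primrec wfc :: "nat \<Rightarrow> nat \<Rightarrow> com \<Rightarrow> bool" where
  "wfc k s Skip = True"
| "wfc k s (Push i a) = (i < k \<and> 0 < a \<and> a < s)"
| "wfc k s (Wr i a) = (i < k \<and> 0 < a \<and> a < s)"
| "wfc k s (Pop i) = (i < k)"
| "wfc k s (c ;; d) = (wfc k s c \<and> wfc k s d)"
| "wfc k s (Case i f) = (i < k \<and> (\<forall>a < s. wfc k s (f a)))"
| "wfc k s (While i A c) = (i < k \<and> wfc k s c)"

text \<open>One semantics for both resources: the number counts the steps of the compiled machine
  (the leading 1 of a compound rule is the step that unfolds the command), and \<open>B\<close>
  restricts the height reached by a push, the only command that lets a stack grow. \<open>Wr\<close>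
  has no rule because it occurs only inside the machine.\<close>

inductive ex :: "(nat \<Rightarrow> bool) \<Rightarrow> com \<Rightarrow> store \<Rightarrow> nat \<Rightarrow> store \<Rightarrow> bool" for B where
  Skip: "ex B Skip \<sigma> 1 \<sigma>"
| Push: "B (Suc (length (\<sigma> i))) \<Longrightarrow> ex B (Push i a) \<sigma> 2 (\<sigma>(i := a # \<sigma> i))"
| Pop: "ex B (Pop i) \<sigma> 1 (\<sigma>(i := tl (\<sigma> i)))"
| Seq: "ex B c \<sigma> t \<sigma>' \<Longrightarrow> ex B d \<sigma>' u \<sigma>'' \<Longrightarrow> ex B (c ;; d) \<sigma> (1 + t + u) \<sigma>''"
| Case: "ex B (f (hd0 (\<sigma> i))) \<sigma> t \<sigma>' \<Longrightarrow> ex B (Case i f) \<sigma> (1 + t) \<sigma>'"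
| WhileF: "hd0 (\<sigma> i) \<notin> A \<Longrightarrow> ex B (While i A c) \<sigma> 1 \<sigma>"
| WhileT: "hd0 (\<sigma> i) \<in> A \<Longrightarrow> ex B c \<sigma> t \<sigma>' \<Longrightarrow> ex B (While i A c) \<sigma>' u \<sigma>'' \<Longrightarrow>
    ex B (While i A c) \<sigma> (1 + t + u) \<sigma>''"

lemma ex_mono: "ex B c \<sigma> t \<sigma>' \<Longrightarrow> (\<And>l. B l \<Longrightarrow> B' l) \<Longrightarrow> ex B' c \<sigma> t \<sigma>'"
  by (induction rule: ex.induct) (auto intro: ex.intros simp del: One_nat_def)

text \<open>The simulation is proved for bounded stacks; this supplies some bound for programs of
  which only the time is of interest.\<close>

lemma ex_bounded: "ex B c \<sigma> t \<sigma>' \<Longrightarrow> \<exists>b. ex (\<lambda>l. l \<le> b) c \<sigma> t \<sigma>'"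
proof (induction rule: ex.induct)
  case (Push \<sigma> i a)
  show ?case by (intro exI[of _ "Suc (length (\<sigma> i))"] ex.Push) simp
next
  case (Seq c \<sigma> t \<sigma>' d u \<sigma>'')
  then obtain b b' where "ex (\<lambda>l. l \<le> b) c \<sigma> t \<sigma>'" "ex (\<lambda>l. l \<le> b') d \<sigma>' u \<sigma>''" by blast
  then show ?case by (intro exI[of _ "max b b'"] ex.Seq) (auto elim!: ex_mono)
next
  case (WhileT \<sigma> i A c t \<sigma>' u \<sigma>'')
  then obtain b b' where
    "ex (\<lambda>l. l \<le> b) c \<sigma> t \<sigma>'" "ex (\<lambda>l. l \<le> b') (While i A c) \<sigma>' u \<sigma>''" by blast
  then show ?case
    using WhileT(1) by (intro exI[of _ "max b b'"] ex.WhileT) (auto elim!: ex_mono)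
qed (auto intro: ex.intros simp del: One_nat_def fun_upd_apply)

definition wp :: "(nat \<Rightarrow> bool) \<Rightarrow> com \<Rightarrow> store \<Rightarrow> (nat \<Rightarrow> store \<Rightarrow> bool) \<Rightarrow> bool" where
  "wp B c \<sigma> Q \<longleftrightarrow> (\<exists>t \<sigma>'. ex B c \<sigma> t \<sigma>' \<and> Q t \<sigma>')"

lemma ex_iff:
  "ex B Skip \<sigma> t \<sigma>' \<longleftrightarrow> t = 1 \<and> \<sigma>' = \<sigma>"
  "ex B (Push i a) \<sigma> t \<sigma>' \<longleftrightarrow> B (Suc (length (\<sigma> i))) \<and> t = 2 \<and> \<sigma>' = \<sigma>(i := a # \<sigma> i)"
  "ex B (Pop i) \<sigma> t \<sigma>' \<longleftrightarrow> t = 1 \<and> \<sigma>' = \<sigma>(i := tl (\<sigma> i))"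
  "ex B (c ;; d) \<sigma> t \<sigma>' \<longleftrightarrow> (\<exists>u \<rho> v. ex B c \<sigma> u \<rho> \<and> ex B d \<rho> v \<sigma>' \<and> t = 1 + u + v)"
  "ex B (Case i f) \<sigma> t \<sigma>' \<longleftrightarrow> (\<exists>u. ex B (f (hd0 (\<sigma> i))) \<sigma> u \<sigma>' \<and> t = 1 + u)"
  by (subst ex.simps, force)+

lemma ex_While_done: "hd0 (\<sigma> i) \<notin> A \<Longrightarrow> ex B (While i A c) \<sigma> t \<sigma>' \<longleftrightarrow> t = 1 \<and> \<sigma>' = \<sigma>"
  by (subst ex.simps, force)

text \<open>As equations they turn the symbolic execution of loop-free code into
  simplification.\<close>

lemma wp_simps [simp]:
  "wp B Skip \<sigma> Q = Q 1 \<sigma>"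
  "wp B (Push i a) \<sigma> Q = (B (Suc (length (\<sigma> i))) \<and> Q 2 (\<sigma>(i := a # \<sigma> i)))"
  "wp B (Pop i) \<sigma> Q = Q 1 (\<sigma>(i := tl (\<sigma> i)))"
  "wp B (c ;; d) \<sigma> Q = wp B c \<sigma> (\<lambda>t \<sigma>'. wp B d \<sigma>' (\<lambda>u. Q (1 + t + u)))"
  "wp B (Case i f) \<sigma> Q = wp B (f (hd0 (\<sigma> i))) \<sigma> (\<lambda>t. Q (1 + t))"
  unfolding wp_def ex_iff by (simp_all del: One_nat_def, metis+)

lemma wp_While_done [simp]: "hd0 (\<sigma> i) \<notin> A \<Longrightarrow> wp B (While i A c) \<sigma> Q = Q 1 \<sigma>"
  unfolding wp_def by (simp add: ex_While_done)

lemma wp_While_step: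
  "hd0 (\<sigma> i) \<in> A \<Longrightarrow>
    wp B c \<sigma> (\<lambda>t \<sigma>'. wp B (While i A c) \<sigma>' (\<lambda>u. Q (1 + t + u))) \<Longrightarrow> wp B (While i A c) \<sigma> Q"
  unfolding wp_def by (blast intro: ex.WhileT)

lemma wp_mono: "wp B c \<sigma> Q \<Longrightarrow> (\<And>t \<sigma>'. Q t \<sigma>' \<Longrightarrow> Q' t \<sigma>') \<Longrightarrow> wp B c \<sigma> Q'"
  unfolding wp_def by blast

section \<open>Finite control from pending commands, tapes from stacks\<close>

primrec conts :: "nat \<Rightarrow> com \<Rightarrow> com list set" where
  "conts s Skip = {[Skip], []}"
| "conts s (Push i a) = {[Push i a], [Wr i a], []}"
| "conts s (Wr i a) = {[Wr i a], []}"
| "conts s (Pop i) = {[Pop i], []}"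
| "conts s (c ;; d) = {[c ;; d]} \<union> (\<lambda>l. l @ [d]) ` conts s c \<union> conts s d"
| "conts s (Case i f) = {[Case i f], []} \<union> (\<Union>a<s. conts s (f a))"
| "conts s (While i A c) = {[While i A c], []} \<union> (\<lambda>l. l @ [While i A c]) ` conts s c"

fun nxt :: "com \<Rightarrow> (nat \<Rightarrow> nat) \<Rightarrow> com list" where
  "nxt (Push i a) r = [Wr i a]"
| "nxt (c ;; d) r = [c, d]"
| "nxt (Case i f) r = [f (r i)]"
| "nxt (While i A c) r = (if r i \<in> A then [c, While i A c] else [])"
| "nxt _ r = []"

text \<open>A machine step writes before it moves, so \<open>Push\<close> can only move the head to
  a fresh cell and leaves the writing to \<open>Wr\<close>. \<open>Pop\<close> on an empty stack
  does nothing, in agreement with \<open>tl [] = []\<close>.\<close>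

fun act :: "com \<Rightarrow> (nat \<Rightarrow> nat) \<Rightarrow> nat \<Rightarrow> nat \<times> move" where
  "act (Push i a) r j = (r j, if j = i then (if j = 0 then Left else Right) else Stay)"
| "act (Wr i a) r j = (if j = i then a else r j, Stay)"
| "act (Pop i) r j = (if j = i \<and> r j \<noteq> 0 then (0, if j = 0 then Right else Left) else (r j, Stay))"
| "act _ r j = (r j, Stay)"

lemma conts_self: "[c] \<in> conts s c" and conts_Nil: "[] \<in> conts s c"
  by (induction c) auto

lemma finite_conts: "finite (conts s c)"
  by (induction c) auto

text \<open>Execution keeps the list of pending commands within the finite set
  \<open>conts s c\<close>, so these lists can serve as states. They resemble the partial
  derivatives of a regular expression: unfolding a loop puts back the same single copy of
  it.\<close>

lemma conts_nxt:
  "d # l \<in> conts s c \<Longrightarrow> wfc k s c \<Longrightarrow> (\<And>j. j < k \<Longrightarrow> r j < s) \<Longrightarrow> nxt d r @ l \<in> conts s c"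
proof (induction c arbitrary: d l)
  case (Seq c1 c2)
  consider "d = c1 ;; c2" "l = []" | l1 where "d # l = l1 @ [c2]" "l1 \<in> conts s c1" | "d # l \<in> conts s c2"
    using Seq.prems(1) by auto
  then show ?case
  proof cases
    case 1
    then show ?thesis using conts_self[of c1 s] by (auto simp: image_iff intro!: disjI1 bexI[of _ "[c1]"])
  next
    case 2
    show ?thesis
    proof (cases l1)
      case Nil
      then have "d # l \<in> conts s c2" using 2 conts_self[of c2 s] by auto
      then show ?thesis using Seq by auto
    next
      case (Cons d' l1')
      then have "nxt d r @ l1' \<in> conts s c1" "l = l1' @ [c2]" using 2 Seq by auto
      then show ?thesis by auto
    qed
  next
    case 3
    then show ?thesis using Seq by auto
  qed
next
  case (Case i f)
  consider "d = Case i f" "l = []" | a where "a < s" "d # l \<in> conts s (f a)"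
    using Case.prems(1) by auto
  then show ?case
  proof cases
    case 1
    moreover have "r i < s" using Case.prems by simp
    ultimately show ?thesis using conts_self[of "f (r i)" s] by auto
  next
    case 2
    then have "nxt d r @ l \<in> conts s (f a)" using Case by auto
    then show ?thesis using 2 by auto
  qed
next
  case (While i A c)
  consider "d = While i A c" "l = []" | l1 where "d # l = l1 @ [While i A c]" "l1 \<in> conts s c"
    using While.prems(1) by auto
  then show ?case
  proof cases
    case 1
    then show ?thesis using conts_self[of c s] by (auto simp: image_iff intro!: bexI[of _ "[c]"])
  next
    case 2
    show ?thesis
    proof (cases l1)
      case Nil
      then show ?thesis using 2 conts_self[of c s] by (auto simp: image_iff intro!: bexI[of _ "[c]"])
    next
      case (Cons d' l1')
      then have "nxt d r @ l1' \<in> conts s c" "l = l1' @ [While i A c]" using 2 While by auto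
      then show ?thesis by auto
    qed
  qed
qed auto

lemma conts_wfc: "l \<in> conts s c \<Longrightarrow> wfc k s c \<Longrightarrow> d \<in> set l \<Longrightarrow> wfc k s d"
  by (induction c arbitrary: l) force+

text \<open>\<open>n\<close> is the length of the input. Stack 0 has its bottom in cell
  \<open>n - 1\<close> and grows to the left, so that the initial tape with its head on cell 0 is a
  stack as it stands. The head rests on the top element, or on the blank beyond the bottom.\<close>

definition tp :: "nat \<Rightarrow> nat \<Rightarrow> nat list \<Rightarrow> tape \<times> int" where
  "tp n j xs = (if j = 0
     then (\<lambda>p. if int n - int (length xs) \<le> p \<and> p < int n then xs ! nat (p - (int n - int (length xs))) else 0,
           int n - int (length xs))
     else (\<lambda>p. if 0 \<le> p \<and> p < int (length xs) then xs ! nat (int (length xs) - 1 - p) else 0,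
           int (length xs) - 1))"

lemma tp_read: "fst (tp n j xs) (snd (tp n j xs)) = hd0 xs"
  by (cases xs) (auto simp: tp_def)

lemma tp_upd: "(fst (tp n j xs))(snd (tp n j xs) := hd0 xs) = fst (tp n j xs)"
  by (simp flip: tp_read[of n j xs] del: fun_upd_apply)

lemma tp_push:
  "tp n j (a # xs) = (let (t, h) = tp n j xs; h' = shift (if j = 0 then Left else Right) h in (t(h' := a), h'))"
  by (auto simp: tp_def fun_eq_iff Let_def nth_Cons' nat_eq_iff split: if_splits;
      intro arg_cong[where f = "(!) xs"]; simp)

lemma tp_pop:
  assumes "xs \<noteq> []"
  shows "tp n j (tl xs) = (let (t, h) = tp n j xs in (t(h := 0), shift (if j = 0 then Right else Left) h))"
proof -
  obtain a ys where "xs = a # ys" using assms by (cases xs) auto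
  then show ?thesis
    by (auto simp: tp_def fun_eq_iff Let_def nth_Cons' nat_eq_iff split: if_splits;
      intro arg_cong[where f = "(!) ys"]; simp)
qed

lemma tp_head: "\<bar>snd (tp n j xs)\<bar> \<le> int n + int (length xs) + 1"
  by (auto simp: tp_def)

definition bsym :: "bool \<Rightarrow> nat" where "bsym x = (if x then 2 else 1)"

definition start :: "bool list \<Rightarrow> store" where
  "start x = (\<lambda>j. if j = 0 then map bsym x else [])"

section \<open>Compiled machine and its simulation of programs\<close>

locale compile =
  fixes k s :: nat and c :: com
  assumes k: "k \<ge> 2" and s: "s \<ge> 3" and wf: "wfc k s c"
begin

definition code :: "com list \<Rightarrow> nat" where
  "code = (SOME h. bij_betw h (conts s c) {0..<card (conts s c)})"

definition decode :: "nat \<Rightarrow> com list" where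
  "decode = inv_into (conts s c) code"

text \<open>States 0, 1 and 2 are given by the machine model, hence the offset 3. State 0 only
  brings the heads of the other tapes to cell -1, where an empty stack has its head. When no command
  is pending, the top of stack 0 decides: 2 is the symbol for \<open>True\<close>.\<close>

definition dlt :: "nat \<Rightarrow> nat list \<Rightarrow> nat \<times> (nat \<times> move) list" where
  "dlt q as =
    (if q = 0 then (3 + code [c], map (\<lambda>j. (as ! j, if j = 0 then Stay else Left)) [0..<k])
     else case decode (q - 3) of
       [] \<Rightarrow> (if as ! 0 = 2 then 1 else 2, map (\<lambda>j. (as ! j, Stay)) [0..<k])
     | d # l \<Rightarrow> (3 + code (nxt d ((!) as) @ l), map (act d ((!) as)) [0..<k]))"

definition mach :: tm where
  "mach = \<lparr>tapes = k, states = 3 + card (conts s c), symbols = s, delta = dlt\<rparr>"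

lemma code: "bij_betw code (conts s c) {0..<card (conts s c)}"
  unfolding code_def using ex_bij_betw_finite_nat[OF finite_conts] by (rule someI_ex)

lemma code_less: "l \<in> conts s c \<Longrightarrow> code l < card (conts s c)"
  using code bij_betwE by fastforce

lemma decode_code: "l \<in> conts s c \<Longrightarrow> decode (code l) = l"
  unfolding decode_def using code by (simp add: bij_betw_def)

lemma decode_in: "decode n \<in> conts s c" if "n < card (conts s c)"
  unfolding decode_def using code that by (intro inv_into_into) (auto simp: bij_betw_def)

lemma act_less: "wfc k s d \<Longrightarrow> r j < s \<Longrightarrow> fst (act d r j) < s"
  using s by (cases d) auto

lemma wf_mach: "wf_tm mach"
  unfolding wf_tm_def
proof (intro conjI allI impI)
  show "1 \<le> tapes mach" "3 \<le> states mach" "3 \<le> symbols mach"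
    using k s by (auto simp: mach_def)
  fix q as assume q: "q < states mach" and as: "length as = tapes mach \<and> set as \<subseteq> {..<symbols mach}"
  then have as_less: "as ! j < s" if "j < k" for j
  proof -
    have "as ! j \<in> set as" using as that by (simp add: mach_def)
    then show ?thesis using as by (auto simp: mach_def)
  qed
  have c0: "0 < card (conts s c)" using conts_Nil[of s c] finite_conts[of s c] by (auto simp: card_gt_0_iff)
  have d: "decode (q - 3) \<in> conts s c" using q c0 by (intro decode_in) (auto simp: mach_def)
  have nx: "code (nxt d ((!) as) @ l) < card (conts s c)" if "decode (q - 3) = d # l" for d l
    using conts_nxt[of d l s c k "(!) as"] d that wf as_less by (intro code_less) auto
  have ac: "fst (act d ((!) as) j) < s" if "decode (q - 3) = d' # l" "d = d'" "j < k" for d d' l j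
    using act_less[of d "(!) as" j] conts_wfc[OF d wf, of d'] that as_less by auto
  show "case delta mach q as of (q', acts) \<Rightarrow>
      q' < states mach \<and> length acts = tapes mach \<and> fst ` set acts \<subseteq> {..<symbols mach}"
    using as_less nx ac code_less[OF conts_self] by (auto simp: mach_def dlt_def split: list.split)
qed

definition cfg :: "nat \<Rightarrow> com list \<Rightarrow> store \<Rightarrow> config" where
  "cfg n l \<sigma> = (3 + code l, map (\<lambda>j. tp n j (\<sigma> j)) [0..<k])"

lemma map2_map: "map2 f (map g xs) (map h xs) = map (\<lambda>x. f (g x) (h x)) xs"
  by (induction xs) auto

lemma step_map:
  assumes "q \<noteq> 1" "q \<noteq> 2"
    "delta mach q (map (\<lambda>j. fst (T j) (snd (T j))) [0..<k]) = (q', map A [0..<k])"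
  shows "step mach (q, map T [0..<k]) =
    (q', map (\<lambda>j. ((fst (T j))(snd (T j) := fst (A j)), shift (snd (A j)) (snd (T j)))) [0..<k])"
proof -
  have "map (\<lambda>(t, h). t h) (map T [0..<k]) = map (\<lambda>j. fst (T j) (snd (T j))) [0..<k]"
    by (auto simp: case_prod_beta)
  then show ?thesis
    using assms by (simp add: step_def halted_def map2_map case_prod_beta del: map_map)
qed

lemma step_cfg:
  assumes l: "d # l \<in> conts s c"
    and T: "\<And>j. j < k \<Longrightarrow> T j = ((fst (tp n j (\<sigma> j)))(snd (tp n j (\<sigma> j)) := fst (act d (\<lambda>j. hd0 (\<sigma> j)) j)),
      shift (snd (act d (\<lambda>j. hd0 (\<sigma> j)) j)) (snd (tp n j (\<sigma> j))))"
    and nx: "nxt d ((!) (map (\<lambda>j. hd0 (\<sigma> j)) [0..<k])) = nl"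
  shows "step mach (cfg n (d # l) \<sigma>) = (3 + code (nl @ l), map T [0..<k])"
proof -
  have w: "wfc k s d" using conts_wfc[OF l wf] by simp
  let ?r = "(!) (map (\<lambda>j. hd0 (\<sigma> j)) [0..<k])"
  have a: "act d ?r j = act d (\<lambda>j. hd0 (\<sigma> j)) j" if "j < k" for j
    using w that k by (cases "j = 0"; cases d) auto
  have "delta mach (3 + code (d # l)) (map (\<lambda>j. fst (tp n j (\<sigma> j)) (snd (tp n j (\<sigma> j)))) [0..<k]) =
      (3 + code (nl @ l), map (act d ?r) [0..<k])"
    using nx decode_code[OF l] by (simp add: mach_def dlt_def tp_read)
  from step_map[OF _ _ this] show ?thesis
    using T a by (simp add: cfg_def)
qed

definition ok :: "nat \<Rightarrow> config \<Rightarrow> bool" where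
  "ok b C \<longleftrightarrow> (\<forall>(_, h) \<in> set (snd C). \<bar>h\<bar> \<le> int b)"

text \<open>Space is a property of the whole run, so the bound is imposed on every intermediate
  configuration.\<close>

definition reach :: "nat \<Rightarrow> nat \<Rightarrow> config \<Rightarrow> config \<Rightarrow> bool" where
  "reach b t C C' \<longleftrightarrow> (step mach ^^ t) C = C' \<and> (\<forall>u\<le>t. ok b ((step mach ^^ u) C))"

lemma reach_trans: "reach b t C C' \<Longrightarrow> reach b u C' C'' \<Longrightarrow> reach b (t + u) C C''"
  unfolding reach_def
proof (intro conjI allI impI; elim conjE)
  assume *: "(step mach ^^ t) C = C'" "(step mach ^^ u) C' = C''"
    "\<forall>u\<le>t. ok b ((step mach ^^ u) C)" "\<forall>v\<le>u. ok b ((step mach ^^ v) C')"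
  show "(step mach ^^ (t + u)) C = C''" using * by (simp add: add.commute[of t u] funpow_add)
  fix v assume v: "v \<le> t + u"
  show "ok b ((step mach ^^ v) C)"
  proof (cases "v \<le> t")
    case False
    then obtain w where w: "v = w + t" by (metis le_add_diff_inverse2 nat_le_linear)
    then have "(step mach ^^ v) C = (step mach ^^ w) C'" using *(1) by (simp add: funpow_add)
    moreover have "w \<le> u" using w v by simp
    ultimately show ?thesis using *(4) by simp
  qed (use *(3) in blast)
qed

lemma reach_1: "step mach C = C' \<Longrightarrow> ok b C \<Longrightarrow> ok b C' \<Longrightarrow> reach b 1 C C'"
  unfolding reach_def by (auto simp: le_Suc_eq)

definition fits :: "nat \<Rightarrow> store \<Rightarrow> bool" where
  "fits b \<sigma> \<longleftrightarrow> (\<forall>j<k. length (\<sigma> j) \<le> b \<and> set (\<sigma> j) \<subseteq> {0<..<s})"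

lemma ok_map: "(\<And>j. j < k \<Longrightarrow> \<bar>snd (T j)\<bar> \<le> int b) \<Longrightarrow> ok b (q, map T [0..<k])"
  unfolding ok_def by (auto simp: case_prod_beta)

lemma tp_bound: "fits b \<sigma> \<Longrightarrow> j < k \<Longrightarrow> \<bar>snd (tp n j (\<sigma> j))\<bar> \<le> int (n + b + 1)"
  using tp_head[of n j "\<sigma> j"] unfolding fits_def by force

text \<open>By \<open>tp_bound\<close> the heads stay within \<open>n + b + 1\<close>; the extra
  cell is for a head halfway through a push.\<close>

lemma ok_cfg: "fits b \<sigma> \<Longrightarrow> ok (n + b + 2) (cfg n l \<sigma>)"
  unfolding cfg_def
proof (rule ok_map)
  fix j assume "fits b \<sigma>" "j < k"
  from tp_bound[OF this, of n] show "\<bar>snd (tp n j (\<sigma> j))\<bar> \<le> int (n + b + 2)" by simp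
qed

lemma hd0_less: "fits b \<sigma> \<Longrightarrow> j < k \<Longrightarrow> hd0 (\<sigma> j) < s"
  unfolding fits_def using s by (cases "\<sigma> j") auto

lemma step_stay:
  assumes l: "d # l \<in> conts s c" and d: "\<forall>i a. d \<noteq> Push i a \<and> d \<noteq> Wr i a \<and> d \<noteq> Pop i" and f: "fits b \<sigma>"
    and nx: "nxt d (\<lambda>j. hd0 (\<sigma> j)) = nl"
  shows "reach (n + b + 2) 1 (cfg n (d # l) \<sigma>) (cfg n (nl @ l) \<sigma>)" "nl @ l \<in> conts s c"
proof -
  have w: "wfc k s d" using conts_wfc[OF l wf] by simp
  let ?r = "(!) (map (\<lambda>j. hd0 (\<sigma> j)) [0..<k])"
  \<comment> \<open>\<open>?r\<close> agrees with the store only below \<open>k\<close>;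
    well-formedness keeps the inspected stack in that range.\<close>
  have nx': "nxt d ?r = nl" using nx w by (cases d) auto
  have "step mach (cfg n (d # l) \<sigma>) = (3 + code (nl @ l), map (\<lambda>j. tp n j (\<sigma> j)) [0..<k])"
  proof (rule step_cfg[OF l _ nx'])
    fix j
    have "act d (\<lambda>j. hd0 (\<sigma> j)) j = (hd0 (\<sigma> j), Stay)" using d by (cases d) auto
    then show "tp n j (\<sigma> j) = ((fst (tp n j (\<sigma> j)))(snd (tp n j (\<sigma> j)) := fst (act d (\<lambda>j. hd0 (\<sigma> j)) j)),
      shift (snd (act d (\<lambda>j. hd0 (\<sigma> j)) j)) (snd (tp n j (\<sigma> j))))"
      by (simp add: tp_upd)
  qed
  then show "reach (n + b + 2) 1 (cfg n (d # l) \<sigma>) (cfg n (nl @ l) \<sigma>)"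
    using ok_cfg[OF f] by (intro reach_1) (auto simp: cfg_def)
  show "nl @ l \<in> conts s c"
    using conts_nxt[OF l wf, of ?r] nx' hd0_less[OF f] by auto
qed

lemma step_pop:
  assumes l: "Pop i # l \<in> conts s c" and f: "fits b \<sigma>"
  shows "reach (n + b + 2) 1 (cfg n (Pop i # l) \<sigma>) (cfg n l (\<sigma>(i := tl (\<sigma> i))))"
    "l \<in> conts s c" "fits b (\<sigma>(i := tl (\<sigma> i)))"
proof -
  let ?r = "(!) (map (\<lambda>j. hd0 (\<sigma> j)) [0..<k])"
  let ?\<sigma> = "\<sigma>(i := tl (\<sigma> i))"
  have i: "i < k" using conts_wfc[OF l wf, of "Pop i"] by simp
  show f': "fits b ?\<sigma>"
    using f i unfolding fits_def by (cases "\<sigma> i") (fastforce split: if_splits)+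
  have "step mach (cfg n (Pop i # l) \<sigma>) = (3 + code ([] @ l), map (\<lambda>j. tp n j (?\<sigma> j)) [0..<k])"
  proof (rule step_cfg[OF l])
    fix j assume "j < k"
    have "hd0 (\<sigma> j) = 0 \<longleftrightarrow> \<sigma> j = []" using f \<open>j < k\<close> unfolding fits_def by (cases "\<sigma> j") auto
    then show "tp n j (?\<sigma> j) = ((fst (tp n j (\<sigma> j)))(snd (tp n j (\<sigma> j)) := fst (act (Pop i) (\<lambda>j. hd0 (\<sigma> j)) j)),
      shift (snd (act (Pop i) (\<lambda>j. hd0 (\<sigma> j)) j)) (snd (tp n j (\<sigma> j))))"
      using tp_pop[of "\<sigma> j" n j] tp_upd[of n j "[]"] by (auto simp: case_prod_beta Let_def tp_upd)
  qed auto
  then show "reach (n + b + 2) 1 (cfg n (Pop i # l) \<sigma>) (cfg n l ?\<sigma>)"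
    using ok_cfg[OF f] ok_cfg[OF f'] by (intro reach_1) (auto simp: cfg_def)
  show "l \<in> conts s c"
    using conts_nxt[OF l wf, of ?r] hd0_less[OF f] by auto
qed

lemma step_push:
  assumes l: "Push i a # l \<in> conts s c" and f: "fits b \<sigma>" and b: "length (\<sigma> i) < b"
  shows "reach (n + b + 2) 2 (cfg n (Push i a # l) \<sigma>) (cfg n l (\<sigma>(i := a # \<sigma> i)))"
    "l \<in> conts s c" "fits b (\<sigma>(i := a # \<sigma> i))"
proof -
  let ?r = "(!) (map (\<lambda>j. hd0 (\<sigma> j)) [0..<k])"
  let ?\<sigma> = "\<sigma>(i := a # \<sigma> i)"
  have i: "i < k" "0 < a" "a < s" using conts_wfc[OF l wf, of "Push i a"] by simp_all
  show f': "fits b ?\<sigma>" using f b i unfolding fits_def by auto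
  have l1: "Wr i a # l \<in> conts s c"
    using conts_nxt[OF l wf, of ?r] hd0_less[OF f] by auto
  show l2: "l \<in> conts s c"
    using conts_nxt[OF l1 wf, of ?r] hd0_less[OF f] by auto
  \<comment> \<open>Halfway through a push: the head has reached the fresh cell, which is still
    blank.\<close>
  define T where "T j = (if j = i then
    (fst (tp n j (\<sigma> j)), shift (if j = 0 then Left else Right) (snd (tp n j (\<sigma> j)))) else tp n j (\<sigma> j))" for j
  define C where "C = (3 + code (Wr i a # l), map T [0..<k])"
  have 1: "step mach (cfg n (Push i a # l) \<sigma>) = C"
    unfolding C_def
  proof (rule step_cfg[OF l, where nl = "[Wr i a]", simplified append_Cons append_Nil])
    fix j
    show "T j = ((fst (tp n j (\<sigma> j)))(snd (tp n j (\<sigma> j)) := fst (act (Push i a) (\<lambda>j. hd0 (\<sigma> j)) j)),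
      shift (snd (act (Push i a) (\<lambda>j. hd0 (\<sigma> j)) j)) (snd (tp n j (\<sigma> j))))"
      by (auto simp: T_def tp_upd)
  qed auto
  let ?as = "map (\<lambda>j. fst (T j) (snd (T j))) [0..<k]"
  have "delta mach (3 + code (Wr i a # l)) ?as = (3 + code l, map (act (Wr i a) ((!) ?as)) [0..<k])"
    using decode_code[OF l1] by (simp add: mach_def dlt_def)
  from step_map[OF _ _ this]
  have "step mach C = (3 + code l, map (\<lambda>j. ((fst (T j))(snd (T j) := fst (act (Wr i a) ((!) ?as) j)),
      shift (snd (act (Wr i a) ((!) ?as) j)) (snd (T j)))) [0..<k])"
    by (simp add: C_def)
  also have "\<dots> = cfg n l ?\<sigma>"
    using tp_push[of n i a "\<sigma> i"]
    by (auto simp: cfg_def T_def case_prod_beta Let_def)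
  finally have 2: "step mach C = cfg n l ?\<sigma>" .
  have "\<bar>snd (T j)\<bar> \<le> int (n + b + 2)" if "j < k" for j
    using tp_bound[OF f that, of n] unfolding T_def by auto
  then have "ok (n + b + 2) C" unfolding C_def by (rule ok_map)
  then have "reach (n + b + 2) (1 + 1) (cfg n (Push i a # l) \<sigma>) (cfg n l ?\<sigma>)"
    using ok_cfg[OF f] ok_cfg[OF f'] 1 2 by (intro reach_trans[of _ _ _ C] reach_1) auto
  then show "reach (n + b + 2) 2 (cfg n (Push i a # l) \<sigma>) (cfg n l ?\<sigma>)" by (simp add: numeral_2_eq_2)
qed

text \<open>The continuation \<open>l\<close> stays arbitrary in the induction, so that a part of a
  compound command can be simulated with the other parts still pending.\<close>

lemma sim:
  assumes "ex (\<lambda>l. l \<le> b) d \<sigma> t \<sigma>'" and "d # l \<in> conts s c" and "fits b \<sigma>"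
  shows "reach (n + b + 2) t (cfg n (d # l) \<sigma>) (cfg n l \<sigma>') \<and> l \<in> conts s c \<and> fits b \<sigma>'"
  using assms
proof (induction arbitrary: l rule: ex.induct)
  case (Skip \<sigma>)
  then show ?case using step_stay[of Skip l b \<sigma> "[]"] by auto
next
  case (Push \<sigma> i a)
  then show ?case using step_push(1)[of i a l b \<sigma> n] step_push(2,3)[of i a l b \<sigma>] by (simp add: Suc_le_eq del: fun_upd_apply)
next
  case (Pop i \<sigma>)
  then show ?case using step_pop(1)[of i l b \<sigma> n] step_pop(2,3)[of i l b \<sigma>] by (simp del: fun_upd_apply)
next
  case (Seq c' \<sigma> t \<sigma>' d u \<sigma>'')
  have 1: "reach (n + b + 2) 1 (cfg n ((c' ;; d) # l) \<sigma>) (cfg n (c' # d # l) \<sigma>)" "c' # d # l \<in> conts s c"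
    using step_stay[of "c' ;; d" l b \<sigma> "[c', d]"] Seq.prems by auto
  have 2: "reach (n + b + 2) t (cfg n (c' # d # l) \<sigma>) (cfg n (d # l) \<sigma>')" "d # l \<in> conts s c" "fits b \<sigma>'"
    using Seq.IH(1)[OF 1(2) Seq.prems(2)] by auto
  show ?case using Seq.IH(2)[OF 2(2,3)] reach_trans[OF reach_trans[OF 1(1) 2(1)]] by blast
next
  case (Case f \<sigma> i t \<sigma>')
  have 1: "reach (n + b + 2) 1 (cfg n (Case i f # l) \<sigma>) (cfg n (f (hd0 (\<sigma> i)) # l) \<sigma>)"
    "f (hd0 (\<sigma> i)) # l \<in> conts s c"
    using step_stay[of "Case i f" l b \<sigma> "[f (hd0 (\<sigma> i))]"] Case.prems by auto
  show ?case using Case.IH[OF 1(2) Case.prems(2)] reach_trans[OF 1(1)] by blast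
next
  case (WhileF \<sigma> i A c')
  then show ?case using step_stay[of "While i A c'" l b \<sigma> "[]"] by auto
next
  case (WhileT \<sigma> i A c' t \<sigma>' u \<sigma>'')
  have 1: "reach (n + b + 2) 1 (cfg n (While i A c' # l) \<sigma>) (cfg n (c' # While i A c' # l) \<sigma>)"
    "c' # While i A c' # l \<in> conts s c"
    using step_stay[of "While i A c'" l b \<sigma> "[c', While i A c']"] WhileT.prems WhileT.hyps by auto
  have 2: "reach (n + b + 2) t (cfg n (c' # While i A c' # l) \<sigma>) (cfg n (While i A c' # l) \<sigma>')"
    "While i A c' # l \<in> conts s c" "fits b \<sigma>'"
    using WhileT.IH(1)[OF 1(2) WhileT.prems(2)] by auto
  show ?case using WhileT.IH(2)[OF 2(2,3)] reach_trans[OF reach_trans[OF 1(1) 2(1)]] by blast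
qed

lemma init_step:
  assumes "length x \<le> b"
  shows "reach (length x + b + 2) 1 (init mach x) (cfg (length x) [c] (start x))" "fits b (start x)"
proof -
  show f: "fits b (start x)" using assms s unfolding fits_def start_def bsym_def by auto
  define T where "T j = (if j = 0 then tape_of x else tape_of [], 0 :: int)" for j :: nat
  have "map T [0..<k] = (tape_of x, 0) # replicate (k - 1) (tape_of [], 0)"
    using k by (auto simp: T_def list_eq_iff_nth_eq nth_Cons')
  then have i: "init mach x = (0, map T [0..<k])" by (simp add: init_def mach_def)
  have ok0: "ok (length x + b + 2) (init mach x)" unfolding i by (rule ok_map) (simp add: T_def)
  let ?as = "map (\<lambda>j. fst (T j) (snd (T j))) [0..<k]"
  have "delta mach 0 ?as = (3 + code [c], map (\<lambda>j. (?as ! j, if j = 0 then Stay else Left)) [0..<k])"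
    by (simp add: mach_def dlt_def)
  from step_map[OF _ _ this]
  have "step mach (init mach x) = (3 + code [c], map (\<lambda>j. ((fst (T j))(snd (T j) := fst (T j) (snd (T j))),
      shift (if j = 0 then Stay else Left) (snd (T j)))) [0..<k])"
    by (simp add: i)
  also have "\<dots> = cfg (length x) [c] (start x)"
    by (auto simp: cfg_def T_def start_def tp_def tape_of_def bsym_def fun_eq_iff nat_less_iff)
  finally show "reach (length x + b + 2) 1 (init mach x) (cfg (length x) [c] (start x))"
    using ok0 ok_cfg[OF f] by (intro reach_1) auto
qed

lemma final_step:
  assumes "fits b \<sigma>"
  shows "reach (n + b + 2) 1 (cfg n [] \<sigma>) (if hd0 (\<sigma> 0) = 2 then 1 else 2, map (\<lambda>j. tp n j (\<sigma> j)) [0..<k])"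
proof -
  let ?as = "map (\<lambda>j. fst (tp n j (\<sigma> j)) (snd (tp n j (\<sigma> j)))) [0..<k]"
  have "delta mach (3 + code []) ?as = (if hd0 (\<sigma> 0) = 2 then 1 else 2, map (\<lambda>j. (?as ! j, Stay)) [0..<k])"
    using decode_code[OF conts_Nil] k by (simp add: mach_def dlt_def tp_read)
  from step_map[OF _ _ this]
  have "step mach (cfg n [] \<sigma>) = (if hd0 (\<sigma> 0) = 2 then 1 else 2, map (\<lambda>j. tp n j (\<sigma> j)) [0..<k])"
    by (simp add: cfg_def)
  moreover have "ok (n + b + 2) (q, map (\<lambda>j. tp n j (\<sigma> j)) [0..<k])" for q
    using ok_cfg[OF assms, of n "[]"] by (simp add: ok_def cfg_def)
  ultimately show ?thesis using ok_cfg[OF assms] by (intro reach_1) simp_all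
qed

lemma run_ex:
  assumes e: "ex (\<lambda>l. l \<le> b) c (start x) t \<sigma>" and b: "length x \<le> b"
  shows "reach (length x + b + 2) (t + 2) (init mach x)
    (if hd0 (\<sigma> 0) = 2 then 1 else 2, map (\<lambda>j. tp (length x) j (\<sigma> j)) [0..<k])" (is "reach ?b _ _ ?C")
proof -
  have "reach ?b t (cfg (length x) [c] (start x)) (cfg (length x) [] \<sigma>)" "fits b \<sigma>"
    using sim[OF e conts_self init_step(2)[OF b], of "length x"] by auto
  then have "reach ?b (1 + t + 1) (init mach x) ?C"
    using init_step(1)[OF b] final_step[of b \<sigma> "length x"] by (blast intro: reach_trans)
  then show ?thesis by simp
qed

end

section \<open>From programs to complexity classes\<close>

lemma halted_stable: "halted C \<Longrightarrow> (step M ^^ t) C = C"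
  by (induction t) (auto simp: step_def)

theorem PSPACE_I:
  fixes c :: com
  assumes "k \<ge> 2" "s \<ge> 3" "wfc k s c"
    and *: "\<And>x. wp (\<lambda>l. l \<le> poly p (length x)) c (start x) (\<lambda>_ \<sigma>. hd0 (\<sigma> 0) = 2 \<longleftrightarrow> x \<in> A)"
    and len: "\<And>n. n \<le> poly p n"
  shows "A \<in> PSPACE"
proof -
  interpret compile k s c by unfold_locales (fact assms)+
  have "\<exists>t C. reach (length x + poly p (length x) + 2) t (init mach x) C \<and> fst C = (if x \<in> A then 1 else 2)" for x
  proof -
    obtain t \<sigma> where "ex (\<lambda>l. l \<le> poly p (length x)) c (start x) t \<sigma>" and h: "hd0 (\<sigma> 0) = 2 \<longleftrightarrow> x \<in> A"
      using *[of x] unfolding wp_def by blast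
    from run_ex[OF this(1) len] h show ?thesis by force
  qed
  then obtain T C where r: "\<And>x. reach (length x + poly p (length x) + 2) (T x) (init mach x) (C x)"
    and C: "\<And>x. fst (C x) = (if x \<in> A then 1 else 2)" by metis
  have hC: "halted (C x)" for x using C[of x] by (simp add: halted_def)
  have "decides mach A"
    unfolding decides_def run_def using r C unfolding reach_def by metis
  moreover have "runs_in_space mach (poly ([:0, 1:] + p + [:2:]))"
    unfolding runs_in_space_def run_def
  proof (intro allI)
    fix x t
    have "ok (length x + poly p (length x) + 2) ((step mach ^^ t) (init mach x))"
    proof (cases "t \<le> T x")
      \<comment> \<open>After halting the configuration, and with it the head positions, no longer
        changes.\<close>
      case False
      then obtain w where "t = w + T x" by (metis le_add_diff_inverse2 nat_le_linear)
      then have "(step mach ^^ t) (init mach x) = C x"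
        using r[of x] halted_stable[OF hC[of x], of w mach] unfolding reach_def by (simp add: funpow_add)
      then show ?thesis using r[of x] unfolding reach_def by auto
    qed (use r in \<open>auto simp: reach_def\<close>)
    then show "\<forall>(_, h)\<in>set (snd ((step mach ^^ t) (init mach x))). \<bar>h\<bar> \<le> int (poly ([:0, 1:] + p + [:2:]) (length x))"
      unfolding ok_def by simp
  qed
  ultimately show ?thesis using wf_mach unfolding PSPACE_def by blast
qed

theorem polytime_I:
  fixes c :: com
  assumes "k \<ge> 2" "s \<ge> 3" "wfc k s c"
    and *: "\<And>x. wp (\<lambda>_. True) c (start x)
      (\<lambda>t \<sigma>. t \<le> poly p (length x) \<and> rev (\<sigma> (k - 1)) = map bsym (f x))"
  shows "polytime_computable f"
proof -
  interpret compile k s c by unfold_locales (fact assms)+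
  have "computes_in_time mach f (poly (p + [:2:]))"
    unfolding computes_in_time_def
  proof
    fix x
    obtain t \<sigma> where "ex (\<lambda>_. True) c (start x) t \<sigma>" and t: "t \<le> poly p (length x)"
      and out: "rev (\<sigma> (k - 1)) = map bsym (f x)" using *[of x] unfolding wp_def by blast
    then obtain b0 where b0: "ex (\<lambda>l. l \<le> b0) c (start x) t \<sigma>" using ex_bounded by blast
    define b where "b = max b0 (length x)"
    have "ex (\<lambda>l. l \<le> b) c (start x) t \<sigma>" using b0 by (rule ex_mono) (simp add: b_def)
    from run_ex[OF this] have r: "run mach x (t + 2) = (if hd0 (\<sigma> 0) = 2 then 1 else 2,
        map (\<lambda>j. tp (length x) j (\<sigma> j)) [0..<k])" (is "_ = ?C")
      unfolding b_def reach_def run_def by auto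
    have h: "halted ?C" by (simp add: halted_def)
    \<comment> \<open>The result is inspected after exactly \<open>poly (p + [:2:])\<close> steps,
      so the machine idles for the remaining \<open>w\<close>. The 2 accounts for the initial and
      the final step.\<close>
    obtain w where w: "poly p (length x) = w + t" using t by (metis le_add_diff_inverse2)
    then have "run mach x (poly (p + [:2:]) (length x)) = (step mach ^^ w) (run mach x (t + 2))"
      unfolding run_def using funpow_add[of w "t + 2" "step mach"] by (simp add: ac_simps)
    then have e: "run mach x (poly (p + [:2:]) (length x)) = ?C"
      using halted_stable[OF h] r by simp
    have "fst (last (snd ?C)) = fst (tp (length x) (k - 1) (\<sigma> (k - 1)))"
      using k by (simp add: last_map)
    \<comment> \<open>An output stack has its bottom in cell 0, so that read from the bottom it is
      the tape: the output is pushed in its natural order.\<close>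
    also have "\<sigma> (k - 1) = rev (map bsym (f x))" using out by (metis rev_rev_ident)
    also have "fst (tp (length x) (k - 1) (rev (map bsym (f x)))) = tape_of (f x)"
    proof -
      have "m - Suc (nat (int m - 1 - i)) = nat i" if "0 \<le> i" "i < int m" for i m
        using that by linarith
      then show ?thesis using k by (auto simp: tp_def tape_of_def fun_eq_iff rev_nth bsym_def)
    qed
    finally show "let C = run mach x (poly (p + [:2:]) (length x)) in halted C \<and> fst (last (snd C)) = tape_of (f x)"
      using e h by simp
  qed
  then show ?thesis using wf_mach unfolding polytime_computable_def by blast
qed

section \<open>Programs that write formulas\<close>

text \<open>Loops over unary counters are the only control structure, so the running time is
  polynomial in the counters by construction. In \<open>For v t r p\<close>, \<open>v\<close> holds
  the index, \<open>t\<close> the iterations still to come, \<open>r\<close> the bound.\<close>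

datatype script = Nop | Emit nat nat | Then script script | For nat nat nat script

type_synonym env = "nat \<Rightarrow> nat"

fun out :: "script \<Rightarrow> env \<Rightarrow> (nat \<times> nat) list" where
  "out Nop \<rho> = []"
| "out (Emit j a) \<rho> = [(j, a)]"
| "out (Then p q) \<rho> = out p \<rho> @ out q \<rho>"
| "out (For v t r p) \<rho> = concat (map (\<lambda>i. out p (\<rho>(v := i))) [0..<\<rho> r])"

definition move :: "nat \<Rightarrow> com \<Rightarrow> com" where
  "move i c = While i {1} (Pop i ;; c)"

text \<open>Copying a unary stack empties it, so the bound \<open>r\<close> is moved to the scratch
  stack 1 and from there back to \<open>r\<close> and into \<open>t\<close>. The last move empties
  \<open>v\<close>, so that \<open>v\<close> and \<open>t\<close> are fresh again after the
  loop.\<close>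

fun comp :: "script \<Rightarrow> com" where
  "comp Nop = Skip"
| "comp (Emit j a) = Push j a"
| "comp (Then p q) = (comp p ;; comp q)"
| "comp (For v t r p) = (move r (Push 1 1) ;; move 1 (Push r 1 ;; Push t 1) ;;
     move t (comp p ;; Push v 1) ;; move v Skip)"

text \<open>\<open>W\<close> are the output stacks, \<open>X\<close> the counters that may be read,
  \<open>Y\<close> the stacks in use for other purposes.\<close>

fun wfs :: "nat \<Rightarrow> nat \<Rightarrow> nat set \<Rightarrow> nat set \<Rightarrow> nat set \<Rightarrow> script \<Rightarrow> bool" where
  "wfs k s W X Y Nop = True"
| "wfs k s W X Y (Emit j a) = (j \<in> W \<and> j < k \<and> 0 < a \<and> a < s)"
| "wfs k s W X Y (Then p q) = (wfs k s W X Y p \<and> wfs k s W X Y q)"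
| "wfs k s W X Y (For v t r p) = (v < k \<and> t < k \<and> r < k \<and> v \<noteq> t \<and> r \<in> X \<and>
     {v, t} \<inter> (X \<union> Y \<union> W \<union> {1}) = {} \<and> wfs k s W (insert v X) (insert t Y) p)"

text \<open>A polynomial in a common bound of all counters. The 30 and 10 of a loop round up 23 and
  7, its overhead per iteration and once.\<close>

fun cost :: "script \<Rightarrow> nat poly" where
  "cost Nop = [:1:]"
| "cost (Emit j a) = [:2:]"
| "cost (Then p q) = cost p + cost q + [:1:]"
| "cost (For v t r p) = [:0, 1:] * (cost p + [:30:]) + [:10:]"

fun emit :: "(nat \<times> nat) list \<Rightarrow> store \<Rightarrow> store" where
  "emit [] \<sigma> = \<sigma>"
| "emit ((j, a) # es) \<sigma> = emit es (\<sigma>(j := a # \<sigma> j))"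

lemma emit_append: "emit (es @ es') \<sigma> = emit es' (emit es \<sigma>)"
  by (induction es arbitrary: \<sigma>) auto

lemma emit_other: "j \<notin> fst ` set es \<Longrightarrow> emit es \<sigma> j = \<sigma> j"
  by (induction es arbitrary: \<sigma>) auto

lemma emit_upd: "j \<notin> fst ` set es \<Longrightarrow> emit es (\<sigma>(j := xs)) = (emit es \<sigma>)(j := xs)"
proof (induction es arbitrary: \<sigma>)
  case (Cons e es)
  obtain i a where e: "e = (i, a)" by force
  with Cons.prems have "i \<noteq> j" by auto
  then have "(\<sigma>(j := xs))(i := a # (\<sigma>(j := xs)) i) = (\<sigma>(i := a # \<sigma> i))(j := xs)" by (auto simp: fun_eq_iff)
  then show ?case using Cons e by (simp del: fun_upd_apply)
qed simp

lemma wfs_wfc: "wfs k s W X Y p \<Longrightarrow> 2 \<le> k \<Longrightarrow> 2 \<le> s \<Longrightarrow> wfc k s (comp p)"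
  by (induction p arbitrary: X Y) (auto simp: move_def)

lemma out_target: "wfs k s W X Y p \<Longrightarrow> e \<in> set (out p \<rho>) \<Longrightarrow> fst e \<in> W"
  by (induction p arbitrary: X Y \<rho>) auto

lemma out_targets: "wfs k s W X Y p \<Longrightarrow> fst ` set (out p \<rho>) \<subseteq> W"
  using out_target by fastforce

abbreviation "any \<equiv> \<lambda>_ :: nat. True"

text \<open>Invariant rule for loops that use up a unary stack. Besides the body each round costs
  three steps: the test, the sequencing and the \<open>Pop\<close>.\<close>

lemma wp_move:
  assumes "\<sigma> i = replicate n 1"
    and step: "\<And>m \<tau>. m < n \<Longrightarrow> I m \<tau> \<Longrightarrow> wp any c (\<tau>(i := replicate (n - Suc m) 1))
      (\<lambda>t \<tau>'. t \<le> b \<and> I (Suc m) \<tau>')"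
    and I: "I 0 \<sigma>" "\<And>m \<tau>. m \<le> n \<Longrightarrow> I m \<tau> \<Longrightarrow> \<tau> i = replicate (n - m) 1"
  shows "wp any (move i c) \<sigma> (\<lambda>t \<tau>. t \<le> n * (b + 3) + 1 \<and> I n \<tau>)"
proof -
  have "wp any (move i c) \<tau> (\<lambda>t \<tau>'. t \<le> d * (b + 3) + 1 \<and> I n \<tau>')" if "I (n - d) \<tau>" "d \<le> n" for d \<tau>
    using that
  proof (induction d arbitrary: \<tau>)
    case 0
    then show ?case using I(2)[of n \<tau>] by (simp add: move_def)
  next
    case (Suc d)
    have n: "n - Suc d < n" "Suc (n - Suc d) = n - d" using Suc.prems by auto
    have t: "\<tau> i = 1 # replicate d 1" using I(2)[OF _ Suc.prems(1)] Suc.prems(2) by simp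
    have "wp any c (\<tau>(i := replicate d 1)) (\<lambda>t \<tau>'. t \<le> b \<and> I (n - d) \<tau>')"
      using step[OF n(1) Suc.prems(1)] n(2) Suc.prems(2) by simp
    then show ?case
      unfolding move_def using t
      by (intro wp_While_step) (auto elim!: wp_mono dest!: Suc.IH[unfolded move_def] simp: Suc.prems Suc_leD[OF Suc.prems(2)])
  qed
  from this[of n \<sigma>] I(1) show ?thesis by simp
qed

text \<open>Unclaimed stacks are empty; this is what lets a loop take them as counters with value
  0.\<close>

definition agree :: "nat set \<Rightarrow> nat set \<Rightarrow> nat set \<Rightarrow> env \<Rightarrow> store \<Rightarrow> bool" where
  "agree W X Y \<rho> \<sigma> \<longleftrightarrow> (\<forall>r\<in>X. \<sigma> r = replicate (\<rho> r) 1) \<and> (\<forall>j. j \<notin> X \<union> Y \<union> W \<longrightarrow> \<sigma> j = []) \<and>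
    1 \<notin> X \<union> Y \<union> W \<and> X \<inter> W = {} \<and> Y \<inter> W = {} \<and> X \<inter> Y = {}"

lemma agree_cong: "agree W X Y \<rho> \<sigma> \<Longrightarrow> (\<And>j. j \<notin> W \<Longrightarrow> \<sigma>' j = \<sigma> j) \<Longrightarrow> agree W X Y \<rho> \<sigma>'"
  unfolding agree_def disjoint_iff by auto

lemma agree_update:
  assumes "agree W X Y \<rho> \<sigma>" "{v, t} \<inter> (X \<union> Y \<union> W \<union> {1}) = {}" "v \<noteq> t"
  shows "agree W (insert v X) (insert t Y) (\<rho>(v := m)) (\<sigma>(t := xs, v := replicate m 1))"
  using assms unfolding agree_def by auto

lemma wp_comp:
  assumes "wfs k s W X Y p" "agree W X Y \<rho> \<sigma>" "\<forall>r\<in>X. \<rho> r \<le> b"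
  shows "wp any (comp p) \<sigma> (\<lambda>t \<sigma>'. t \<le> poly (cost p) b \<and> \<sigma>' = emit (out p \<rho>) \<sigma>)"
  using assms
proof (induction p arbitrary: X Y \<rho> \<sigma>)
  case (Then p q)
  have "agree W X Y \<rho> (emit (out p \<rho>) \<sigma>)"
  proof -
    have "emit (out p \<rho>) \<sigma> j = \<sigma> j" if "j \<notin> W" for j
      using out_targets[of k s W X Y p \<rho>] Then.prems(1) that by (intro emit_other) auto
    then show ?thesis using agree_cong[OF Then.prems(2)] by blast
  qed
  with Then.prems have "wp any (comp q) (emit (out p \<rho>) \<sigma>)
      (\<lambda>t \<sigma>'. t \<le> poly (cost q) b \<and> \<sigma>' = emit (out q \<rho>) (emit (out p \<rho>) \<sigma>))"
    by (intro Then.IH(2)) auto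
  note q = this
  have p: "wp any (comp p) \<sigma> (\<lambda>t \<sigma>'. t \<le> poly (cost p) b \<and> \<sigma>' = emit (out p \<rho>) \<sigma>)"
    using Then.prems by (intro Then.IH(1)) auto
  show ?case
    unfolding comp.simps wp_simps
    apply (rule wp_mono[OF p], elim conjE, hypsubst)
    apply (rule wp_mono[OF q])
    by (simp add: emit_append)
next
  case (For v t r p)
  define n where "n = \<rho> r"
  have d: "v < k" "t < k" "r < k" "v \<noteq> t" "r \<in> X" "v \<notin> X" "v \<notin> Y" "v \<notin> W" "v \<noteq> 1" "t \<notin> X" "t \<notin> Y" "t \<notin> W" "t \<noteq> 1"
    "wfs k s W (insert v X) (insert t Y) p" using For.prems(1) by auto
  have e: "\<sigma> v = []" "\<sigma> t = []" "\<sigma> 1 = []" "\<sigma> r = replicate n 1" "r \<noteq> 1" "r \<noteq> v" "r \<noteq> t" "r \<notin> W"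
    using For.prems(2) d unfolding agree_def n_def by auto
  have nb: "n \<le> b" using For.prems(3) d n_def by auto
  let ?\<sigma>1 = "\<sigma>(r := [], 1 := replicate n 1)" and ?\<sigma>2 = "\<sigma>(t := replicate n 1)"
  have 1: "wp any (move r (Push 1 1)) \<sigma> (\<lambda>u \<tau>. u \<le> n * (2 + 3) + 1 \<and>
      \<tau> = \<sigma>(r := replicate (n - n) 1, 1 := replicate n 1))"
    by (rule wp_move[where I = "\<lambda>m \<tau>. \<tau> = \<sigma>(r := replicate (n - m) 1, 1 := replicate m 1)"])
      (use e in \<open>auto simp: fun_eq_iff\<close>)
  have 2: "wp any (move 1 (Push r 1 ;; Push t 1)) ?\<sigma>1 (\<lambda>u \<tau>. u \<le> n * (5 + 3) + 1 \<and>
      \<tau> = \<sigma>(r := replicate n 1, 1 := replicate (n - n) 1, t := replicate n 1))"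
    by (rule wp_move[where I = "\<lambda>m \<tau>. \<tau> = \<sigma>(r := replicate m 1, 1 := replicate (n - m) 1, t := replicate m 1)"])
      (use e d in \<open>auto simp: fun_eq_iff\<close>)
  define es where "es m = concat (map (\<lambda>i. out p (\<rho>(v := i))) [0..<m])" for m
  have es_Suc: "es (Suc m) = es m @ out p (\<rho>(v := m))" for m by (simp add: es_def)
  have es: "fst ` set (out p (\<rho>(v := i))) \<subseteq> W" "fst ` set (es i) \<subseteq> W" for i
    using out_target[OF d(14)] by (auto simp: es_def)
  have nes: "j \<notin> fst ` set (es i)" "j \<notin> fst ` set (out p (\<rho>(v := i)))" if "j \<notin> W" for i j
    using es[of i] that by auto
  have 3: "wp any (move t (comp p ;; Push v 1)) ?\<sigma>2 (\<lambda>u \<tau>. u \<le> n * (poly (cost p) b + 3 + 3) + 1 \<and>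
      \<tau> = (emit (es n) \<sigma>)(t := replicate (n - n) 1, v := replicate n 1))"
  proof (rule wp_move[where I = "\<lambda>m \<tau>. \<tau> = (emit (es m) \<sigma>)(t := replicate (n - m) 1, v := replicate m 1)"])
    fix m \<tau> assume m: "m < n" "\<tau> = (emit (es m) \<sigma>)(t := replicate (n - m) 1, v := replicate m 1)"
    let ?\<tau> = "\<tau>(t := replicate (n - Suc m) 1)"
    have "agree W (insert v X) (insert t Y) (\<rho>(v := m)) ?\<tau>"
    proof -
      have "emit (es m) \<sigma> j = \<sigma> j" if "j \<notin> W" for j
        using nes(1)[OF that] by (rule emit_other)
      then have "agree W X Y \<rho> (emit (es m) \<sigma>)" using agree_cong[OF For.prems(2)] by blast
      moreover have "?\<tau> = (emit (es m) \<sigma>)(t := replicate (n - Suc m) 1, v := replicate m 1)"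
        using d(4) m(2) by (auto simp: fun_eq_iff)
      ultimately show ?thesis using d by (metis For.prems(1) agree_update wfs.simps(4))
    qed
    moreover have "\<forall>r\<in>insert v X. (\<rho>(v := m)) r \<le> b" using For.prems(3) m nb by auto
    ultimately have "wp any (comp p) ?\<tau> (\<lambda>u \<tau>'. u \<le> poly (cost p) b \<and> \<tau>' = emit (out p (\<rho>(v := m))) ?\<tau>)"
      using For.IH d(14) by blast
    moreover have "(emit (out p (\<rho>(v := m))) ?\<tau>)(v := 1 # emit (out p (\<rho>(v := m))) ?\<tau> v) =
        (emit (es (Suc m)) \<sigma>)(t := replicate (n - Suc m) 1, v := replicate (Suc m) 1)"
      using d nes[OF d(8)] nes[OF d(12)] es_Suc unfolding m(2)
      by (simp add: emit_upd emit_append)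
    ultimately show "wp any (comp p ;; Push v 1) ?\<tau> (\<lambda>u \<tau>'. u \<le> poly (cost p) b + 3 \<and>
        \<tau>' = (emit (es (Suc m)) \<sigma>)(t := replicate (n - Suc m) 1, v := replicate (Suc m) 1))"
      by (auto elim!: wp_mono)
  qed (use e d in \<open>auto simp: es_def fun_eq_iff\<close>)
  let ?\<sigma>3 = "(emit (es n) \<sigma>)(t := [], v := replicate n 1)"
  have 4: "wp any (move v Skip) ?\<sigma>3 (\<lambda>u \<tau>. u \<le> n * (1 + 3) + 1 \<and> \<tau> = (emit (es n) \<sigma>)(t := [], v := replicate (n - n) 1))"
    by (rule wp_move[where I = "\<lambda>m \<tau>. \<tau> = (emit (es n) \<sigma>)(t := [], v := replicate (n - m) 1)"])
      (use e d in \<open>auto simp: fun_eq_iff\<close>)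
  have f1: "\<sigma>(r := replicate (n - n) 1, 1 := replicate n 1) = ?\<sigma>1"
    and f2: "\<sigma>(r := replicate n 1, 1 := replicate (n - n) 1, t := replicate n 1) = ?\<sigma>2"
    and f3: "(emit (es n) \<sigma>)(t := replicate (n - n) 1, v := replicate n 1) = ?\<sigma>3"
    and f4: "(emit (es n) \<sigma>)(t := [], v := replicate (n - n) 1) = emit (es n) \<sigma>"
    using e d nes by (auto simp: fun_eq_iff emit_other)
  have "u1 + (u2 + (u3 + u4)) + 3 \<le> poly (cost (For v t r p)) b"
    if "u1 \<le> n * (2 + 3) + 1" "u2 \<le> n * (5 + 3) + 1" "u3 \<le> n * (poly (cost p) b + 3 + 3) + 1" "u4 \<le> n * (1 + 3) + 1"
    for u1 u2 u3 u4
  proof -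
    have "u1 + (u2 + (u3 + u4)) + 3 \<le> n * (poly (cost p) b + 30) + 10"
      using that by (simp add: algebra_simps)
    also have "\<dots> \<le> b * (poly (cost p) b + 30) + 10" using nb by simp
    finally show ?thesis by simp
  qed
  note arith = this
  have out: "out (For v t r p) \<rho> = es n" by (simp add: es_def n_def)
  show ?case
    unfolding comp.simps wp_simps out
    apply (rule wp_mono[OF 1[unfolded f1]], elim conjE, hypsubst)
    apply (rule wp_mono[OF 2[unfolded f2]], elim conjE, hypsubst)
    apply (rule wp_mono[OF 3[unfolded f3]], elim conjE, hypsubst)
    apply (rule wp_mono[OF 4[unfolded f4]], elim conjE)
    by (drule (3) arith) (simp del: cost.simps)
qed auto

section \<open>Bit strings and formulas that scripts can print\<close>

definition bits :: "nat \<Rightarrow> bool list \<Rightarrow> (nat \<times> nat) list" where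
  "bits j bs = map (\<lambda>b. (j, bsym b)) bs"

lemma bsym_less: "0 < bsym b" "bsym b < 3"
  by (simp_all add: bsym_def)

lemma bits_append: "bits j (bs @ bs') = bits j bs @ bits j bs'"
  by (simp add: bits_def)

lemma bits_concat: "bits j (concat bss) = concat (map (bits j) bss)"
  by (induction bss) (simp_all add: bits_def)

text \<open>A single script must serve all values of the counters. The closure rules below then
  replace any talk of machines by the syntactic shape of a family of formulas.\<close>

definition gens :: "nat \<Rightarrow> nat \<Rightarrow> nat set \<Rightarrow> nat set \<Rightarrow> (env \<Rightarrow> bool list) \<Rightarrow> bool" where
  "gens k j X Y f \<longleftrightarrow> (\<exists>p. wfs k 3 {j} X Y p \<and> (\<forall>\<rho>. out p \<rho> = bits j (f \<rho>)))"

lemma gens_const: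
  assumes "j < k" shows "gens k j X Y (\<lambda>_. bs)"
proof (induction bs)
  case Nil
  show ?case unfolding gens_def by (rule exI[of _ Nop]) (simp add: bits_def)
next
  case (Cons b bs)
  then obtain p where "wfs k 3 {j} X Y p" "\<forall>\<rho>. out p \<rho> = bits j bs" unfolding gens_def by auto
  then show ?case unfolding gens_def
    by (intro exI[of _ "Then (Emit j (bsym b)) p"]) (use assms in \<open>auto simp: bits_def bsym_less\<close>)
qed

lemma gens_append: "gens k j X Y f \<Longrightarrow> gens k j X Y g \<Longrightarrow> gens k j X Y (\<lambda>\<rho>. f \<rho> @ g \<rho>)"
  unfolding gens_def by (elim exE, rule_tac x = "Then p pa" in exI) (simp add: bits_append)

lemma gens_loop:
  assumes "gens k j (insert v X) (insert t Y) f" "v < k" "t < k" "r < k" "v \<noteq> t" "r \<in> X"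
    "{v, t} \<inter> (X \<union> Y \<union> {1, j}) = {}"
  shows "gens k j X Y (\<lambda>\<rho>. concat (map (\<lambda>i. f (\<rho>(v := i))) [0..<\<rho> r]))"
proof -
  obtain p where "wfs k 3 {j} (insert v X) (insert t Y) p" "\<forall>\<rho>. out p \<rho> = bits j (f \<rho>)"
    using assms(1) unfolding gens_def by auto
  then show ?thesis unfolding gens_def
    by (intro exI[of _ "For v t r p"]) (use assms in \<open>auto simp: bits_concat o_def\<close>)
qed

definition gen :: "nat \<Rightarrow> nat \<Rightarrow> nat set \<Rightarrow> nat set \<Rightarrow> (env \<Rightarrow> fm) \<Rightarrow> bool" where
  "gen k j X Y f \<longleftrightarrow> gens k j X Y (\<lambda>\<rho>. enc (f \<rho>))"

definition conjs :: "fm list \<Rightarrow> fm" where "conjs as = foldr Conj as (Var 0)"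
definition disjs :: "fm list \<Rightarrow> fm" where "disjs as = foldr Disj as Fls"

text \<open>In Polish notation a right-nested conjunction is a plain concatenation with no brackets
  to close, so a loop can print it.\<close>

lemma enc_conjs: "enc (conjs as) = concat (map (\<lambda>a. [False, False, True, True] @ enc a) as) @ enc (Var 0)"
  by (induction as) (simp_all add: conjs_def)

lemma gen_const: "j < k \<Longrightarrow> gen k j X Y (\<lambda>_. a)"
  unfolding gen_def by (rule gens_const)

lemma gen_prefix:
  assumes "gen k j X Y f" "j < k" "\<And>a. enc (C a) = bs @ enc a"
  shows "gen k j X Y (\<lambda>\<rho>. C (f \<rho>))"
  unfolding gen_def assms(3) by (intro gens_append gens_const assms(1)[unfolded gen_def] assms(2))

lemma gen_Conj: "gen k j X Y f \<Longrightarrow> gen k j X Y g \<Longrightarrow> j < k \<Longrightarrow> gen k j X Y (\<lambda>\<rho>. Conj (f \<rho>) (g \<rho>))"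
  unfolding gen_def enc.simps by (intro gens_append gens_const)

lemma gen_Disj: "gen k j X Y f \<Longrightarrow> gen k j X Y g \<Longrightarrow> j < k \<Longrightarrow> gen k j X Y (\<lambda>\<rho>. Disj (f \<rho>) (g \<rho>))"
  unfolding gen_def enc.simps by (intro gens_append gens_const)

lemma gen_power:
  assumes "gen k j X Y f" "j < k" "\<And>a. enc (C a) = bs @ enc a"
    and "v < k" "t < k" "r < k" "v \<noteq> t" "r \<in> X" "{v, t} \<inter> (X \<union> Y \<union> {1, j}) = {}"
  shows "gen k j X Y (\<lambda>\<rho>. (C ^^ \<rho> r) (f \<rho>))"
proof -
  have "enc ((C ^^ n) a) = concat (map (\<lambda>_. bs) [0..<n]) @ enc a" for n a
  proof (induction n)
    case (Suc n)
    have "concat (map (\<lambda>_. bs) [0..<Suc n]) = bs @ concat (map (\<lambda>_. bs) [0..<n])"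
      unfolding map_replicate_trivial by simp
    then show ?case using Suc assms(3) by simp
  qed simp
  note enc_power = this
  have "gens k j X Y (\<lambda>\<rho>. concat (map (\<lambda>i. (\<lambda>_. bs) (\<rho>(v := i))) [0..<\<rho> r]))"
    by (intro gens_loop[where v = v and t = t] gens_const assms)
  from gens_append[OF this assms(1)[unfolded gen_def]] show ?thesis
    unfolding gen_def enc_power by simp
qed

lemma gen_conjs_loop:
  assumes "gen k j (insert v X) (insert t Y) f" "j < k" "v < k" "t < k" "r < k" "v \<noteq> t" "r \<in> X"
    "{v, t} \<inter> (X \<union> Y \<union> {1, j}) = {}"
  shows "gen k j X Y (\<lambda>\<rho>. conjs (map (\<lambda>i. f (\<rho>(v := i))) [0..<\<rho> r]))"
  unfolding gen_def enc_conjs map_map o_def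
  by (intro gens_append gens_const gens_loop[where f = "\<lambda>\<rho>. _ @ enc (f \<rho>)" and t = t] assms assms(1)[unfolded gen_def])

lemma gen_conjs:
  assumes "\<And>a. a \<in> set as \<Longrightarrow> gen k j X Y (f a)" "j < k"
  shows "gen k j X Y (\<lambda>\<rho>. conjs (map (\<lambda>a. f a \<rho>) as))"
  using assms(1)
proof (induction as)
  case (Cons a as)
  then show ?case using assms(2) by (auto simp: conjs_def intro!: gen_Conj)
qed (simp add: conjs_def gen_const assms)

lemma gen_disjs:
  assumes "\<And>a. a \<in> set as \<Longrightarrow> gen k j X Y (f a)" "j < k"
  shows "gen k j X Y (\<lambda>\<rho>. disjs (map (\<lambda>a. f a \<rho>) as))"
  using assms(1)
proof (induction as)
  case (Cons a as)
  then show ?case using assms(2) by (auto simp: disjs_def intro!: gen_Disj)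
qed (simp add: disjs_def gen_const assms)

section \<open>Counters of polynomial size and the scan of the input\<close>

fun emits :: "(nat \<times> nat) list \<Rightarrow> script" where
  "emits [] = Nop"
| "emits ((j, a) # es) = Then (Emit j a) (emits es)"

lemma out_emits: "out (emits es) \<rho> = es"
  by (induction es rule: emits.induct) auto

lemma wfs_emits: "(\<And>j a. (j, a) \<in> set es \<Longrightarrow> j \<in> W \<and> j < k \<and> 0 < a \<and> a < s) \<Longrightarrow> wfs k s W X Y (emits es)"
  by (induction es rule: emits.induct) auto

text \<open>Nesting \<open>d\<close> loops bounded by counter 3 emits \<open>es\<close> as often as
  the \<open>d\<close>-th power of that counter; this is how the other counters are set to
  polynomials in the input length.\<close>

fun pows :: "(nat \<times> nat) list \<Rightarrow> nat \<Rightarrow> script" where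
  "pows es 0 = emits es"
| "pows es (Suc d) = For (9 + 2 * d) (10 + 2 * d) 3 (pows es d)"

lemma out_pows: "out (pows es d) \<rho> = concat (replicate (\<rho> 3 ^ d) es)"
proof (induction d arbitrary: \<rho>)
  case (Suc d)
  have "concat (replicate a (concat (replicate b es))) = concat (replicate (a * b) es)" for a b
    by (induction a) (simp_all add: replicate_add)
  then show ?case using Suc by (simp add: map_replicate_trivial)
qed (simp add: out_emits)

lemma wfs_pows:
  assumes "\<And>j a. (j, a) \<in> set es \<Longrightarrow> j \<in> W \<and> j < k \<and> 0 < a \<and> a < s" "30 + 2 * d \<le> k"
    "\<And>x. x \<in> X \<union> Y \<Longrightarrow> x < 9 \<or> 9 + 2 * d \<le> x" "3 \<in> X" "W \<subseteq> {..<9}"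
  shows "wfs k s W X Y (pows es d)"
  using assms
proof (induction d arbitrary: X Y)
  case 0
  then show ?case by (auto intro: wfs_emits)
next
  case (Suc d)
  have "wfs k s W (insert (9 + 2 * d) X) (insert (10 + 2 * d) Y) (pows es d)"
    by (rule Suc.IH) (use Suc.prems in fastforce)+
  moreover have "9 + 2 * d \<notin> X \<union> Y \<union> W" "10 + 2 * d \<notin> X \<union> Y \<union> W"
    using Suc.prems by fastforce+
  ultimately show ?case using Suc.prems by auto
qed

text \<open>
  Counter 3 is 1 plus the length of the input, 4, 5 and 6 are polynomials computed from it, and 7 is the
  current position of the input. The stacks 0 and 8 hold the input, and the loops use 9 and above.
\<close>

definition regs :: "nat \<Rightarrow> nat \<Rightarrow> nat \<Rightarrow> (nat \<times> nat) list" where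
  "regs a b c = replicate a (4, 1) @ replicate b (5, 1) @ replicate c (6, 1)"

lemma emit_replicate: "emit (replicate n (j, a)) \<sigma> = \<sigma>(j := replicate n a @ \<sigma> j)"
  by (induction n arbitrary: \<sigma>) (auto simp: fun_eq_iff replicate_app_Cons_same)

lemma emit_regs: "emit (concat (replicate M (regs a b c))) \<sigma> = \<sigma>(4 := replicate (M * a) 1 @ \<sigma> 4,
    5 := replicate (M * b) 1 @ \<sigma> 5, 6 := replicate (M * c) 1 @ \<sigma> 6)"
proof (induction M arbitrary: \<sigma>)
  case (Suc M)
  have "replicate (x + y) (1 :: nat) = replicate (y + x) 1" for x y by (simp add: add.commute)
  then show ?case unfolding replicate_Suc concat.simps emit_append Suc
    by (simp add: regs_def emit_append emit_replicate fun_eq_iff replicate_add flip: append_assoc)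
qed (simp add: fun_eq_iff)

lemma emit_bits: "emit (bits j bs) \<sigma> = \<sigma>(j := rev (map bsym bs) @ \<sigma> j)"
  by (induction bs arbitrary: \<sigma>) (auto simp: bits_def fun_eq_iff)

text \<open>The branch of a \<open>Case\<close> for the blank is never taken inside the loops below,
  but it has to push a legal symbol all the same.\<close>

definition dig :: "nat \<Rightarrow> nat" where "dig a = (if a = 2 then 2 else 1)"

lemma dig_bsym [simp]: "dig (bsym b) = bsym b"
  by (simp add: dig_def bsym_def)

lemma bsym_mem [simp]: "bsym b \<in> {1, 2}" "bsym b = 2 \<longleftrightarrow> b"
  by (simp_all add: bsym_def)

lemma wp_count:
  "\<sigma> 0 = map bsym x \<Longrightarrow> wp any (While 0 {1, 2} (Case 0 (\<lambda>a. Pop 0 ;; Push 8 (dig a)) ;; Push 3 1)) \<sigma>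
    (\<lambda>t \<tau>. t \<le> length x * 10 + 1 \<and>
      \<tau> = \<sigma>(0 := [], 8 := rev (map bsym x) @ \<sigma> 8, 3 := replicate (length x) 1 @ \<sigma> 3))"
proof (induction x arbitrary: \<sigma>)
  case Nil
  then show ?case by (simp add: fun_eq_iff)
next
  case (Cons b x)
  let ?\<sigma> = "\<sigma>(0 := map bsym x, 8 := bsym b # \<sigma> 8, 3 := 1 # \<sigma> 3)"
  have *: "wp any (While 0 {1, 2} (Case 0 (\<lambda>a. Pop 0 ;; Push 8 (dig a)) ;; Push 3 1)) ?\<sigma>
    (\<lambda>t \<tau>. t \<le> length x * 10 + 1 \<and>
      \<tau> = ?\<sigma>(0 := [], 8 := rev (map bsym x) @ ?\<sigma> 8, 3 := replicate (length x) 1 @ ?\<sigma> 3))"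
    by (rule Cons.IH) simp
  show ?case
    apply (rule wp_While_step)
     apply (simp add: Cons.prems bsym_def)
    apply (simp add: Cons.prems)
    apply (rule wp_mono[OF *[simplified]])
    by (auto simp: fun_eq_iff replicate_app_Cons_same)
qed

lemma wp_back:
  "\<sigma> 8 = rev (map bsym x) \<Longrightarrow> wp any (While 8 {1, 2} (Case 8 (\<lambda>a. Pop 8 ;; Push 0 (dig a)))) \<sigma>
    (\<lambda>t \<tau>. t \<le> length x * 10 + 1 \<and> \<tau> = \<sigma>(8 := [], 0 := map bsym x @ \<sigma> 0))"
proof (induction x arbitrary: \<sigma> rule: rev_induct)
  case Nil
  then show ?case by (simp add: fun_eq_iff)
next
  case (snoc b x)
  let ?\<sigma> = "\<sigma>(8 := rev (map bsym x), 0 := bsym b # \<sigma> 0)"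
  have *: "wp any (While 8 {1, 2} (Case 8 (\<lambda>a. Pop 8 ;; Push 0 (dig a)))) ?\<sigma>
    (\<lambda>t \<tau>. t \<le> length x * 10 + 1 \<and> \<tau> = ?\<sigma>(8 := [], 0 := map bsym x @ ?\<sigma> 0))"
    by (rule snoc.IH) simp
  show ?case
    apply (rule wp_While_step)
     apply (simp add: snoc.prems bsym_def)
    apply (simp add: snoc.prems)
    apply (rule wp_mono[OF *[simplified]])
    by (auto simp: fun_eq_iff)
qed

text \<open>Replaces an arbitrary polynomial by a bound of the shape that \<open>pows\<close> can
  compute.\<close>

lemma poly_bound: "\<exists>c d. \<forall>n. poly (p :: nat poly) n \<le> c * (n + 1) ^ d"
proof (induction p)
  case (pCons a p)
  then obtain c d where c: "\<And>n. poly p n \<le> c * (n + 1) ^ d" by blast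
  have "poly (pCons a p) n \<le> (a + c) * (n + 1) ^ Suc d" for n
  proof -
    have "n * poly p n \<le> (n + 1) * (c * (n + 1) ^ d)" using c by (intro mult_mono) auto
    moreover have "a * 1 \<le> a * (n + 1) ^ Suc d" by (intro mult_le_mono2 one_le_power) simp
    ultimately show ?thesis by (simp add: algebra_simps)
  qed
  then show ?case by blast
qed (intro exI[of _ 0], simp)

definition env_of :: "nat \<Rightarrow> nat \<Rightarrow> nat \<Rightarrow> nat \<Rightarrow> nat \<Rightarrow> nat \<Rightarrow> env" where
  "env_of a b c d n i = (\<lambda>_. 0)(3 := n + 1, 4 := (n + 1) ^ d * a, 5 := (n + 1) ^ d * b, 6 := (n + 1) ^ d * c, 7 := i)"

text \<open>Only the \<open>cell\<close> parts depend on the input bits, and they come in the order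
  of the input. One scan suffices, with counter 7 as the position; what follows depends on the
  length alone.\<close>

theorem generator:
  fixes cell :: "bool \<Rightarrow> env \<Rightarrow> bool list"
  assumes k: "k = 30 + 2 * d" and j: "j = k - 1"
    and cell: "\<And>b. gens k j {3, 4, 5, 6, 7} {0, 8} (cell b)" and rest: "gens k j {3, 4, 5, 6, 7} {0, 8} rest"
  shows "polytime_computable (\<lambda>x. concat (map (\<lambda>i. cell (x ! i) (env_of a b c d (length x) i)) [0..<length x]) @
      rest (env_of a b c d (length x) (length x)))"
proof -
  let ?X = "{3, 4, 5, 6, 7} :: nat set" and ?Y = "{0, 8} :: nat set"
  obtain pc where pc: "\<And>b. wfs k 3 {j} ?X ?Y (pc b)" "\<And>b \<rho>. out (pc b) \<rho> = bits j (cell b \<rho>)"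
    using cell unfolding gens_def by metis
  obtain pr where pr: "wfs k 3 {j} ?X ?Y pr" "\<And>\<rho>. out pr \<rho> = bits j (rest \<rho>)"
    using rest unfolding gens_def by metis
  let ?A1 = "While 0 {1, 2} (Case 0 (\<lambda>a. Pop 0 ;; Push 8 (dig a)) ;; Push 3 1)"
  let ?A2 = "While 8 {1, 2} (Case 8 (\<lambda>a. Pop 8 ;; Push 0 (dig a)))"
  let ?B = "pows (regs a b c) d"
  let ?C = "While 0 {1, 2} (Case 0 (\<lambda>a. comp (pc (a = 2))) ;; Pop 0 ;; Push 7 1)"
  let ?prog = "?A1 ;; Push 3 1 ;; ?A2 ;; comp ?B ;; ?C ;; comp pr"
  have jj: "j \<notin> ?X" "j \<notin> ?Y" "j \<noteq> 1" "j \<noteq> 0" "j < k" "30 \<le> k" using k j by auto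
  have wB: "wfs k 3 {4, 5, 6} {3} {0} ?B"
    by (rule wfs_pows) (use k in \<open>auto simp: regs_def\<close>)
  have wf: "wfc k 3 ?prog"
    using k jj wB pc(1) pr(1) by (auto intro!: wfs_wfc simp: dig_def)
  \<comment> \<open>A common bound of all counters. The exponent is \<open>Suc d\<close> because
    counter 3 is \<open>n + 1\<close> even for \<open>d = 0\<close>.\<close>
  define Bp where "Bp = [:a + b + c + 1:] * [:1, 1:] ^ Suc d"
  have Bp: "poly Bp n = (a + b + c + 1) * (n + 1) ^ Suc d" for n by (simp add: Bp_def)
  have bnd: "env_of a b c d n i r \<le> poly Bp n" if "i \<le> n" for n i r
  proof -
    have 1: "(n + 1) ^ d \<le> (n + 1) ^ Suc d" by simp
    have 2: "n + 1 \<le> (n + 1) ^ Suc d" by (rule self_le_power) simp_all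
    have 3: "(n + 1) ^ d * e \<le> poly Bp n" if "e \<le> a + b + c" for e
      unfolding Bp using mult_mono[OF 1, of e "a + b + c + 1"] that by (simp add: mult.commute)
    have 4: "n + 1 \<le> poly Bp n" unfolding Bp using mult_mono[OF _ 2, of 1 "a + b + c + 1"] by simp
    show ?thesis using 3[of a] 3[of b] 3[of c] 4 that by (auto simp: env_of_def)
  qed
  define q where "q = cost (pc True) + cost (pc False) + [:10:]"
  define T where "T = [:20, 30:] + pcompose (cost ?B) [:1, 1:] + [:0, 1:] * pcompose q Bp + pcompose (cost pr) Bp"
  show ?thesis
  proof (rule polytime_I[OF _ _ wf, where p = T])
    fix x :: "bool list"
    define n where "n = length x"
    define \<rho> where "\<rho> = env_of a b c d n"
    have A: "wp any (?A1 ;; Push 3 1 ;; ?A2) (start x) (\<lambda>t \<sigma>. t \<le> n * 20 + 6 \<and>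
        \<sigma> = (start x)(3 := replicate (n + 1) 1))"
      unfolding wp_simps
      apply (rule wp_mono[OF wp_count[of _ x]], simp add: start_def, elim conjE, hypsubst, rule conjI, simp)
      apply (rule wp_mono[OF wp_back[of _ x]])
      by (auto simp: start_def fun_eq_iff n_def)
    let ?\<sigma>A = "(start x)(3 := replicate (n + 1) 1)"
    have agA: "agree {4, 5, 6} {3} {0} (\<rho> 0) ?\<sigma>A"
      by (auto simp: agree_def start_def \<rho>_def env_of_def)
    have B: "wp any (comp ?B) ?\<sigma>A (\<lambda>t \<sigma>. t \<le> poly (cost ?B) (n + 1) \<and>
        \<sigma> = emit (out ?B (\<rho> 0)) ?\<sigma>A)"
      by (rule wp_comp[OF wB agA]) (simp add: \<rho>_def env_of_def)
    let ?\<sigma>B = "emit (out ?B (\<rho> 0)) ?\<sigma>A"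
    have agB: "agree {j} ?X ?Y (\<rho> 0) ?\<sigma>B" and B0: "?\<sigma>B 0 = map bsym x" and Bj: "?\<sigma>B j = []"
      using jj by (auto simp: agree_def out_pows emit_regs start_def \<rho>_def env_of_def)
    have Cc: "wp any (comp (pc v)) \<sigma> (\<lambda>t \<sigma>'. t \<le> poly (cost (pc v)) (poly Bp n) \<and>
        \<sigma>' = \<sigma>(j := rev (map bsym (cell v (\<rho> i))) @ \<sigma> j))"
      if "agree {j} ?X ?Y (\<rho> i) \<sigma>" "i \<le> n" for v \<sigma> i
      using wp_comp[OF pc(1) that(1), of "poly Bp n"] bnd[OF that(2)] by (simp add: pc(2) emit_bits \<rho>_def)
    have C: "wp any ?C \<sigma> (\<lambda>t \<sigma>'. t \<le> (n - i) * poly q (poly Bp n) + 1 \<and> agree {j} ?X ?Y (\<rho> n) \<sigma>' \<and>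
        \<sigma>' j = rev (map bsym (concat (map (\<lambda>i. cell (x ! i) (\<rho> i)) [i..<n]))) @ \<sigma> j)"
      if "agree {j} ?X ?Y (\<rho> i) \<sigma>" "\<sigma> 0 = map bsym (drop i x)" "i \<le> n" for \<sigma> i
      using that
    proof (induction "n - i" arbitrary: i \<sigma>)
      case 0
      then show ?case by (simp add: n_def)
    next
      case (Suc m)
      then have i: "i < n" by simp
      let ?v = "x ! i"
      have dr: "drop i x = ?v # drop (Suc i) x" using i by (simp add: Cons_nth_drop_Suc n_def)
      let ?\<sigma> = "\<sigma>(j := rev (map bsym (cell ?v (\<rho> i))) @ \<sigma> j)"
      let ?\<sigma>' = "?\<sigma>(0 := map bsym (drop (Suc i) x), 7 := 1 # \<sigma> 7)"
      have ag: "agree {j} ?X ?Y (\<rho> (Suc i)) ?\<sigma>'"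
        using Suc.prems(1) jj unfolding agree_def by (auto simp: \<rho>_def env_of_def)
      have IH: "wp any ?C ?\<sigma>' (\<lambda>t \<sigma>'. t \<le> (n - Suc i) * poly q (poly Bp n) + 1 \<and> agree {j} ?X ?Y (\<rho> n) \<sigma>' \<and>
          \<sigma>' j = rev (map bsym (concat (map (\<lambda>i. cell (x ! i) (\<rho> i)) [Suc i..<n]))) @ ?\<sigma>' j)"
        by (rule Suc.hyps(1)) (use Suc.hyps(2) ag i in auto)
      have q: "poly (cost (pc ?v)) (poly Bp n) + 10 \<le> poly q (poly Bp n)"
        by (cases ?v) (auto simp: q_def)
      have ni: "n - i = Suc (n - Suc i)" using i by simp
      have up: "[i..<n] = i # [Suc i..<n]" using i by (rule upt_conv_Cons)
      have h: "hd0 (\<sigma> 0) = bsym ?v" using Suc.prems(2) dr by simp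
      have e: "?\<sigma>(0 := tl (?\<sigma> 0), 7 := 1 # (?\<sigma>(0 := tl (?\<sigma> 0))) 7) = ?\<sigma>'"
        using jj Suc.prems(2) dr by (auto simp: fun_eq_iff)
      show ?case
        apply (rule wp_While_step)
         apply (simp only: h bsym_mem)
        apply (unfold wp_simps h bsym_mem)
        apply (rule wp_mono[OF Cc[OF Suc.prems(1,3)]], elim conjE, hypsubst)
        apply (rule conjI, simp)
        apply (unfold e)
        apply (rule wp_mono[OF IH])
        using jj q unfolding ni up by auto
    qed
    have D: "wp any (comp pr) \<sigma> (\<lambda>t \<sigma>'. t \<le> poly (cost pr) (poly Bp n) \<and>
        \<sigma>' = \<sigma>(j := rev (map bsym (rest (\<rho> n))) @ \<sigma> j))"
      if "agree {j} ?X ?Y (\<rho> n) \<sigma>" for \<sigma>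
      using wp_comp[OF pr(1) that(1), of "poly Bp n"] bnd[of n n] by (simp add: pr(2) emit_bits \<rho>_def)
    have CC: "wp any ?C ?\<sigma>B (\<lambda>t \<sigma>'. t \<le> n * poly q (poly Bp n) + 1 \<and> agree {j} ?X ?Y (\<rho> n) \<sigma>' \<and>
        \<sigma>' j = rev (map bsym (concat (map (\<lambda>i. cell (x ! i) (\<rho> i)) [0..<n]))))"
      using C[of 0 ?\<sigma>B] agB B0 Bj by simp
    have T: "poly T n = 20 + 30 * n + poly (cost ?B) (n + 1) + n * poly q (poly Bp n) + poly (cost pr) (poly Bp n)"
      by (simp add: T_def poly_pcompose)
    have "wp any (comp ?B ;; ?C ;; comp pr) ?\<sigma>A
        (\<lambda>t \<sigma>. t \<le> poly (cost ?B) (n + 1) + n * poly q (poly Bp n) + poly (cost pr) (poly Bp n) + 3 \<and> rev (\<sigma> j) =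
          map bsym (concat (map (\<lambda>i. cell (x ! i) (\<rho> i)) [0..<n]) @ rest (\<rho> n)))"
      unfolding wp_simps
      apply (rule wp_mono[OF B], elim conjE, hypsubst)
      apply (rule wp_mono[OF CC], elim conjE)
      apply (rule wp_mono[OF D], assumption)
      by (auto simp: rev_map)
    then have "wp any ((?A1 ;; Push 3 1 ;; ?A2) ;; (comp ?B ;; ?C ;; comp pr)) (start x)
        (\<lambda>t \<sigma>. t + 10 \<le> poly T n \<and> rev (\<sigma> j) =
          map bsym (concat (map (\<lambda>i. cell (x ! i) (\<rho> i)) [0..<n]) @ rest (\<rho> n)))"
      unfolding wp_simps(4)[of _ "?A1 ;; Push 3 1 ;; ?A2"] T
      apply -
      apply (rule wp_mono[OF A], elim conjE, hypsubst)
      apply (erule wp_mono)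
      by auto
    then show "wp any ?prog (start x) (\<lambda>t \<sigma>. t \<le> poly T (length x) \<and>
        rev (\<sigma> (k - 1)) = map bsym (concat (map (\<lambda>i. cell (x ! i) (env_of a b c d (length x) i)) [0..<length x]) @
          rest (env_of a b c d (length x) (length x))))"
      unfolding wp_simps \<rho>_def n_def j
      by (auto elim!: wp_mono)
  qed (use k in auto)
qed

section \<open>The formula of a space-bounded computation\<close>

definition dead :: fm where "dead = Box Fls"
definition alive :: fm where "alive = Dia (Var 0)"
definition outer :: fm where "outer = Box alive"
definition inner :: fm where "inner = Dia dead"

text \<open>\<open>outer\<close> and \<open>inner\<close> keep chain successors and tree successors
  apart. The length is \<open>j + 2\<close> because a chain world one step before its dead end has a
  dead successor and would pass for a node, and the dead end itself is the mark that every node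
  carries.\<close>

definition lit :: "bool \<Rightarrow> nat \<Rightarrow> fm" where
  "lit s j = (if s then Dia (Conj outer ((Dia ^^ (j + 2)) dead)) else Box (Disj inner ((Box ^^ (j + 2)) alive)))"

text \<open>Quantification over tree successors only: the chain worlds next to a node, the dead end
  included, satisfy \<open>outer\<close>.\<close>

definition all :: "fm \<Rightarrow> fm" where "all a = Box (Disj outer a)"
definition some :: "fm \<Rightarrow> fm" where "some a = Dia (Conj inner a)"

lemma holds_conjs: "holds R V w (conjs as) \<longleftrightarrow> (\<forall>a\<in>set as. holds R V w a) \<and> w \<in> V 0"
  by (induction as) (auto simp: conjs_def)

lemma holds_disjs: "holds R V w (disjs as) \<longleftrightarrow> (\<exists>a\<in>set as. holds R V w a)"
  by (induction as) (auto simp: disjs_def)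

lemma paths_clash: "holds R V w ((Dia ^^ n) dead) \<Longrightarrow> holds R V w ((Box ^^ n) alive) \<Longrightarrow> False"
  by (induction n arbitrary: w) (auto simp: dead_def alive_def)

lemma outer_inner: "holds R V w outer \<Longrightarrow> holds R V w inner \<Longrightarrow> False"
  by (auto simp: outer_def inner_def dead_def alive_def)

text \<open>This replaces negation in the soundness proof, where both literals of a bit may fail. In
  the intended model exactly one of them holds (\<open>sat_lit\<close>).\<close>

lemma lit_clash: "holds R V w (lit True j) \<Longrightarrow> holds R V w (lit False j) \<Longrightarrow> False"
  using paths_clash[of R V _ "j + 2"] outer_inner[of R V] unfolding lit_def by (auto simp del: funpow.simps)

lemma all_D: "holds R V w (all a) \<Longrightarrow> (w, v) \<in> R \<Longrightarrow> holds R V v inner \<Longrightarrow> holds R V v a"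
  using outer_inner[of R V] by (auto simp: all_def)

text \<open>The bits of a node are coded by the lengths of the chains that it starts; an additional
  dead successor distinguishes it from the worlds of these chains.\<close>

datatype 'n world = Node 'n | Chain nat

inductive_set acc :: "('n \<Rightarrow> nat \<Rightarrow> bool) \<Rightarrow> ('n \<Rightarrow> 'n \<Rightarrow> bool) \<Rightarrow> ('n world \<times> 'n world) set" for bs ch where
  "(Chain (Suc n), Chain n) \<in> acc bs ch"
| "(Node u, Chain 0) \<in> acc bs ch"
| "bs u j \<Longrightarrow> (Node u, Chain (j + 2)) \<in> acc bs ch"
| "ch u v \<Longrightarrow> (Node u, Node v) \<in> acc bs ch"

lemma acc_Chain: "(Chain n, v) \<in> acc bs ch \<longleftrightarrow> (\<exists>m. n = Suc m \<and> v = Chain m)"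
  by (auto elim: acc.cases intro: acc.intros)

lemma acc_Node: "(Node u, v) \<in> acc bs ch \<longleftrightarrow> v = Chain 0 \<or> (\<exists>j. bs u j \<and> v = Chain (j + 2)) \<or> (\<exists>u'. ch u u' \<and> v = Node u')"
  by (auto elim: acc.cases intro: acc.intros simp del: add_2_eq_Suc')

abbreviation "sat bs ch \<equiv> holds (acc bs ch) (\<lambda>_. UNIV)"

lemma sat_dead: "sat bs ch w dead \<longleftrightarrow> w = Chain 0"
proof (cases w)
  case (Chain n)
  then show ?thesis by (cases n) (auto simp: dead_def acc_Chain)
qed (auto simp: dead_def acc_Node)

lemma sat_alive: "sat bs ch w alive \<longleftrightarrow> w \<noteq> Chain 0"
  using sat_dead[of bs ch w] by (simp add: dead_def alive_def) blast

lemma sat_inner: "sat bs ch w inner \<longleftrightarrow> (\<exists>u. w = Node u) \<or> w = Chain 1"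
  by (cases w) (auto simp: inner_def sat_dead acc_Chain acc_Node)

lemma sat_outer: "sat bs ch w outer \<longleftrightarrow> \<not> sat bs ch w inner"
  by (auto simp: inner_def outer_def sat_dead sat_alive)

lemma sat_path: "sat bs ch (Chain n) ((Dia ^^ m) dead) \<longleftrightarrow> n = m"
  by (induction m arbitrary: n) (auto simp: sat_dead acc_Chain)

lemma sat_dual: "sat bs ch w ((Box ^^ m) alive) \<longleftrightarrow> \<not> sat bs ch w ((Dia ^^ m) dead)"
  by (induction m arbitrary: w) (auto simp: sat_dead sat_alive)

lemma sat_lit: "sat bs ch (Node u) (lit s j) \<longleftrightarrow> bs u j = s"
proof -
  have "sat bs ch (Node u) (lit True j) \<longleftrightarrow> bs u j"
    by (auto simp: lit_def acc_Node sat_outer sat_inner sat_path simp del: funpow.simps)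
  moreover have "sat bs ch (Node u) (lit False j) \<longleftrightarrow> \<not> sat bs ch (Node u) (lit True j)"
    by (simp add: lit_def sat_dual sat_outer del: funpow.simps)
  ultimately show ?thesis by (cases s) auto
qed

lemma sat_all: "sat bs ch (Node u) (all a) \<longleftrightarrow> (\<forall>v. ch u v \<longrightarrow> sat bs ch (Node v) a)"
  by (auto simp: all_def acc_Node sat_outer sat_inner)

lemma sat_some: "sat bs ch (Node u) (some a) \<longleftrightarrow> (\<exists>v. ch u v \<and> sat bs ch (Node v) a)"
  by (auto simp: some_def acc_Node sat_outer sat_inner)

section \<open>Facts about configurations and the clauses relating them\<close>

datatype kind = Cell nat nat | Head nat | NoHead nat | State nat

text \<open>Offsets of source and target from a common natural number \<open>i\<close>: a move to
  the left leads from \<open>i + 1\<close> to \<open>i\<close>. Thus no clause mentions a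
  predecessor.\<close>

fun shifts :: "move \<Rightarrow> nat \<times> nat" where
  "shifts Left = (1, 0)"
| "shifts Stay = (0, 0)"
| "shifts Right = (0, 1)"

locale space_machine =
  fixes M :: tm and A :: "bool list set" and p :: "nat poly"
  assumes wf: "wf_tm M" and dec: "decides M A" and space: "runs_in_space M (poly p)"
begin

definition kinds :: "kind set" where
  "kinds = (\<lambda>(\<tau>, a). Cell \<tau> a) ` ({..<tapes M} \<times> {..<symbols M}) \<union> Head ` {..<tapes M} \<union>
     NoHead ` {..<tapes M} \<union> State ` {..<states M}"

definition K :: nat where "K = card kinds"

definition num :: "kind \<Rightarrow> nat" where
  "num = (SOME h. bij_betw h kinds {0..<K})"

lemma kinds_iff [simp]:
  "Cell \<tau> a \<in> kinds \<longleftrightarrow> \<tau> < tapes M \<and> a < symbols M"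
  "Head \<tau> \<in> kinds \<longleftrightarrow> \<tau> < tapes M" "NoHead \<tau> \<in> kinds \<longleftrightarrow> \<tau> < tapes M" "State q \<in> kinds \<longleftrightarrow> q < states M"
  by (auto simp: kinds_def)

lemma finite_kinds: "finite kinds" by (simp add: kinds_def)

lemma num: "bij_betw num kinds {0..<K}"
  unfolding num_def K_def using ex_bij_betw_finite_nat[OF finite_kinds] by (rule someI_ex)

lemma num_less: "k \<in> kinds \<Longrightarrow> num k < K"
  using num bij_betwE by fastforce

lemma num_inj: "k \<in> kinds \<Longrightarrow> k' \<in> kinds \<Longrightarrow> num k = num k' \<longleftrightarrow> k = k'"
  using num unfolding bij_betw_def inj_on_def by blast

text \<open>Interleaves the facts of the first, middle and last configuration of a node
  (\<open>w\<close> is 0, 1, 2). Index 0 is reserved for the mark that tells the first child from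
  the second.\<close>

definition bit :: "nat \<Rightarrow> nat \<Rightarrow> nat" where "bit w e = 3 * e + w + 1"

definition atm :: "bool \<Rightarrow> nat \<Rightarrow> nat \<Rightarrow> kind \<Rightarrow> fm" where
  "atm s w i k = lit s (bit w (i * K + num k))"

text \<open>The child with \<open>lit True 0\<close> covers the first half. The first and third
  clause hand facts down. The second and fourth hand them up, by contraposition: unless the fact
  holds here, every such child satisfies the opposite literal about its last configuration.\<close>

definition node :: "nat \<Rightarrow> fm" where
  "node L = conjs [some (lit True 0), some (lit False 0), conjs (map (\<lambda>i. conjs (map (\<lambda>\<kappa>. conjs [
     Disj (lit False (bit 0 (i * K + \<kappa>))) (all (Disj (lit False 0) (lit True (bit 0 (i * K + \<kappa>))))),
     Disj (lit True (bit 1 (i * K + \<kappa>))) (all (Disj (lit False 0) (lit False (bit 2 (i * K + \<kappa>))))),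
     Disj (lit False (bit 1 (i * K + \<kappa>))) (all (Disj (lit True 0) (lit True (bit 0 (i * K + \<kappa>))))),
     Disj (lit True (bit 2 (i * K + \<kappa>))) (all (Disj (lit True 0) (lit False (bit 2 (i * K + \<kappa>)))))]) [0..<K])) [0..<L])]"

text \<open>Halting states idle, as in \<open>step\<close>, so that the run can be followed for
  exactly a power of two steps.\<close>

definition succ :: "nat \<Rightarrow> nat list \<Rightarrow> nat \<times> (nat \<times> move) list" where
  "succ q as = (if q \<in> {1, 2} then (q, map (\<lambda>a. (a, Stay)) as) else delta M q as)"

text \<open>The absence of a head cannot be inferred from the failure of \<open>Head\<close>, as a
  model may satisfy neither literal. Hence \<open>NoHead\<close> is a fact of its own that moves
  along with the head and licenses the copying of a cell.\<close>

definition moved :: "nat \<Rightarrow> nat \<times> move \<Rightarrow> nat \<Rightarrow> fm" where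
  "moved \<tau> bm i = conjs ([Disj (atm False 0 i (Head \<tau>)) (atm True 2 i (Cell \<tau> (fst bm))),
     Disj (atm False 0 (i + fst (shifts (snd bm))) (Head \<tau>)) (atm True 2 (i + snd (shifts (snd bm))) (Head \<tau>)),
     Disj (atm False 0 (i + fst (shifts (snd bm))) (NoHead \<tau>)) (atm True 2 (i + snd (shifts (snd bm))) (NoHead \<tau>))] @
     map (\<lambda>a. Disj (atm False 0 i (NoHead \<tau>)) (Disj (atm False 0 i (Cell \<tau> a)) (atm True 2 i (Cell \<tau> a)))) [0..<symbols M])"

definition effect :: "nat \<Rightarrow> nat \<Rightarrow> nat list \<Rightarrow> fm" where
  "effect L q as = conjs [atm True 2 0 (State (fst (succ q as))),
     conjs (map (\<lambda>\<tau>. conjs (map (\<lambda>i. moved \<tau> (snd (succ q as) ! \<tau>) i) [0..<L])) [0..<tapes M])]"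

definition transition :: "nat \<Rightarrow> nat \<times> nat list \<Rightarrow> fm" where
  "transition L qa = Disj (atm False 0 0 (State (fst qa))) (Disj
     (disjs (map (\<lambda>\<tau>. conjs (map (\<lambda>i. Disj (atm False 0 i (Head \<tau>)) (atm False 0 i (Cell \<tau> (snd qa ! \<tau>)))) [0..<L])) [0..<tapes M]))
     (effect L (fst qa) (snd qa)))"

text \<open>The \<open>NoHead\<close> facts treat the border of the window: position
  \<open>L\<close> is the source for a move to the left into \<open>L - 1\<close>, and position 0 is
  the target of no move to the right.\<close>

definition leaf :: "nat \<Rightarrow> fm" where
  "leaf L = conjs [conjs (map (\<lambda>\<tau>. Conj (atm True 0 L (NoHead \<tau>)) (atm True 2 0 (NoHead \<tau>))) [0..<tapes M]),
     conjs (map (transition L) (List.product [0..<states M] (List.n_lists (tapes M) [0..<symbols M])))]"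

definition cell :: "nat \<Rightarrow> bool \<Rightarrow> nat \<Rightarrow> fm" where
  "cell H b i = atm True 0 (H + i) (Cell 0 (bsym b))"

text \<open>Position \<open>i\<close> stands for cell \<open>i - H\<close>. The blanks at
  \<open>H + n + i\<close> overshoot the window of length \<open>2 * H\<close>; they are true facts
  of the initial tape there as well.\<close>

definition initial :: "nat \<Rightarrow> nat \<Rightarrow> fm" where
  "initial H n = conjs [atm True 0 0 (State 0),
     conjs (map (\<lambda>\<tau>. atm True 0 H (Head \<tau>)) [0..<tapes M]),
     conjs (map (\<lambda>i. conjs [atm True 0 i (Cell 0 0), atm True 0 (H + n + i) (Cell 0 0),
       conjs (map (\<lambda>\<tau>. Conj (atm True 0 i (Cell \<tau> 0)) (atm True 0 (H + i) (Cell \<tau> 0))) [1..<tapes M]),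
       conjs (map (\<lambda>\<tau>. Conj (atm True 0 i (NoHead \<tau>)) (atm True 0 (H + i + 1) (NoHead \<tau>))) [0..<tapes M])]) [0..<H])]"

definition rest :: "nat \<Rightarrow> nat \<Rightarrow> nat \<Rightarrow> nat \<Rightarrow> fm" where
  "rest H L m n = conjs [initial H n, atm False 2 0 (State 2),
     conjs (map (\<lambda>l. (all ^^ l) (node L)) [0..<m]), (all ^^ m) (leaf L)]"

text \<open>The conjuncts for the input bits come first, so that they can be printed while the input
  is scanned.\<close>

definition formula :: "nat \<Rightarrow> nat \<Rightarrow> nat \<Rightarrow> bool list \<Rightarrow> fm" where
  "formula H L m x = foldr (\<lambda>i a. Conj (cell H (x ! i) i) a) [0..<length x] (rest H L m (length x))"

fun cb :: "nat \<Rightarrow> config \<Rightarrow> nat \<Rightarrow> kind \<Rightarrow> bool" where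
  "cb H c i (Cell \<tau> a) \<longleftrightarrow> fst (snd c ! \<tau>) (int i - int H) = a"
| "cb H c i (Head \<tau>) \<longleftrightarrow> snd (snd c ! \<tau>) = int i - int H"
| "cb H c i (NoHead \<tau>) \<longleftrightarrow> snd (snd c ! \<tau>) \<noteq> int i - int H"
| "cb H c i (State q) \<longleftrightarrow> i = 0 \<and> fst c = q"

definition valid :: "config \<Rightarrow> bool" where
  "valid c \<longleftrightarrow> fst c < states M \<and> length (snd c) = tapes M \<and>
     (\<forall>\<tau><tapes M. \<forall>j. fst (snd c ! \<tau>) j < symbols M)"

definition reads :: "config \<Rightarrow> nat list" where
  "reads c = map (\<lambda>(t, h). t h) (snd c)"

lemma reads_nth: "valid c \<Longrightarrow> \<tau> < tapes M \<Longrightarrow> reads c ! \<tau> = fst (snd c ! \<tau>) (snd (snd c ! \<tau>))"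
  by (simp add: reads_def valid_def case_prod_beta)

lemma reads_ok: "valid c \<Longrightarrow> length (reads c) = tapes M \<and> set (reads c) \<subseteq> {..<symbols M}"
  unfolding reads_def valid_def by (auto simp: case_prod_beta in_set_conv_nth) (metis fst_conv)

lemma reads_less: "valid c \<Longrightarrow> \<tau> < tapes M \<Longrightarrow> reads c ! \<tau> < symbols M"
  by (simp add: reads_nth) (simp add: valid_def)

lemma succ_ok:
  assumes "valid c"
  shows "fst (succ (fst c) (reads c)) < states M" "length (snd (succ (fst c) (reads c))) = tapes M"
    "\<tau> < tapes M \<Longrightarrow> fst (snd (succ (fst c) (reads c)) ! \<tau>) < symbols M"
proof -
  have *: "case delta M (fst c) (reads c) of (q', acts) \<Rightarrow>
      q' < states M \<and> length acts = tapes M \<and> fst ` set acts \<subseteq> {..<symbols M}"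
  proof -
    have "\<forall>q<states M. \<forall>as. length as = tapes M \<and> set as \<subseteq> {..<symbols M} \<longrightarrow> (case delta M q as of (q', acts) \<Rightarrow>
        q' < states M \<and> length acts = tapes M \<and> fst ` set acts \<subseteq> {..<symbols M})"
      using wf unfolding wf_tm_def by (elim conjE)
    moreover have "fst c < states M" using assms by (simp add: valid_def)
    ultimately show ?thesis using reads_ok[OF assms] by (elim allE[of _ "fst c"] allE[of _ "reads c"] impE) simp_all
  qed
  show "fst (succ (fst c) (reads c)) < states M" "length (snd (succ (fst c) (reads c))) = tapes M"
    using * reads_ok[OF assms] assms by (auto simp: succ_def valid_def)
  show "fst (snd (succ (fst c) (reads c)) ! \<tau>) < symbols M" if "\<tau> < tapes M"
  proof (cases "fst c \<in> {1, 2}")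
    case True
    then show ?thesis
      using reads_ok[OF assms] that reads_less[OF assms that] by (auto simp: succ_def)
  next
    case False
    show ?thesis
    proof -
      obtain r acts where d: "delta M (fst c) (reads c) = (r, acts)" by force
      then have "fst (acts ! \<tau>) \<in> fst ` set acts" using * that by simp
      then show ?thesis using * d False by (auto simp: succ_def)
    qed
  qed
qed

lemma step_succ:
  assumes "valid c"
  shows "fst (step M c) = fst (succ (fst c) (reads c))" "length (snd (step M c)) = tapes M"
    "\<tau> < tapes M \<Longrightarrow> snd (step M c) ! \<tau> =
      ((fst (snd c ! \<tau>))(snd (snd c ! \<tau>) := fst (snd (succ (fst c) (reads c)) ! \<tau>)),
       shift (snd (snd (succ (fst c) (reads c)) ! \<tau>)) (snd (snd c ! \<tau>)))"
  using assms succ_ok[OF assms] reads_ok[OF assms] reads_nth[OF assms, of \<tau>]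
  by (auto simp: step_def halted_def succ_def valid_def case_prod_beta Let_def simp flip: reads_def)

lemma valid_step: "valid c \<Longrightarrow> valid (step M c)"
  using step_succ[of c] succ_ok[of c] unfolding valid_def[of "step M c"]
  by (auto simp: valid_def[of c])

lemma valid_run: "valid (run M x t)"
proof (induction t)
  case 0
  show ?case
    using wf by (auto simp: run_def init_def valid_def wf_tm_def tape_of_def nth_Cons')
next
  case (Suc t)
  then show ?case using valid_step by (simp add: run_def)
qed

lemma head_run: "\<tau> < tapes M \<Longrightarrow> \<bar>snd (snd (run M x t) ! \<tau>)\<bar> \<le> int (poly p (length x))"
proof -
  assume "\<tau> < tapes M"
  then have "snd (run M x t) ! \<tau> \<in> set (snd (run M x t))" using valid_run[of x t] by (simp add: valid_def)
  then show ?thesis using space unfolding runs_in_space_def by (fastforce simp: case_prod_beta)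
qed

section \<open>Soundness: a model follows the run\<close>

lemma atm_clash: "holds R V w (atm True v i k) \<Longrightarrow> holds R V w (atm False v i k) \<Longrightarrow> False"
  unfolding atm_def by (rule lit_clash)

definition inside :: "nat \<Rightarrow> nat \<Rightarrow> config \<Rightarrow> bool" where
  "inside H L c \<longleftrightarrow> (\<forall>\<tau><tapes M. - int H < snd (snd c ! \<tau>) \<and> snd (snd c ! \<tau>) < int L - int H)"

text \<open>Unit propagation: every true fact about \<open>c\<close> refutes a negative literal of a
  clause, until only the conclusion about \<open>step M c\<close> remains.\<close>

lemma leaf_sound:
  assumes leaf: "holds R V w (leaf L)" and c: "valid c" "inside H L c" "inside H L (step M c)"
    and U: "\<And>i k. i < L \<Longrightarrow> k \<in> kinds \<Longrightarrow> cb H c i k \<Longrightarrow> holds R V w (atm True 0 i k)"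
    and i: "i < L" and k: "k \<in> kinds" "cb H (step M c) i k"
  shows "holds R V w (atm True 2 i k)"
proof -
  let ?h = "holds R V w"
  define q where "q = fst c"
  define q' where "q' = fst (succ q (reads c))"
  define acts where "acts = snd (succ q (reads c))"
  have L: "0 < L" using i by simp
  have q: "q < states M" using c by (simp add: q_def valid_def)
  have ts: "tapes M > 0" using wf by (simp add: wf_tm_def)
  have nohead: "?h (atm True 0 L (NoHead \<tau>))" "?h (atm True 2 0 (NoHead \<tau>))" if "\<tau> < tapes M" for \<tau>
    using leaf that by (auto simp: leaf_def holds_conjs)
  have "?h (transition L (q, reads c))"
    using leaf reads_ok[OF c(1)] q by (fastforce simp: leaf_def holds_conjs set_n_lists)
  moreover have "\<not> ?h (atm False 0 0 (State q))"
    using U[of 0 "State q"] atm_clash L q by (auto simp: q_def)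
  moreover have "\<not> ?h (conjs (map (\<lambda>i. Disj (atm False 0 i (Head \<tau>)) (atm False 0 i (Cell \<tau> (reads c ! \<tau>)))) [0..<L]))"
    if \<tau>: "\<tau> < tapes M" for \<tau>
  proof -
    define j where "j = nat (snd (snd c ! \<tau>) + int H)"
    have j: "j < L" "snd (snd c ! \<tau>) = int j - int H"
      using c(2) \<tau> by (auto simp: inside_def j_def)
    have "reads c ! \<tau> < symbols M"
      using c(1) \<tau> unfolding reads_nth[OF c(1) \<tau>] valid_def by blast
    then have "?h (atm True 0 j (Head \<tau>))" "?h (atm True 0 j (Cell \<tau> (reads c ! \<tau>)))"
      using U[of j] j \<tau> reads_nth[OF c(1) \<tau>] by auto
    then show ?thesis using j(1) atm_clash by (fastforce simp: holds_conjs)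
  qed
  ultimately have e: "?h (effect L q (reads c))"
    by (fastforce simp: transition_def holds_disjs)
  have m: "?h (moved \<tau> (acts ! \<tau>) i)" if "\<tau> < tapes M" "i < L" for \<tau> i
    using e that by (auto simp: effect_def holds_conjs acts_def)
  have new: "fst (step M c) = q'" "\<And>\<tau>. \<tau> < tapes M \<Longrightarrow> snd (step M c) ! \<tau> =
      ((fst (snd c ! \<tau>))(snd (snd c ! \<tau>) := fst (acts ! \<tau>)), shift (snd (acts ! \<tau>)) (snd (snd c ! \<tau>)))"
    using step_succ[OF c(1)] by (auto simp: q_def q'_def acts_def)
  show ?thesis
  proof (cases k)
    case (State r)
    have "?h (atm True 2 0 (State q'))" using e by (simp add: effect_def holds_conjs q'_def)
    then show ?thesis using k State new(1) by simp
  next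
    case (Cell \<tau> a)
    then have \<tau>: "\<tau> < tapes M" "a < symbols M" using k by auto
    show ?thesis
    proof (cases "snd (snd c ! \<tau>) = int i - int H")
      case True
      then have "fst (acts ! \<tau>) = a" using k Cell \<tau> new by simp
      moreover have "?h (atm True 0 i (Head \<tau>))" using U[OF i, of "Head \<tau>"] \<tau> True by simp
      ultimately show ?thesis
        using m[OF \<tau>(1) i] Cell atm_clash[of R V w 0 i "Head \<tau>"] by (auto simp: moved_def holds_conjs)
    next
      case False
      then have "?h (atm True 0 i (NoHead \<tau>))" "?h (atm True 0 i (Cell \<tau> a))"
        using U[OF i, of "NoHead \<tau>"] U[OF i, of "Cell \<tau> a"] \<tau> k Cell new by auto
      moreover have "?h (Disj (atm False 0 i (NoHead \<tau>)) (Disj (atm False 0 i (Cell \<tau> a)) (atm True 2 i (Cell \<tau> a))))"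
        using m[OF \<tau>(1) i] \<tau>(2) by (auto simp: moved_def holds_conjs)
      ultimately show ?thesis
        using Cell atm_clash[of R V w 0 i] by auto
    qed
  next
    case (Head \<tau>)
    then have \<tau>: "\<tau> < tapes M" using k by auto
    define j where "j = nat (snd (snd c ! \<tau>) + int H)"
    have j: "0 < j" "j < L" "snd (snd c ! \<tau>) = int j - int H"
      using c(2) \<tau> by (auto simp: inside_def j_def)
    have hj: "?h (atm True 0 j (Head \<tau>))" using U[OF j(2), of "Head \<tau>"] \<tau> j by simp
    have s: "shift (snd (acts ! \<tau>)) (int j - int H) = int i - int H"
      using k Head new(2)[OF \<tau>] j by simp
    show ?thesis
    proof (cases "snd (acts ! \<tau>)")
      case Left
      then have "j = i + 1" using s by simp
      then show ?thesis using m[OF \<tau> i] Left hj Head atm_clash[of R V w 0 j "Head \<tau>"]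
        by (auto simp: moved_def holds_conjs)
    next
      case Stay
      then have "j = i" using s by simp
      then show ?thesis using m[OF \<tau> i] Stay hj Head atm_clash[of R V w 0 j "Head \<tau>"]
        by (auto simp: moved_def holds_conjs)
    next
      case Right
      then have "i = j + 1" using s by simp
      then show ?thesis using m[OF \<tau> j(2)] Right hj Head atm_clash[of R V w 0 j "Head \<tau>"]
        by (auto simp: moved_def holds_conjs)
    qed
  next
    case (NoHead \<tau>)
    then have \<tau>: "\<tau> < tapes M" using k by auto
    have hj: "?h (atm True 0 j (NoHead \<tau>))" if "j < L" "snd (snd c ! \<tau>) \<noteq> int j - int H" for j
      using U[OF that(1), of "NoHead \<tau>"] \<tau> that by simp
    have s: "shift (snd (acts ! \<tau>)) (snd (snd c ! \<tau>)) \<noteq> int i - int H"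
      using k NoHead new(2)[OF \<tau>] by simp
    show ?thesis
    proof (cases "snd (acts ! \<tau>)")
      case Left
      \<comment> \<open>For \<open>i + 1 = L\<close> the source lies outside the window, and the
        border fact of \<open>leaf\<close> takes over.\<close>
      have "?h (atm True 0 (i + 1) (NoHead \<tau>))"
        using hj[of "i + 1"] s Left nohead(1)[OF \<tau>] i by (cases "i + 1 = L") auto
      then show ?thesis using m[OF \<tau> i] Left NoHead atm_clash[of R V w 0 "i + 1" "NoHead \<tau>"]
        by (auto simp: moved_def holds_conjs)
    next
      case Stay
      then show ?thesis using m[OF \<tau> i] hj[OF i] s NoHead atm_clash[of R V w 0 i "NoHead \<tau>"]
        by (auto simp: moved_def holds_conjs)
    next
      case Right
      show ?thesis
      proof (cases i)
        case 0
        \<comment> \<open>Position 0 has no left neighbour to inherit from.\<close>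
        then show ?thesis using nohead(2)[OF \<tau>] NoHead by simp
      next
        case (Suc j)
        then show ?thesis using m[of \<tau> j] \<tau> i Right NoHead hj[of j] s atm_clash[of R V w 0 j "NoHead \<tau>"]
          by (auto simp: moved_def holds_conjs)
      qed
    qed
  qed
qed

lemma node_sound:
  assumes "holds R V w (node L)" "i < L" "k \<in> kinds"
  defines "child s v \<equiv> (w, v) \<in> R \<and> holds R V v inner \<and> holds R V v (lit s 0)"
  shows "\<exists>v. child s v"
    "child True v \<Longrightarrow> holds R V w (atm True 0 i k) \<Longrightarrow> holds R V v (atm True 0 i k)"
    "child True v \<Longrightarrow> \<not> holds R V v (atm False 2 i k) \<Longrightarrow> holds R V w (atm True 1 i k)"
    "child False v \<Longrightarrow> holds R V w (atm True 1 i k) \<Longrightarrow> holds R V v (atm True 0 i k)"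
    "child False v \<Longrightarrow> \<not> holds R V v (atm False 2 i k) \<Longrightarrow> holds R V w (atm True 2 i k)"
proof -
  have "holds R V w (some (lit True 0))" "holds R V w (some (lit False 0))"
    and *: "holds R V w (Disj (atm False 0 i k) (all (Disj (lit False 0) (atm True 0 i k))))"
      "holds R V w (Disj (atm True 1 i k) (all (Disj (lit False 0) (atm False 2 i k))))"
      "holds R V w (Disj (atm False 1 i k) (all (Disj (lit True 0) (atm True 0 i k))))"
      "holds R V w (Disj (atm True 2 i k) (all (Disj (lit True 0) (atm False 2 i k))))"
    using assms(1,2) num_less[OF assms(3)] by (auto simp: node_def holds_conjs atm_def)
  then show "\<exists>v. child s v" by (cases s) (auto simp: some_def child_def)
  note clash = atm_clash[of R V w _ i k] lit_clash[of R V v 0] all_D[of R V w _ v]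
  show "child True v \<Longrightarrow> holds R V w (atm True 0 i k) \<Longrightarrow> holds R V v (atm True 0 i k)"
    using *(1) clash unfolding child_def by fastforce
  show "child True v \<Longrightarrow> \<not> holds R V v (atm False 2 i k) \<Longrightarrow> holds R V w (atm True 1 i k)"
    using *(2) clash unfolding child_def by fastforce
  show "child False v \<Longrightarrow> holds R V w (atm True 1 i k) \<Longrightarrow> holds R V v (atm True 0 i k)"
    using *(3) clash unfolding child_def by fastforce
  show "child False v \<Longrightarrow> \<not> holds R V v (atm False 2 i k) \<Longrightarrow> holds R V w (atm True 2 i k)"
    using *(4) clash unfolding child_def by fastforce
qed

text \<open>The failure of a negative literal is what a parent can see of a child through its upward
  clauses, hence the form of the conclusion. The first child establishes the middle facts of
  \<open>w\<close>, these start the second child, and that one establishes the last facts.\<close>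

lemma tree_sound:
  assumes L: "0 < L" and ins: "\<And>t. inside H L (run M x t)"
  shows "(\<And>l. l < d \<Longrightarrow> holds R V w ((all ^^ l) (node L))) \<Longrightarrow> holds R V w ((all ^^ d) (leaf L)) \<Longrightarrow>
    (\<And>i k. i < L \<Longrightarrow> k \<in> kinds \<Longrightarrow> cb H (run M x t) i k \<Longrightarrow> holds R V w (atm True 0 i k)) \<Longrightarrow>
    i < L \<Longrightarrow> k \<in> kinds \<Longrightarrow> cb H (run M x (t + 2 ^ d)) i k \<Longrightarrow> \<not> holds R V w (atm False 2 i k)"
proof (induction d arbitrary: w t i k)
  case 0
  have s: "run M x (t + 2 ^ 0) = step M (run M x t)" by (simp add: run_def)
  have "holds R V w (leaf L)" using "0.prems"(2) by simp
  from leaf_sound[OF this valid_run ins _ "0.prems"(3,4,5)] have "holds R V w (atm True 2 i k)"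
    using "0.prems"(6) ins[of "t + 2 ^ 0"] unfolding s by blast
  then show ?case using atm_clash[of R V w 2 i k] by blast
next
  case (Suc d)
  have node: "holds R V w (node L)" using Suc.prems(1)[of 0] by simp
  note N = node_sound[OF node]
  have down: "holds R V v ((all ^^ l) a)"
    if "holds R V w ((all ^^ Suc l) a)" "(w, v) \<in> R" "holds R V v inner" for v l a
    using all_D[of R V w _ v] that by simp
  have sub: "l < d \<Longrightarrow> holds R V v ((all ^^ l) (node L))" "holds R V v ((all ^^ d) (leaf L))"
    if "(w, v) \<in> R" "holds R V v inner" for v l
    using down[OF _ that] Suc.prems(1)[of "Suc l"] Suc.prems(2) by auto
  obtain v where v: "(w, v) \<in> R" "holds R V v inner" "holds R V v (lit True 0)"
    using N(1)[OF Suc.prems(4,5), of True] by blast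
  have Z: "holds R V w (atm True 1 i k)" if "i < L" "k \<in> kinds" "cb H (run M x (t + 2 ^ d)) i k" for i k
  proof (rule N(3)[OF that(1,2)])
    show "(w, v) \<in> R \<and> holds R V v inner \<and> holds R V v (lit True 0)" using v by blast
    show "\<not> holds R V v (atm False 2 i k)"
      by (rule Suc.IH[OF sub[OF v(1,2)]]) (use that N(2) v Suc.prems(3) in blast)+
  qed
  obtain u where u: "(w, u) \<in> R" "holds R V u inner" "holds R V u (lit False 0)"
    using N(1)[OF Suc.prems(4,5), of False] by blast
  have "holds R V w (atm True 2 i k)"
  proof (rule N(5)[OF Suc.prems(4,5)])
    show "(w, u) \<in> R \<and> holds R V u inner \<and> holds R V u (lit False 0)" using u by blast
    have "cb H (run M x (t + 2 ^ d + 2 ^ d)) i k" using Suc.prems(6) by (simp add: add.assoc mult_2)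
    then show "\<not> holds R V u (atm False 2 i k)"
      by (intro Suc.IH[OF sub[OF u(1,2)]]) (use Suc.prems(4,5) Z N(4) u in blast)+
  qed
  then show ?case using atm_clash[of R V w 2 i k] by blast
qed

lemma initial_sound:
  assumes w: "holds R V w (initial H (length x))" and H: "0 < H"
    and x: "\<And>i. i < length x \<Longrightarrow> holds R V w (cell H (x ! i) i)"
    and k: "i < 2 * H" "k \<in> kinds" "cb H (run M x 0) i k"
  shows "holds R V w (atm True 0 i k)"
proof -
  let ?h = "holds R V w"
  have r: "run M x 0 = (0, (tape_of x, 0) # replicate (tapes M - 1) (tape_of [], 0))"
    by (simp add: run_def init_def)
  have nt: "snd (run M x 0) ! \<tau> = (if \<tau> = 0 then (tape_of x, 0) else (tape_of [], 0))" if "\<tau> < tapes M" for \<tau>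
    using that by (simp add: r nth_Cons')
  have e: "tape_of [] = (\<lambda>_. 0)" by (auto simp: tape_of_def)
  have st: "?h (atm True 0 0 (State 0))" and hd: "\<And>\<tau>. \<tau> < tapes M \<Longrightarrow> ?h (atm True 0 H (Head \<tau>))"
    and c0: "\<And>i. i < H \<Longrightarrow> ?h (atm True 0 i (Cell 0 0))" "\<And>i. i < H \<Longrightarrow> ?h (atm True 0 (H + length x + i) (Cell 0 0))"
    and ct: "\<And>i \<tau>. i < H \<Longrightarrow> 1 \<le> \<tau> \<Longrightarrow> \<tau> < tapes M \<Longrightarrow> ?h (atm True 0 i (Cell \<tau> 0)) \<and> ?h (atm True 0 (H + i) (Cell \<tau> 0))"
    and nh: "\<And>i \<tau>. i < H \<Longrightarrow> \<tau> < tapes M \<Longrightarrow> ?h (atm True 0 i (NoHead \<tau>)) \<and> ?h (atm True 0 (H + i + 1) (NoHead \<tau>))"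
    using w by (auto simp: initial_def holds_conjs)
  show ?thesis
  proof (cases k)
    case (State q)
    then show ?thesis using st k by (simp add: r)
  next
    case (Head \<tau>)
    then show ?thesis using hd[of \<tau>] k nt[of \<tau>] by (auto split: if_splits)
  next
    case (NoHead \<tau>)
    then have "\<tau> < tapes M" "i \<noteq> H" using k nt[of \<tau>] by (auto split: if_splits)
    then show ?thesis using nh[of i \<tau>] nh[of "i - H - 1" \<tau>] k(1) NoHead by (cases "i < H") auto
  next
    case (Cell \<tau> a)
    then have \<tau>: "\<tau> < tapes M" using k by auto
    show ?thesis
    proof (cases "\<tau> = 0")
      case False
      then have "a = 0" using nt[OF \<tau>] k Cell by (simp add: e)
      then show ?thesis
        using ct[of i \<tau>] ct[of "i - H" \<tau>] False \<tau> Cell k(1) by (cases "i < H") auto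
    next
      case True
      then have a: "a = tape_of x (int i - int H)" using nt[OF \<tau>] k Cell by simp
      consider "i < H" | "H \<le> i" "i < H + length x" | "H + length x \<le> i" by linarith
      then show ?thesis
      proof cases
        case 1
        then have "a = 0" using a by (simp add: tape_of_def)
        then show ?thesis using c0(1)[OF 1] Cell True by simp
      next
        case 2
        then have "a = bsym (x ! (i - H))"
          using a by (auto simp: tape_of_def bsym_def nat_diff_distrib' simp flip: of_nat_diff)
        then show ?thesis using x[of "i - H"] 2 Cell True by (simp add: cell_def)
      next
        case 3
        then have "a = 0" using a by (simp add: tape_of_def)
        then show ?thesis using c0(2)[of "i - H - length x"] 3 k(1) Cell True by simp
      qed
    qed
  qed
qed

lemma holds_formula: "holds R V w (formula H L m x) \<longleftrightarrow>
  (\<forall>i<length x. holds R V w (cell H (x ! i) i)) \<and> holds R V w (rest H L m (length x))"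
proof -
  have "holds R V w (foldr (\<lambda>i a. Conj (f i) a) is b) \<longleftrightarrow> (\<forall>i\<in>set is. holds R V w (f i)) \<and> holds R V w b" for f :: "nat \<Rightarrow> fm" and "is" b
    by (induction "is") auto
  then show ?thesis by (auto simp: formula_def)
qed

lemma formula_sound:
  assumes h: "holds R V w (formula H L m x)" and H: "poly p (length x) < H" "2 * H = L"
    and t: "fst (run M x (2 ^ m)) \<in> {1, 2}"
  shows "fst (run M x (2 ^ m)) = 1"
proof (rule ccontr)
  assume "fst (run M x (2 ^ m)) \<noteq> 1"
  then have 2: "fst (run M x (2 ^ m)) = 2" using t by simp
  have L: "0 < L" using H by simp
  have ins: "inside H L (run M x t)" for t
    using head_run[of _ x t] H unfolding inside_def by fastforce
  have r: "holds R V w (rest H L m (length x))" and c: "\<And>i. i < length x \<Longrightarrow> holds R V w (cell H (x ! i) i)"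
    using h by (auto simp: holds_formula)
  have r': "holds R V w (initial H (length x))" "holds R V w (atm False 2 0 (State 2))"
    "\<And>l. l < m \<Longrightarrow> holds R V w ((all ^^ l) (node L))" "holds R V w ((all ^^ m) (leaf L))"
    using r by (auto simp: rest_def holds_conjs)
  \<comment> \<open>The conjunct of \<open>rest\<close> that is refuted here is the one that
    constrains the outcome of the run.\<close>
  have "\<not> holds R V w (atm False 2 0 (State 2))"
  proof (rule tree_sound[OF L ins r'(3,4)])
    show "holds R V w (atm True 0 i k)" if "i < L" "k \<in> kinds" "cb H (run M x 0) i k" for i k
      using initial_sound[OF r'(1) _ c] that H by simp
    show "cb H (run M x (0 + 2 ^ m)) 0 (State 2)" using 2 by simp
    show "State 2 \<in> kinds" using wf by (simp add: wf_tm_def)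
  qed (use L in auto)
  then show False using r'(2) by blast
qed

section \<open>Completeness: the tree of time intervals\<close>

text \<open>A node \<open>(l, t, s)\<close> stands for the times from \<open>t\<close> to
  \<open>t + 2 ^ l\<close>, and \<open>s\<close> marks it as a first or second child. For
  \<open>l = 0\<close> the middle is a default value, which \<open>leaf\<close> does not
  mention.\<close>

definition cfg :: "bool list \<Rightarrow> nat \<times> nat \<times> bool \<Rightarrow> nat \<Rightarrow> config" where
  "cfg x u w = run M x (case u of (l, t, s) \<Rightarrow>
     t + (if w = 0 then 0 else if w = 1 then 2 ^ (l - 1) else 2 ^ l))"

fun bs :: "nat \<Rightarrow> bool list \<Rightarrow> nat \<times> nat \<times> bool \<Rightarrow> nat \<Rightarrow> bool" where
  "bs H x u 0 = snd (snd u)"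
| "bs H x u (Suc j) = (\<exists>k\<in>kinds. num k = j div 3 mod K \<and> cb H (cfg x u (j mod 3)) (j div 3 div K) k)"

fun ch :: "nat \<times> nat \<times> bool \<Rightarrow> nat \<times> nat \<times> bool \<Rightarrow> bool" where
  "ch (l, t, s) (l', t', s') \<longleftrightarrow> l = Suc l' \<and> t' = (if s' then t else t + 2 ^ l')"

abbreviation "tree H x \<equiv> sat (bs H x) ch"

lemma tree_atm:
  assumes "w < 3" "k \<in> kinds"
  shows "tree H x (Node u) (atm s w i k) \<longleftrightarrow> cb H (cfg x u w) i k = s"
proof -
  have "(3 * e + w) div 3 = e" "(3 * e + w) mod 3 = w" for e using assms(1) by auto
  note this[of "i * K + num k"]
  moreover have "(i * K + num k) div K = i" "(i * K + num k) mod K = num k"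
    using num_less[OF assms(2)] by auto
  ultimately have "bs H x u (bit w (i * K + num k)) \<longleftrightarrow> cb H (cfg x u w) i k"
    using assms(2) num_inj unfolding bit_def by (auto simp: num_inj)
  then show ?thesis by (simp add: atm_def sat_lit)
qed

text \<open>The clauses of \<open>node\<close> range over raw bit numbers, so whole configurations
  are compared instead of single facts.\<close>

lemma bs_level:
  assumes "v < 3" "v' < 3" "cfg x u v = cfg x u' v'"
  shows "bs H x u (bit v e) \<longleftrightarrow> bs H x u' (bit v' e)"
proof -
  have "(3 * e + w) div 3 = e" "(3 * e + w) mod 3 = w" if "w < 3" for w using that by auto
  then show ?thesis using assms by (simp add: bit_def)
qed

lemma tree_node: "tree H x (Node (Suc l, t, s)) (node L)"
proof -
  let ?u = "(Suc l, t, s)"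
  have l: "cfg x (l, t, True) 0 = cfg x ?u 0" "cfg x (l, t, True) 2 = cfg x ?u 1"
    and r: "cfg x (l, t + 2 ^ l, False) 0 = cfg x ?u 1" "cfg x (l, t + 2 ^ l, False) 2 = cfg x ?u 2"
    by (simp_all add: cfg_def add.assoc mult_2)
  note eq = bs_level[of _ _ x ?u "(l, t, True)" H] bs_level[of _ _ x ?u "(l, t + 2 ^ l, False)" H]
  have "tree H x (Node ?u) (some (lit True 0)) \<and> tree H x (Node ?u) (some (lit False 0))"
    by (auto simp: sat_some sat_lit)
  then show ?thesis
    using eq(1)[of 0 0] eq(1)[of 1 2] eq(2)[of 1 0] eq(2)[of 2 2] l r
    by (auto simp: node_def holds_conjs sat_all sat_lit)
qed

lemma tree_all: "(\<And>t s. tree H x (Node (d, t, s)) a) \<Longrightarrow> tree H x (Node (d + l, t, s)) ((all ^^ l) a)"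
  by (induction l arbitrary: t s) (auto simp: sat_all)

lemma leaf_complete:
  assumes ins: "\<And>t. inside H L (run M x t)" and L: "0 < L"
  shows "tree H x (Node (0, t, s)) (leaf L)"
proof -
  define c where "c = run M x t"
  define c' where "c' = step M c"
  have v: "valid c" unfolding c_def by (rule valid_run)
  have at: "tree H x (Node (0, t, s)) (atm s' 0 i k) \<longleftrightarrow> cb H c i k = s'"
    "tree H x (Node (0, t, s)) (atm s' 2 i k) \<longleftrightarrow> cb H c' i k = s'" if "k \<in> kinds" for i k s'
    using tree_atm[of 0 k H x "(0, t, s)"] tree_atm[of 2 k H x "(0, t, s)"] that
    by (simp_all add: cfg_def c_def c'_def run_def)
  have in1: "- int H < snd (snd c ! \<tau>)" "snd (snd c ! \<tau>) < int L - int H" if "\<tau> < tapes M" for \<tau>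
    using ins[of t] that unfolding inside_def c_def by auto
  have in2: "- int H < snd (snd c' ! \<tau>)" if "\<tau> < tapes M" for \<tau>
    using ins[of "Suc t"] that unfolding inside_def c_def c'_def run_def by auto
  have "tree H x (Node (0, t, s)) (conjs (map (\<lambda>\<tau>. Conj (atm True 0 L (NoHead \<tau>)) (atm True 2 0 (NoHead \<tau>))) [0..<tapes M]))"
    using in1 in2 by (force simp: holds_conjs at)
  moreover have "tree H x (Node (0, t, s)) (transition L (q, as))"
    if q: "q < states M" and as: "length as = tapes M" "set as \<subseteq> {..<symbols M}" for q as
  proof (cases "q = fst c \<and> as = reads c")
    case False
    consider "q \<noteq> fst c" | \<tau> where "\<tau> < tapes M" "as ! \<tau> \<noteq> reads c ! \<tau>"
      using False as(1) reads_ok[OF v] by (metis nth_equalityI)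
    then show ?thesis
    proof cases
      case 1
      then show ?thesis using q by (auto simp: transition_def at)
    next
      case 2
      have "as ! \<tau> < symbols M" using subsetD[OF as(2) nth_mem[of \<tau> as]] as(1) 2 by auto
      then have "tree H x (Node (0, t, s)) (conjs (map (\<lambda>i. Disj (atm False 0 i (Head \<tau>)) (atm False 0 i (Cell \<tau> (as ! \<tau>)))) [0..<L]))"
        using 2 reads_nth[OF v 2(1)] by (auto simp: holds_conjs at)
      then show ?thesis using 2 by (auto simp: transition_def holds_disjs)
    qed
  next
    case True
    define q' where "q' = fst (succ q as)"
    define acts where "acts = snd (succ q as)"
    have new: "fst c' = q'" "\<And>\<tau>. \<tau> < tapes M \<Longrightarrow> snd c' ! \<tau> =
        ((fst (snd c ! \<tau>))(snd (snd c ! \<tau>) := fst (acts ! \<tau>)), shift (snd (acts ! \<tau>)) (snd (snd c ! \<tau>)))"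
      using step_succ[OF v] True by (auto simp: q'_def acts_def c'_def)
    have lt: "q' < states M" "\<And>\<tau>. \<tau> < tapes M \<Longrightarrow> fst (acts ! \<tau>) < symbols M"
      using succ_ok[OF v] True by (auto simp: q'_def acts_def)
    have "tree H x (Node (0, t, s)) (moved \<tau> (acts ! \<tau>) i)" if \<tau>: "\<tau> < tapes M" for \<tau> i
      using new(2)[OF \<tau>] lt(2)[OF \<tau>] \<tau> in1(1)[OF \<tau>]
      by (cases "snd (acts ! \<tau>)") (auto simp: moved_def holds_conjs at)
    then have "tree H x (Node (0, t, s)) (effect L q as)"
      using new(1) lt(1) by (auto simp: effect_def holds_conjs at simp flip: acts_def q'_def)
    then show ?thesis by (simp add: transition_def)
  qed
  then have "tree H x (Node (0, t, s)) (conjs (map (transition L) (List.product [0..<states M] (List.n_lists (tapes M) [0..<symbols M]))))"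
    by (auto simp: holds_conjs set_n_lists atLeast0LessThan)
  ultimately show ?thesis by (simp add: leaf_def holds_conjs)
qed

lemma initial_complete:
  assumes H: "0 < H" shows "tree H x (Node (m, 0, s)) (initial H (length x))"
    and "i < length x \<Longrightarrow> tree H x (Node (m, 0, s)) (cell H (x ! i) i)"
proof -
  have r: "run M x 0 = (0, (tape_of x, 0) # replicate (tapes M - 1) (tape_of [], 0))"
    by (simp add: run_def init_def)
  have nt: "snd (run M x 0) ! \<tau> = (if \<tau> = 0 then (tape_of x, 0) else (tape_of [], 0))" if "\<tau> < tapes M" for \<tau>
    using that by (simp add: r nth_Cons')
  have e: "tape_of [] = (\<lambda>_. 0)" by (auto simp: tape_of_def)
  have at: "tree H x (Node (m, 0, s)) (atm s' 0 i k) \<longleftrightarrow> cb H (run M x 0) i k = s'" if "k \<in> kinds" for i k s'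
    using tree_atm[of 0 k H x "(m, 0, s)"] that by (simp add: cfg_def)
  have M: "0 < tapes M" "0 < states M" "2 < symbols M" using wf by (auto simp: wf_tm_def)
  have b: "bsym b < symbols M" for b using M by (simp add: bsym_def)
  show "i < length x \<Longrightarrow> tree H x (Node (m, 0, s)) (cell H (x ! i) i)"
    using M b nt[OF M(1)] by (auto simp: cell_def at tape_of_def bsym_def)
  show "tree H x (Node (m, 0, s)) (initial H (length x))"
    using M nt H by (auto simp: initial_def holds_conjs at e tape_of_def r)
qed

lemma formula_complete:
  assumes H: "poly p (length x) < H" "2 * H = L" and acc: "fst (run M x (2 ^ m)) = 1"
  shows "tree H x (Node (m, 0, True)) (formula H L m x)"
proof -
  have ins: "inside H L (run M x t)" for t
    using head_run[of _ x t] H unfolding inside_def by fastforce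
  have L: "0 < H" "0 < L" using H by auto
  have "tree H x (Node (m, 0, True)) (atm False 2 0 (State 2))"
    using acc wf by (subst tree_atm) (auto simp: cfg_def wf_tm_def)
  moreover have "tree H x (Node (m, 0, True)) ((all ^^ l) (node L))" if "l < m" for l
    using tree_all[of H x "m - l" "node L" l 0 True] tree_node[of H x "m - l - 1" _ _ L] that by (simp add: Suc_diff_Suc)
  moreover have "tree H x (Node (m, 0, True)) ((all ^^ m) (leaf L))"
    using tree_all[of H x 0 "leaf L" m 0 True] leaf_complete[OF ins L(2)] by simp
  ultimately show ?thesis
    using initial_complete[OF L(1)] by (auto simp: holds_formula rest_def holds_conjs)
qed

section \<open>Halting time from the number of configurations\<close>

lemma outside_run:
  assumes "\<tau> < tapes M" "int (poly p (length x)) < \<bar>j\<bar>"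
  shows "fst (snd (run M x t) ! \<tau>) j = fst (snd (run M x 0) ! \<tau>) j"
proof (induction t)
  case (Suc t)
  have "run M x (Suc t) = step M (run M x t)" by (simp add: run_def)
  moreover have "snd (snd (run M x t) ! \<tau>) \<noteq> j" using head_run[OF assms(1), of x t] assms(2) by auto
  ultimately show ?case using step_succ(3)[OF valid_run assms(1), of x t] Suc by simp
qed simp

definition pattern :: "nat \<Rightarrow> nat \<Rightarrow> config \<Rightarrow> (nat \<times> kind) set" where
  "pattern H L c = {(i, k). i < L \<and> k \<in> kinds \<and> cb H c i k}"

text \<open>Cells outside the space bound keep their initial contents, so the window determines the
  whole configuration.\<close>

lemma pattern_inj:
  assumes H: "poly p (length x) < H" "2 * H = L"
    and eq: "pattern H L (run M x t) = pattern H L (run M x u)"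
  shows "run M x t = run M x u"
proof -
  have iff: "cb H (run M x t) i k \<longleftrightarrow> cb H (run M x u) i k" if "i < L" "k \<in> kinds" for i k
    using eq that unfolding pattern_def by blast
  have v: "valid (run M x t)" "valid (run M x u)" using valid_run by auto
  have f: "fst (run M x t) = fst (run M x u)"
    using iff[of 0 "State (fst (run M x t))"] v H by (auto simp: valid_def)
  have s: "snd (run M x t) ! \<tau> = snd (run M x u) ! \<tau>" if \<tau>: "\<tau> < tapes M" for \<tau>
  proof (rule prod_eqI)
    define i where "i = nat (snd (snd (run M x t) ! \<tau>) + int H)"
    have i: "i < L" "snd (snd (run M x t) ! \<tau>) = int i - int H"
      using head_run[OF \<tau>, of x t] H by (auto simp: i_def)
    then show "snd (snd (run M x t) ! \<tau>) = snd (snd (run M x u) ! \<tau>)"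
      using iff[of i "Head \<tau>"] \<tau> by simp
    show "fst (snd (run M x t) ! \<tau>) = fst (snd (run M x u) ! \<tau>)"
    proof
      fix j
      show "fst (snd (run M x t) ! \<tau>) j = fst (snd (run M x u) ! \<tau>) j"
      proof (cases "int (poly p (length x)) < \<bar>j\<bar>")
        case True
        then show ?thesis using outside_run[OF \<tau> True, of t] outside_run[OF \<tau> True, of u] by simp
      next
        case False
        define i where "i = nat (j + int H)"
        have i: "i < L" "j = int i - int H" using False H by (auto simp: i_def)
        then show ?thesis
          using iff[of i "Cell \<tau> (fst (snd (run M x t) ! \<tau>) j)"] \<tau> v by (auto simp: valid_def)
      qed
    qed
  qed
  have "snd (run M x t) = snd (run M x u)"
    using v s by (auto simp: valid_def intro: nth_equalityI)
  with f show ?thesis by (rule prod_eqI)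
qed

text \<open>A repetition before the first halting time could be cut out of the run. So the
  configurations up to that time are different subsets of the \<open>L * K\<close> facts; this is
  the origin of the depth of the tree.\<close>

lemma halts_early:
  assumes H: "poly p (length x) < H" "2 * H = L"
  shows "halted (run M x (2 ^ (L * K)))"
proof -
  have stable: "run M x (t + n) = run M x t" if "halted (run M x t)" for t n
    using halted_stable[OF that, of n M] by (simp add: run_def funpow_add add.commute[of t n])
  have shiftT: "run M x (t + n) = run M x (u + n)" if "run M x t = run M x u" for t u n
    using that by (simp add: run_def funpow_add add.commute[of _ n])
  obtain T0 where "halted (run M x T0)"
    using dec unfolding decides_def halted_def by (metis insertCI)
  define T where "T = (LEAST t. halted (run M x t))"
  have T: "halted (run M x T)" "\<And>t. t < T \<Longrightarrow> \<not> halted (run M x t)"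
    unfolding T_def using LeastI[of "\<lambda>t. halted (run M x t)" T0] not_less_Least \<open>halted (run M x T0)\<close> by blast+
  have inj: "inj_on (\<lambda>t. pattern H L (run M x t)) {..<T}"
  proof (rule linorder_inj_onI)
    fix t u assume tu: "t < u" "t \<in> {..<T}" "u \<in> {..<T}"
    show "pattern H L (run M x t) \<noteq> pattern H L (run M x u)"
    proof
      assume "pattern H L (run M x t) = pattern H L (run M x u)"
      from shiftT[OF pattern_inj[OF H this], of "T - u"]
      have "run M x (t + (T - u)) = run M x T" using tu by simp
      moreover have "t + (T - u) < T" using tu by auto
      ultimately show False using T(1) T(2) by metis
    qed
  qed auto
  have "(\<lambda>t. pattern H L (run M x t)) ` {..<T} \<subseteq> Pow ({..<L} \<times> kinds)"
    by (auto simp: pattern_def)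
  then have "T \<le> card (Pow ({..<L} \<times> kinds))"
    using card_inj_on_le[OF inj] finite_kinds by simp
  also have "\<dots> = 2 ^ (L * K)" using finite_kinds by (simp add: card_Pow K_def card_cartesian_product)
  finally show ?thesis using stable[OF T(1), of "2 ^ (L * K) - T"] T(1) by simp
qed

lemma formula_correct:
  assumes H: "poly p (length x) < H" and inf: "infinite (UNIV :: 'w set)"
  shows "satisfiable TYPE('w) (formula H (2 * H) (2 * H * K) x) \<longleftrightarrow> x \<in> A"
proof -
  have st: "fst (run M x (2 ^ (2 * H * K))) \<in> {1, 2}"
    using halts_early[OF H refl] by (simp add: halted_def)
  have iff: "fst (run M x (2 ^ (2 * H * K))) = 1 \<longleftrightarrow> x \<in> A"
  proof -
    obtain t where t: "fst (run M x t) = (if x \<in> A then 1 else 2)" using dec unfolding decides_def by blast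
    have "run M x (max t u) = run M x u" if "halted (run M x u)" for t u
    proof -
      obtain w where "max t u = w + u" by (metis le_add_diff_inverse2 max.cobounded2)
      then show ?thesis using halted_stable[OF that, of w M] by (simp add: run_def funpow_add)
    qed
    then have "run M x t = run M x (2 ^ (2 * H * K))"
      using t st by (metis halted_def insertCI max.commute)
    then show ?thesis using t by (auto split: if_splits)
  qed
  have s: "x \<in> A" if sat: "satisfiable TYPE('w) (formula H (2 * H) (2 * H * K) x)"
  proof -
    obtain R :: "('w \<times> 'w) set" and V and w :: 'w where "holds R V w (formula H (2 * H) (2 * H * K) x)"
      using sat unfolding satisfiable_def by blast
    from formula_sound[OF this H refl st] show ?thesis using iff by simp
  qed
  show ?thesis
  proof
    assume "x \<in> A"
    then have "tree H x (Node (2 * H * K, 0, True)) (formula H (2 * H) (2 * H * K) x)"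
      using formula_complete[OF H refl] iff by blast
    \<comment> \<open>The intended model has its own type of worlds and is transferred to the given
      one afterwards.\<close>
    then have "satisfiable TYPE((nat \<times> nat \<times> bool) world) (formula H (2 * H) (2 * H * K) x)"
      unfolding satisfiable_def kripke_model_def
      by (intro exI[of _ UNIV] exI[of _ "acc (bs H x) ch"] exI[of _ "\<lambda>_. UNIV"]) auto
    then show "satisfiable TYPE('w) (formula H (2 * H) (2 * H * K) x)"
      using inf by (rule satisfiable_transfer)
  qed (rule s)
qed

end

text \<open>Bit numbers are linear in the counters and appear as exponents; a constant factor is
  absorbed by printing a longer block per iteration.\<close>

lemma gen_pow:
  assumes "gen k j X Y f" "j < k" "\<And>a. enc (C a) = bs @ enc a" "set rs \<subseteq> X" "\<forall>r\<in>set rs. r < k"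
    and "v < k" "t < k" "v \<noteq> t" "{v, t} \<inter> (X \<union> Y \<union> {1, j}) = {}"
  shows "gen k j X Y (\<lambda>\<rho>. (C ^^ (q * sum_list (map \<rho> rs) + c)) (f \<rho>))"
  using assms(4,5)
proof (induction rs)
  have *: "enc ((C ^^ n) a) = concat (replicate n bs) @ enc a" for n a
    by (induction n) (simp_all add: assms(3))
  {
    case Nil
    show ?case using gen_prefix[OF assms(1,2) *, of c] by simp
  next
    case (Cons r rs)
    have "(C ^^ (q * sum_list (map \<rho> (r # rs)) + c)) a = ((C ^^ q) ^^ \<rho> r) ((C ^^ (q * sum_list (map \<rho> rs) + c)) a)" for \<rho> a
      by (simp add: funpow_mult distrib_left add.assoc) (simp add: funpow_add)
    then show ?case
      using gen_power[OF Cons.IH assms(2) *[of q], of v t r] Cons.prems assms by auto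
  }
qed

lemma conjs_simps: "conjs [] = Var 0" "conjs (a # as) = Conj a (conjs as)"
  by (simp_all add: conjs_def)

text \<open>Adapts \<open>gen_conjs_loop\<close> to bodies written as functions of the index; these
  must not look up the index in the environment as well.\<close>

lemma gen_conjs_loop':
  assumes "gen k j (insert v X) (insert t Y) (\<lambda>\<rho>. g (\<rho> v) \<rho>)" "\<And>\<rho> i. g i (\<rho>(v := i)) = g i \<rho>"
    "j < k" "v < k" "t < k" "r < k" "v \<noteq> t" "r \<in> X" "{v, t} \<inter> (X \<union> Y \<union> {1, j}) = {}"
  shows "gen k j X Y (\<lambda>\<rho>. conjs (map (\<lambda>i. g i \<rho>) [0..<\<rho> r]))"
  using gen_conjs_loop[OF assms(1,3-9)] assms(2) by simp

lemma gen_lit: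
  assumes "j < k" "15 \<le> k" "set rs \<subseteq> X" "\<forall>r\<in>set rs. r < k" "{11, 12} \<inter> (X \<union> Y \<union> {1, j}) = {}"
  shows "gen k j X Y (\<lambda>\<rho>. lit s (q * sum_list (map \<rho> rs) + c))"
proof (cases s)
  case True
  have "gen k j X Y (\<lambda>\<rho>. (Dia ^^ (q * sum_list (map \<rho> rs) + (c + 2))) dead)"
    by (rule gen_pow[where v = 11 and t = 12]) (use assms in \<open>auto intro: gen_const\<close>)
  from gen_prefix[OF this assms(1), of "\<lambda>a. Dia (Conj outer a)"] show ?thesis
    by (simp add: lit_def True add.assoc del: funpow.simps)
next
  case False
  have "gen k j X Y (\<lambda>\<rho>. (Box ^^ (q * sum_list (map \<rho> rs) + (c + 2))) alive)"
    by (rule gen_pow[where v = 11 and t = 12]) (use assms in \<open>auto intro: gen_const\<close>)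
  from gen_prefix[OF this assms(1), of "\<lambda>a. Box (Disj inner a)"] show ?thesis
    by (simp add: lit_def False add.assoc del: funpow.simps)
qed

lemma gen_all: "gen k j X Y f \<Longrightarrow> j < k \<Longrightarrow> gen k j X Y (\<lambda>\<rho>. all (f \<rho>))"
  by (rule gen_prefix[where C = all]) (auto simp: all_def)

lemma gen_some: "gen k j X Y f \<Longrightarrow> j < k \<Longrightarrow> gen k j X Y (\<lambda>\<rho>. some (f \<rho>))"
  by (rule gen_prefix[where C = some]) (auto simp: some_def)

section \<open>Language and printability of the formula\<close>

definition lang :: "fm set" where "lang = modal_lang {AND, OR, BOX, DIA, FALSE}"

lemma lang_simps [simp]:
  "Var p \<in> lang" "Fls \<in> lang" "Conj a b \<in> lang \<longleftrightarrow> a \<in> lang \<and> b \<in> lang" "Disj a b \<in> lang \<longleftrightarrow> a \<in> lang \<and> b \<in> lang"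
  "Box a \<in> lang \<longleftrightarrow> a \<in> lang" "Dia a \<in> lang \<longleftrightarrow> a \<in> lang"
  by (auto simp: lang_def modal_lang_def)

lemma lang_derived [simp]:
  "dead \<in> lang" "alive \<in> lang" "outer \<in> lang" "inner \<in> lang" "all a \<in> lang \<longleftrightarrow> a \<in> lang" "some a \<in> lang \<longleftrightarrow> a \<in> lang"
  by (simp_all add: dead_def alive_def outer_def inner_def all_def some_def)

lemma lang_power [simp]: "(Dia ^^ n) a \<in> lang \<longleftrightarrow> a \<in> lang" "(Box ^^ n) a \<in> lang \<longleftrightarrow> a \<in> lang" "(all ^^ n) a \<in> lang \<longleftrightarrow> a \<in> lang"
  by (induction n) simp_all

lemma lang_lit [simp]: "lit s j \<in> lang"
  by (simp add: lit_def del: funpow.simps)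

lemma lang_conjs [simp]: "conjs as \<in> lang \<longleftrightarrow> set as \<subseteq> lang" "disjs as \<in> lang \<longleftrightarrow> set as \<subseteq> lang"
  by (induction as) (simp_all add: conjs_def disjs_def)

context space_machine
begin

lemma lang_atm [simp]: "atm s w i k \<in> lang"
  by (simp add: atm_def)

lemma lang_formula: "formula H L m x \<in> lang"
proof -
  have "foldr (\<lambda>i a. Conj (cell H (x ! i) i) a) is b \<in> lang" if "b \<in> lang" for "is" b
    using that by (induction "is") (auto simp: cell_def)
  moreover have "rest H L m n \<in> lang" for n
    by (auto simp: rest_def initial_def node_def leaf_def transition_def effect_def moved_def)
  ultimately show ?thesis unfolding formula_def by blast
qed

lemma enc_formula: "enc (formula H L m x) =
  concat (map (\<lambda>i. [False, False, True, True] @ enc (cell H (x ! i) i)) [0..<length x]) @ enc (rest H L m (length x))"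
proof -
  have "enc (foldr (\<lambda>i a. Conj (f i) a) is b) = concat (map (\<lambda>i. [False, False, True, True] @ enc (f i)) is) @ enc b"
    for f :: "nat \<Rightarrow> fm" and "is" b
    by (induction "is") auto
  from this[of "\<lambda>i. cell H (x ! i) i" "[0..<length x]"] show ?thesis by (simp add: formula_def)
qed

lemma gen_atm:
  assumes "j < k" "15 \<le> k" "set rs \<subseteq> X" "\<forall>r\<in>set rs. r < k" "{11, 12} \<inter> (X \<union> Y \<union> {1, j}) = {}"
  shows "gen k j X Y (\<lambda>\<rho>. atm s w (sum_list (map \<rho> rs) + c) \<kappa>)"
  using gen_lit[OF assms, of s "3 * K" "3 * (c * K + num \<kappa>) + w + 1"]
  by (simp add: atm_def bit_def algebra_simps)

lemma gen_raw:
  assumes "j < k" "15 \<le> k" "{r} \<subseteq> X" "r < k" "{11, 12} \<inter> (X \<union> Y \<union> {1, j}) = {}"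
  shows "gen k j X Y (\<lambda>\<rho>. lit s (bit w (\<rho> r * K + \<kappa>)))"
  using gen_lit[OF assms(1,2) _ _ assms(5), of "[r]" s "3 * K" "3 * \<kappa> + w + 1"] assms
  by (simp add: bit_def algebra_simps)

lemma gen_atm0:
  assumes "j < k" "15 \<le> k" "{11, 12} \<inter> (X \<union> Y \<union> {1, j}) = {}"
  shows "gen k j X Y (\<lambda>\<rho>. atm s w c \<kappa>)"
  using gen_atm[OF assms(1,2) _ _ assms(3), of "[]"] by simp

lemma gen_atm1:
  assumes "j < k" "15 \<le> k" "{11, 12} \<inter> (X \<union> Y \<union> {1, j}) = {}" "r \<in> X" "r < k"
  shows "gen k j X Y (\<lambda>\<rho>. atm s w (\<rho> r) \<kappa>)" "gen k j X Y (\<lambda>\<rho>. atm s w (\<rho> r + c) \<kappa>)"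
  using gen_atm[OF assms(1,2) _ _ assms(3), of "[r]" s w 0] gen_atm[OF assms(1,2) _ _ assms(3), of "[r]" s w c] assms
  by simp_all

lemma gen_atm2:
  assumes "j < k" "15 \<le> k" "{11, 12} \<inter> (X \<union> Y \<union> {1, j}) = {}" "r \<in> X" "r < k" "r' \<in> X" "r' < k"
  shows "gen k j X Y (\<lambda>\<rho>. atm s w (\<rho> r + \<rho> r') \<kappa>)" "gen k j X Y (\<lambda>\<rho>. atm s w (\<rho> r + \<rho> r' + c) \<kappa>)"
  using gen_atm[OF assms(1,2) _ _ assms(3), of "[r, r']" s w 0] gen_atm[OF assms(1,2) _ _ assms(3), of "[r, r']" s w c] assms
  by (simp_all add: add.assoc)

lemma gen_atm3:
  assumes "j < k" "15 \<le> k" "{11, 12} \<inter> (X \<union> Y \<union> {1, j}) = {}" "r \<in> X" "r < k" "r' \<in> X" "r' < k" "q \<in> X" "q < k"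
  shows "gen k j X Y (\<lambda>\<rho>. atm s w (\<rho> r + \<rho> r' + \<rho> q) \<kappa>)"
  using gen_atm[OF assms(1,2) _ _ assms(3), of "[r, r', q]" s w 0] assms by (simp add: add.assoc)

lemma gen_formula:
  assumes j: "j < k" "29 \<le> j"
  defines "X \<equiv> {3, 4, 5, 6, 7}" and "Y \<equiv> {0, 8}"
  shows "gen k j X Y (\<lambda>\<rho>. rest (\<rho> 4) (\<rho> 5) (\<rho> 6) (\<rho> 7))" "gen k j X Y (\<lambda>\<rho>. cell (\<rho> 4) b (\<rho> 7))"
proof -
  have node: "gen k j (insert 13 X) (insert 14 Y) (\<lambda>\<rho>. node (\<rho> 5))"
    unfolding node_def conjs_simps X_def Y_def
    apply (intro gen_Conj gen_Disj gen_const gen_some gen_all gen_conjs_loop'[where v = 9 and t = 10] gen_conjs gen_raw j)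
    using j by simp_all
  have moved: "gen k j (insert 9 X) (insert 10 Y) (\<lambda>\<rho>. moved \<tau> a (\<rho> 9))" for \<tau> a
    unfolding moved_def append_Cons append_Nil conjs_simps X_def Y_def
    apply (intro gen_Conj gen_Disj gen_const gen_conjs gen_atm1 j)
    using j by simp_all
  have effect: "gen k j X Y (\<lambda>\<rho>. effect (\<rho> 5) q as)" for q as
    unfolding effect_def conjs_simps
    apply (intro gen_Conj gen_Disj gen_const gen_conjs_loop'[where v = 9 and t = 10] gen_conjs gen_atm0 moved j)
    using j by (simp_all add: X_def Y_def)
  have transition: "gen k j X Y (\<lambda>\<rho>. transition (\<rho> 5) qa)" for qa
    unfolding transition_def conjs_simps
    apply (intro gen_Conj gen_Disj gen_const gen_disjs gen_conjs_loop'[where v = 9 and t = 10] gen_atm0 gen_atm1 effect j)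
    using j by (simp_all add: X_def Y_def)
  have leaf: "gen k j X Y (\<lambda>\<rho>. leaf (\<rho> 5))"
    unfolding leaf_def conjs_simps
    apply (intro gen_Conj gen_Disj gen_const gen_conjs gen_atm0 gen_atm1 transition j)
    using j by (simp_all add: X_def Y_def)
  have initial: "gen k j X Y (\<lambda>\<rho>. initial (\<rho> 4) (\<rho> 7))"
    unfolding initial_def conjs_simps
    apply (intro gen_Conj gen_const gen_conjs gen_conjs_loop'[where v = 9 and t = 10] gen_atm0 gen_atm3 gen_atm2 gen_atm1 j)
    using j by (simp_all add: X_def Y_def)
  have levels: "gen k j X Y (\<lambda>\<rho>. conjs (map (\<lambda>l. (all ^^ l) (node (\<rho> 5))) [0..<\<rho> 6]))"
    apply (rule gen_conjs_loop'[where v = 13 and t = 14])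
    apply (rule gen_power[where C = all and v = 15 and t = 16 and bs = "[False, True, False, True, False, True, False, False] @ enc outer"])
    using j node by (simp_all add: X_def Y_def all_def)
  have leaves: "gen k j X Y (\<lambda>\<rho>. (all ^^ \<rho> 6) (leaf (\<rho> 5)))"
    apply (rule gen_power[where C = all and v = 15 and t = 16 and bs = "[False, True, False, True, False, True, False, False] @ enc outer"])
    using j leaf by (simp_all add: X_def Y_def all_def)
  show "gen k j X Y (\<lambda>\<rho>. rest (\<rho> 4) (\<rho> 5) (\<rho> 6) (\<rho> 7))"
    unfolding rest_def conjs_simps
    by (intro gen_Conj gen_const initial levels leaves j)
  show "gen k j X Y (\<lambda>\<rho>. cell (\<rho> 4) b (\<rho> 7))"
    unfolding cell_def
    apply (intro gen_atm2 j)
    using j by (simp_all add: X_def Y_def)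
qed

theorem reducible:
  assumes S: "{AND, OR, BOX, DIA, FALSE} \<subseteq> S" and inf: "infinite (UNIV :: 'w set)"
  shows "A \<le>\<^sub>p sat_problem TYPE('w) S"
proof -
  obtain c d where cd: "\<And>n. poly p n \<le> c * (n + 1) ^ d" using poly_bound[of p] by blast
  \<comment> \<open>The factor \<open>c + 1\<close> makes the bound strict. \<open>2 * H\<close> and
    \<open>2 * H * K\<close> have the same shape with other coefficients, as the counters
    require.\<close>
  define H where "H n = (n + 1) ^ d * (c + 1)" for n
  define f where "f x = enc (formula (H (length x)) (2 * H (length x)) (2 * H (length x) * K) x)" for x
  define k where "k = 30 + 2 * d"
  define j where "j = k - 1"
  have j: "j < k" "29 \<le> j" by (auto simp: j_def k_def)
  have pH: "poly p n < H n" for n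
  proof -
    have "H n = c * (n + 1) ^ d + (n + 1) ^ d" by (simp add: H_def algebra_simps)
    moreover have "0 < (n + 1) ^ d" by simp
    ultimately show ?thesis using cd[of n] by linarith
  qed
  let ?e = "env_of (c + 1) (2 * (c + 1)) (2 * (c + 1) * K) d"
  have e: "?e n i 4 = H n" "?e n i 5 = 2 * H n" "?e n i 6 = 2 * H n * K" "?e n i 7 = i" for n i
    by (simp_all add: env_of_def H_def algebra_simps)
  have "polytime_computable (\<lambda>x. concat (map (\<lambda>i. (\<lambda>b \<rho>. [False, False, True, True] @ enc (cell (\<rho> 4) b (\<rho> 7)))
      (x ! i) (?e (length x) i)) [0..<length x]) @
      (\<lambda>\<rho>. enc (rest (\<rho> 4) (\<rho> 5) (\<rho> 6) (\<rho> 7))) (?e (length x) (length x)))"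
    by (rule generator[OF k_def j_def])
      (intro gens_append gens_const j gen_formula[OF j, unfolded gen_def])+
  then have "polytime_computable f"
    unfolding e by (simp add: f_def[abs_def] enc_formula)
  moreover have "x \<in> A \<longleftrightarrow> f x \<in> sat_problem TYPE('w) S" for x
  proof -
    let ?\<phi> = "formula (H (length x)) (2 * H (length x)) (2 * H (length x) * K) x"
    have "?\<phi> \<in> modal_lang S"
      using lang_formula[of "H (length x)" "2 * H (length x)" "2 * H (length x) * K" x] S
      by (auto simp: lang_def modal_lang_def)
    then have "f x \<in> sat_problem TYPE('w) S \<longleftrightarrow> satisfiable TYPE('w) ?\<phi>"
      unfolding sat_problem_def f_def by (auto simp: inj_image_mem_iff[OF inj_enc])
    then show ?thesis using formula_correct[OF pH inf] by blast
  qed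
  ultimately show ?thesis unfolding polytime_reducible_def by blast
qed

end

section \<open>Satisfiability as a game\<close>

datatype hm = HT | HF | HA hm hm | HO hm hm | HB bool hm | HD bool hm

text \<open>A positive literal asks for a path, a negative one forbids it. No index code is a proper
  prefix of another, so different variables do not interfere.\<close>

fun chain :: "bool \<Rightarrow> bool list \<Rightarrow> hm" where
  "chain s [] = (if s then HT else HF)"
| "chain s (b # bs) = (if s then HD b (chain s bs) else HB b (chain s bs))"

text \<open>The sign \<open>s\<close> carries negations inwards. The leading \<open>True\<close>
  starts every literal with the second modality, out of reach of the original boxes, which all use
  \<open>False\<close>.\<close>

fun tr :: "bool \<Rightarrow> fm \<Rightarrow> hm" where
  "tr s (Var p) = chain s (True # enc_nat p)"
| "tr s (NVar p) = chain (\<not> s) (True # enc_nat p)"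
| "tr s (Neg a) = tr (\<not> s) a"
| "tr s (Conj a b) = (if s then HA (tr s a) (tr s b) else HO (tr s a) (tr s b))"
| "tr s (Disj a b) = (if s then HO (tr s a) (tr s b) else HA (tr s a) (tr s b))"
| "tr s (Box a) = (if s then HB False (tr s a) else HD False (tr s a))"
| "tr s (Dia a) = (if s then HD False (tr s a) else HB False (tr s a))"
| "tr s Tru = (if s then HT else HF)"
| "tr s Fls = (if s then HF else HT)"

fun hh :: "(bool \<Rightarrow> ('w \<times> 'w) set) \<Rightarrow> 'w \<Rightarrow> hm \<Rightarrow> bool" where
  "hh R w HT = True"
| "hh R w HF = False"
| "hh R w (HA a b) = (hh R w a \<and> hh R w b)"
| "hh R w (HO a b) = (hh R w a \<or> hh R w b)"
| "hh R w (HB c a) = (\<forall>v. (w, v) \<in> R c \<longrightarrow> hh R v a)"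
| "hh R w (HD c a) = (\<exists>v. (w, v) \<in> R c \<and> hh R v a)"

text \<open>Finite trees with labelled edges are one fixed universe of models, in which given models
  can be joined under a new root by the constructor.\<close>

datatype htree = Branch (children: "(bool \<times> htree) list")

definition htR :: "bool \<Rightarrow> (htree \<times> htree) set" where
  "htR b = {(t, t'). (b, t') \<in> set (children t)}"

definition tsat :: "hm list \<Rightarrow> bool" where
  "tsat \<Gamma> \<longleftrightarrow> (\<exists>t. \<forall>a\<in>set \<Gamma>. hh htR t a)"

lemma chain_dual: "hh R w (chain False bs) \<longleftrightarrow> \<not> hh R w (chain True bs)"
  by (induction bs arbitrary: w) auto

lemma tr_dual: "hh R w (tr False a) \<longleftrightarrow> \<not> hh R w (tr True a)"
proof (induction a arbitrary: w)
  case (Var p)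
  then show ?case using chain_dual[of R w "True # enc_nat p"] by simp
next
  case (NVar p)
  then show ?case using chain_dual[of R w "True # enc_nat p"] by simp
qed auto

text \<open>A variable is declared true wherever its translation holds; this turns any model of the
  translation into a model of the formula.\<close>

lemma hh_model: "hh R w (tr True a) \<longleftrightarrow> holds (R False) (\<lambda>p. {w. hh R w (tr True (Var p))}) w a"
proof (induction a arbitrary: w)
  case (NVar p)
  then show ?case using chain_dual[of R w "True # enc_nat p"] by simp
next
  case (Neg a)
  then show ?case using tr_dual[of R w a] by simp
qed auto

lemma tsat_satisfiable: "tsat [tr True a] \<Longrightarrow> satisfiable TYPE(htree) a"
proof -
  assume "tsat [tr True a]"
  then obtain t where "hh htR t (tr True a)" by (auto simp: tsat_def)
  then have "holds (htR False) (\<lambda>p. {w. hh htR w (tr True (Var p))}) t a" by (rule hh_model[THEN iffD1])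
  then show ?thesis unfolding satisfiable_def kripke_model_def
    by (rule_tac x = UNIV in exI, rule_tac x = "htR False" in exI,
        rule_tac x = "\<lambda>p. {w. hh htR w (tr True (Var p))}" in exI) auto
qed

text \<open>A variable is simulated by an edge to a fresh chain that spells out its index.\<close>

definition unR :: "('w \<times> 'w) set \<Rightarrow> (nat \<Rightarrow> 'w set) \<Rightarrow> bool \<Rightarrow> (('w + bool list) \<times> ('w + bool list)) set" where
  "unR R V b = {(Inr (b # bs), Inr bs) | bs. True} \<union>
     (if b then {(Inl w, Inr (enc_nat p)) | w p. w \<in> V p} else {(Inl w, Inl v) | w v. (w, v) \<in> R})"

lemma unR_Inr: "hh (unR R V) (Inr cs) (chain True bs) \<longleftrightarrow> (\<exists>ds. cs = bs @ ds)"
  by (induction bs arbitrary: cs) (auto simp: unR_def)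

lemma unR_holds: "hh (unR R V) (Inl w) (tr True a) \<longleftrightarrow> holds R V w a"
proof -
  have v: "hh (unR R V) (Inl w) (tr True (Var p)) \<longleftrightarrow> w \<in> V p" for w p
  proof -
    have "hh (unR R V) (Inl w) (tr True (Var p)) \<longleftrightarrow> (\<exists>q. w \<in> V q \<and> (\<exists>ds. enc_nat q = enc_nat p @ ds))"
      by (auto simp: unR_def simp flip: unR_Inr[of R V])
    \<comment> \<open>An index code that is a prefix of another one is equal to it.\<close>
    also have "\<dots> \<longleftrightarrow> w \<in> V p"
      using enc_nat_cancel[of _ "[]" p] by (metis append_Nil2)
    finally show ?thesis .
  qed
  show ?thesis
  proof (induction a arbitrary: w)
    case (Var p)
    show ?case using v by simp
  next
    case (NVar p)
    have "hh (unR R V) (Inl w) (tr True (NVar p)) \<longleftrightarrow> \<not> hh (unR R V) (Inl w) (tr True (Var p))"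
      using chain_dual[of "unR R V" "Inl w" "True # enc_nat p"] by simp
    then show ?case by (simp only: v holds.simps)
  next
    case (Neg a)
    then show ?case using tr_dual[of "unR R V" "Inl w" a] by simp
  qed (auto simp: unR_def)
qed

section \<open>Tableau rules: resolving connectives and following a diamond\<close>

definition comb :: "(hm list \<times> bool) set \<Rightarrow> (hm list \<times> bool) set \<Rightarrow> (hm list \<times> bool) set" where
  "comb A B = {(\<Delta>1 @ \<Delta>2, l1 \<or> l2) | \<Delta>1 l1 \<Delta>2 l2. (\<Delta>1, l1) \<in> A \<and> (\<Delta>2, l2) \<in> B}"

lemma comb_iff: "(\<Delta>, l) \<in> comb A B \<longleftrightarrow> (\<exists>\<Delta>1 l1 \<Delta>2 l2. (\<Delta>1, l1) \<in> A \<and> (\<Delta>2, l2) \<in> B \<and> \<Delta> = \<Delta>1 @ \<Delta>2 \<and> l = (l1 \<or> l2))"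
  unfolding comb_def by (simp, blast)

lemma combI: "(\<Delta>1, l1) \<in> A \<Longrightarrow> (\<Delta>2, l2) \<in> B \<Longrightarrow> (\<Delta>1 @ \<Delta>2, l1 \<or> l2) \<in> comb A B"
  unfolding comb_iff by blast

lemma comb_bex: "(\<exists>(\<Delta>, l) \<in> comb A B. f \<Delta> l) \<longleftrightarrow> (\<exists>(\<Delta>, l) \<in> A. \<exists>(\<Delta>', l') \<in> B. f (\<Delta> @ \<Delta>') (l \<or> l'))"
proof -
  have e: "(\<exists>(\<Delta>, l) \<in> X. f \<Delta> l) \<longleftrightarrow> (\<exists>\<Delta> l. (\<Delta>, l) \<in> X \<and> f \<Delta> l)" for X and f :: "hm list \<Rightarrow> bool \<Rightarrow> bool"
    by auto
  show ?thesis unfolding e comb_iff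
    by (intro iffI; elim exE conjE; hypsubst?; intro exI conjI; (assumption | rule refl))
qed

lemma comb_False: "(\<exists>\<Delta>. (\<Delta>, False) \<in> comb A B \<and> (\<forall>d\<in>set \<Delta>. Q d)) \<longleftrightarrow>
    (\<exists>\<Delta>. (\<Delta>, False) \<in> A \<and> (\<forall>d\<in>set \<Delta>. Q d)) \<and> (\<exists>\<Delta>. (\<Delta>, False) \<in> B \<and> (\<forall>d\<in>set \<Delta>. Q d))"
proof -
  have "(\<Delta>, False) \<in> comb A B \<longleftrightarrow> (\<exists>\<Delta>1 \<Delta>2. (\<Delta>1, False) \<in> A \<and> (\<Delta>2, False) \<in> B \<and> \<Delta> = \<Delta>1 @ \<Delta>2)" for \<Delta>
    unfolding comb_iff by auto
  note iff = this
  show ?thesis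
  proof (intro iffI; elim exE conjE)
    fix \<Delta> assume "(\<Delta>, False) \<in> comb A B" and Q: "\<forall>d\<in>set \<Delta>. Q d"
    then obtain \<Delta>1 \<Delta>2 where "(\<Delta>1, False) \<in> A" "(\<Delta>2, False) \<in> B" "\<Delta> = \<Delta>1 @ \<Delta>2" unfolding iff by blast
    then show "(\<exists>\<Delta>. (\<Delta>, False) \<in> A \<and> (\<forall>d\<in>set \<Delta>. Q d)) \<and> (\<exists>\<Delta>. (\<Delta>, False) \<in> B \<and> (\<forall>d\<in>set \<Delta>. Q d))"
      using Q by (intro conjI exI[of _ \<Delta>1] exI[of _ \<Delta>2]) simp_all
  next
    fix \<Delta>1 \<Delta>2 assume "(\<Delta>1, False) \<in> A" "(\<Delta>2, False) \<in> B" "\<forall>d\<in>set \<Delta>1. Q d" "\<forall>d\<in>set \<Delta>2. Q d"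
    then show "\<exists>\<Delta>. (\<Delta>, False) \<in> comb A B \<and> (\<forall>d\<in>set \<Delta>. Q d)"
      unfolding iff by (intro exI[of _ "\<Delta>1 @ \<Delta>2"]) auto
  qed
qed

text \<open>All ways to resolve a formula into modal ones. A branch that meets \<open>HF\<close> is
  flagged instead of dropped, because a pass of the machine reads on and merely remembers the
  loss.\<close>

fun expa :: "hm \<Rightarrow> (hm list \<times> bool) set" where
  "expa HT = {([], False)}"
| "expa HF = {([], True)}"
| "expa (HA a b) = comb (expa a) (expa b)"
| "expa (HO a b) = expa a \<union> expa b"
| "expa a = {([a], False)}"

fun exps :: "hm list \<Rightarrow> (hm list \<times> bool) set" where
  "exps [] = {([], False)}"
| "exps (a # \<Gamma>) = comb (expa a) (exps \<Gamma>)"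

lemma hh_expa: "hh R w a \<longleftrightarrow> (\<exists>\<Delta>. (\<Delta>, False) \<in> expa a \<and> (\<forall>d\<in>set \<Delta>. hh R w d))"
  by (induction a) (auto simp: comb_False)

lemma hh_exps: "(\<forall>a\<in>set \<Gamma>. hh R w a) \<longleftrightarrow> (\<exists>\<Delta>. (\<Delta>, False) \<in> exps \<Gamma> \<and> (\<forall>d\<in>set \<Delta>. hh R w d))"
  by (induction \<Gamma>) (simp_all add: comb_False hh_expa[symmetric])

lemma tsat_exps: "tsat \<Gamma> \<longleftrightarrow> (\<exists>\<Delta>. (\<Delta>, False) \<in> exps \<Gamma> \<and> tsat \<Delta>)"
  unfolding tsat_def hh_exps[of \<Gamma>] by blast

text \<open>Symbols start at 1 because 0 marks the end of a stack.\<close>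

fun tk :: "hm \<Rightarrow> nat list" where
  "tk HT = [1]"
| "tk HF = [2]"
| "tk (HA a b) = 3 # tk a @ tk b"
| "tk (HO a b) = 4 # tk a @ tk b"
| "tk (HB c a) = (5 + of_bool c) # tk a"
| "tk (HD c a) = (7 + of_bool c) # tk a"

definition tks :: "hm list \<Rightarrow> nat list" where "tks \<Gamma> = concat (map tk \<Gamma>)"

lemma tks_simps [simp]: "tks [] = []" "tks (a # \<Gamma>) = tk a @ tks \<Gamma>" "tks (\<Gamma> @ \<Delta>) = tks \<Gamma> @ tks \<Delta>"
  by (simp_all add: tks_def)

lemma tk_pos: "0 < length (tk a)" by (cases a) auto

definition modal :: "hm list \<Rightarrow> bool" where
  "modal \<Delta> \<longleftrightarrow> (\<forall>d\<in>set \<Delta>. \<exists>b c. d = HB b c \<or> d = HD b c)"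

lemma modal_simps [simp]: "modal []" "modal (\<Delta> @ \<Delta>') \<longleftrightarrow> modal \<Delta> \<and> modal \<Delta>'" "modal [HB b c]" "modal [HD b c]"
  by (auto simp: modal_def)

lemma modal_expa: "(\<Delta>, l) \<in> expa a \<Longrightarrow> modal \<Delta>"
  by (induction a arbitrary: \<Delta> l) (auto simp: comb_iff)

lemma modal_exps: "(\<Delta>, l) \<in> exps \<Gamma> \<Longrightarrow> modal \<Delta>"
  by (induction \<Gamma> arbitrary: \<Delta> l) (auto simp: comb_iff dest: modal_expa)

lemma length_expa: "(\<Delta>, l) \<in> expa a \<Longrightarrow> length (tks \<Delta>) \<le> length (tk a)"
proof (induction a arbitrary: \<Delta> l)
  case (HA a b)
  then obtain \<Delta>1 l1 \<Delta>2 l2 where "(\<Delta>1, l1) \<in> expa a" "(\<Delta>2, l2) \<in> expa b" "\<Delta> = \<Delta>1 @ \<Delta>2"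
    by (auto simp: comb_iff)
  then show ?case using HA.IH(1)[of \<Delta>1 l1] HA.IH(2)[of \<Delta>2 l2] by simp
next
  case (HO a b)
  then have "length (tks \<Delta>) \<le> length (tk a) \<or> length (tks \<Delta>) \<le> length (tk b)" by auto
  then show ?case by auto
qed auto

lemma length_exps: "(\<Delta>, l) \<in> exps \<Gamma> \<Longrightarrow> length (tks \<Delta>) \<le> length (tks \<Gamma>)"
  by (induction \<Gamma> arbitrary: \<Delta> l) (auto simp: comb_iff dest!: length_expa intro!: add_mono)

fun boxes :: "bool \<Rightarrow> hm list \<Rightarrow> hm list" where
  "boxes b (HB b' c # \<Delta>) = (if b' = b then c # boxes b \<Delta> else boxes b \<Delta>)"
| "boxes b (_ # \<Delta>) = boxes b \<Delta>"
| "boxes b [] = []"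

text \<open>One list per diamond: its argument among those of the boxes of the same modality. The
  order of \<open>\<Delta>\<close> is kept, so that a single pass from left to right can write the
  list.\<close>

fun nexts :: "bool \<Rightarrow> hm list \<Rightarrow> hm list set" where
  "nexts b (HB b' c # \<Delta>) = (if b' = b then (#) c ` nexts b \<Delta> else nexts b \<Delta>)"
| "nexts b (HD b' c # \<Delta>) = (if b' = b then {c # boxes b \<Delta>} else {}) \<union> nexts b \<Delta>"
| "nexts b (_ # \<Delta>) = nexts b \<Delta>"
| "nexts b [] = {}"

lemma set_boxes: "c \<in> set (boxes b \<Delta>) \<longleftrightarrow> HB b c \<in> set \<Delta>"
  by (induction b \<Delta> rule: boxes.induct) auto

lemma length_boxes: "modal \<Delta> \<Longrightarrow> length (tks (boxes b \<Delta>)) + length \<Delta> \<le> length (tks \<Delta>)"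
  by (induction b \<Delta> rule: boxes.induct) (auto simp: modal_def)

lemma modal_Cons: "modal (d # \<Delta>) \<longleftrightarrow> (\<exists>b c. d = HB b c \<or> d = HD b c) \<and> modal \<Delta>"
  by (simp add: modal_def)

text \<open>Every member of \<open>\<Delta>\<close> loses its leading symbol or disappears. The
  saving pays for the rounds of the game.\<close>

lemma length_nexts: "modal \<Delta> \<Longrightarrow> \<Gamma> \<in> nexts b \<Delta> \<Longrightarrow> length (tks \<Gamma>) + length \<Delta> \<le> length (tks \<Delta>)"
proof (induction \<Delta> arbitrary: \<Gamma>)
  case (Cons d \<Delta>)
  have IH: "length (tks \<Gamma>) + length \<Delta> \<le> length (tks \<Delta>)" if "\<Gamma> \<in> nexts b \<Delta>" for \<Gamma>
    using Cons.IH[OF _ that] Cons.prems(1) by (simp add: modal_Cons)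
  have "length (tks (boxes b \<Delta>)) + length \<Delta> \<le> length (tks \<Delta>)"
    using length_boxes[of \<Delta> b] Cons.prems(1) by (simp add: modal_Cons)
  then show ?case using Cons.prems by (cases d) (auto simp: modal_Cons dest: IH split: if_splits)
qed simp

lemma nexts_set: "\<Gamma> \<in> nexts b \<Delta> \<Longrightarrow> \<exists>c. HD b c \<in> set \<Delta> \<and> set \<Gamma> = insert c {c'. HB b c' \<in> set \<Delta>}"
proof (induction \<Delta> arbitrary: \<Gamma>)
  case (Cons d \<Delta>)
  consider a \<Gamma>' where "d = HB b a" "\<Gamma> = a # \<Gamma>'" "\<Gamma>' \<in> nexts b \<Delta>"
    | a where "d = HD b a" "\<Gamma> = a # boxes b \<Delta>" | "\<Gamma> \<in> nexts b \<Delta>" "\<And>c'. d \<noteq> HB b c'"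
    using Cons.prems by (cases d) (auto split: if_splits)
  then show ?case
  proof cases
    case 1
    then obtain c where "HD b c \<in> set \<Delta>" "set \<Gamma>' = insert c {c'. HB b c' \<in> set \<Delta>}" using Cons.IH by blast
    then show ?thesis using 1 by (intro exI[of _ c]) auto
  next
    case 2
    then show ?thesis by (intro exI[of _ a]) (auto simp: set_boxes)
  next
    case 3
    then obtain c where "HD b c \<in> set \<Delta>" "set \<Gamma> = insert c {c'. HB b c' \<in> set \<Delta>}" using Cons.IH by blast
    then show ?thesis using 3(2) by (intro exI[of _ c]) auto
  qed
qed simp

lemma nexts_ex: "HD b c \<in> set \<Delta> \<Longrightarrow> \<exists>\<Gamma>\<in>nexts b \<Delta>. set \<Gamma> = insert c {c'. HB b c' \<in> set \<Delta>}"
proof (induction \<Delta>)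
  case (Cons d \<Delta>)
  show ?case
  proof (cases "d = HD b c")
    case True
    then show ?thesis by (intro bexI[of _ "c # boxes b \<Delta>"]) (auto simp: set_boxes)
  next
    case False
    then obtain \<Gamma> where g: "\<Gamma> \<in> nexts b \<Delta>" "set \<Gamma> = insert c {c'. HB b c' \<in> set \<Delta>}" using Cons by auto
    show ?thesis
    proof (cases "\<exists>a. d = HB b a")
      case True
      then obtain a where "d = HB b a" by blast
      then show ?thesis using g by (intro bexI[of _ "a # \<Gamma>"]) auto
    next
      case False
      then show ?thesis using g by (intro bexI[of _ \<Gamma>]; cases d) auto
    qed
  qed
qed simp

text \<open>The usual modal rule; a model is assembled by giving the root a separate child for each
  diamond.\<close>

lemma tsat_nexts:
  assumes "modal \<Delta>" shows "tsat \<Delta> \<longleftrightarrow> (\<forall>b. \<forall>\<Gamma>\<in>nexts b \<Delta>. tsat \<Gamma>)"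
proof
  assume "tsat \<Delta>"
  then obtain t where t: "\<forall>a\<in>set \<Delta>. hh htR t a" by (auto simp: tsat_def)
  show "\<forall>b. \<forall>\<Gamma>\<in>nexts b \<Delta>. tsat \<Gamma>"
  proof (intro allI ballI)
    fix b \<Gamma> assume "\<Gamma> \<in> nexts b \<Delta>"
    then obtain c where c: "HD b c \<in> set \<Delta>" "set \<Gamma> = insert c {c'. HB b c' \<in> set \<Delta>}" using nexts_set by blast
    then obtain t' where t': "(t, t') \<in> htR b" "hh htR t' c" using t by fastforce
    then show "tsat \<Gamma>" unfolding tsat_def c(2) using t by (intro exI[of _ t']) fastforce
  qed
next
  assume *: "\<forall>b. \<forall>\<Gamma>\<in>nexts b \<Delta>. tsat \<Gamma>"
  have "\<exists>t. hh htR t c \<and> (\<forall>c'. HB b c' \<in> set \<Delta> \<longrightarrow> hh htR t c')" if "HD b c \<in> set \<Delta>" for b c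
    using nexts_ex[OF that] * unfolding tsat_def by fastforce
  then obtain f where "\<forall>b c. HD b c \<in> set \<Delta> \<longrightarrow> hh htR (f b c) c \<and> (\<forall>c'. HB b c' \<in> set \<Delta> \<longrightarrow> hh htR (f b c) c')"
    by metis
  then have f: "hh htR (f b c) c" "\<And>c'. HB b c' \<in> set \<Delta> \<Longrightarrow> hh htR (f b c) c'" if "HD b c \<in> set \<Delta>" for b c
    using that by blast+
  define t where "t = Branch (concat (map (\<lambda>d. case d of HD b c \<Rightarrow> [(b, f b c)] | _ \<Rightarrow> []) \<Delta>))"
  have t: "(t, t') \<in> htR b \<longleftrightarrow> (\<exists>c. HD b c \<in> set \<Delta> \<and> t' = f b c)" for t' b
    unfolding t_def htR_def by (force split: hm.splits)
  have "hh htR t d" if "d \<in> set \<Delta>" for d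
    using assms that f t unfolding modal_def by fastforce
  then show "tsat \<Delta>" unfolding tsat_def by blast
qed

text \<open>Finite tree model property: one successor per diamond suffices, and the formulas get
  shorter along each edge.\<close>

lemma hh_tsat: "(\<forall>a\<in>set \<Gamma>. hh R w a) \<Longrightarrow> tsat \<Gamma>"
proof (induction "length (tks \<Gamma>)" arbitrary: \<Gamma> w rule: less_induct)
  case less
  obtain \<Delta> where \<Delta>: "(\<Delta>, False) \<in> exps \<Gamma>" "\<forall>d\<in>set \<Delta>. hh R w d"
    using hh_exps[of \<Gamma> R w] less.prems by blast
  have m: "modal \<Delta>" using modal_exps[OF \<Delta>(1)] .
  have "tsat \<Gamma>'" if g: "\<Gamma>' \<in> nexts b \<Delta>" for b \<Gamma>'
  proof -
    obtain c where c: "HD b c \<in> set \<Delta>" "set \<Gamma>' = insert c {c'. HB b c' \<in> set \<Delta>}" using nexts_set[OF g] by blast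
    then obtain v where v: "(w, v) \<in> R b" "hh R v c" using \<Delta>(2) by fastforce
    have "length \<Delta> > 0" using c(1) by auto
    then have "length (tks \<Gamma>') < length (tks \<Gamma>)"
      using length_nexts[OF m g] length_exps[OF \<Delta>(1)] by linarith
    moreover have "\<forall>a\<in>set \<Gamma>'. hh R v a" using c v \<Delta>(2) by fastforce
    ultimately show ?thesis using less.hyps by blast
  qed
  then have "tsat \<Delta>" using tsat_nexts[OF m] by blast
  then show ?case using tsat_exps \<Delta>(1) by blast
qed

lemma satisfiable_tsat:
  assumes "infinite (UNIV :: 'w set)"
  shows "satisfiable TYPE('w) a \<longleftrightarrow> tsat [tr True a]"
proof
  assume "satisfiable TYPE('w) a"
  then obtain R :: "('w \<times> 'w) set" and V w where "holds R V w a" unfolding satisfiable_def by blast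
  then show "tsat [tr True a]" using hh_tsat[of "[tr True a]" "unR R V" "Inl w"] by (simp add: unR_holds)
qed (rule satisfiable_transfer[OF tsat_satisfiable assms])

text \<open>
  A pass reads formulas in Polish notation. Each symbol is read in a mode, and it pushes a mode for each of its
  arguments: 1 (resolve), 2 (copy), 3 (delete), \<open>4 + b\<close> (look for a diamond of modality \<open>b\<close> to follow),
  \<open>6 + b\<close> (such a diamond has been found). When no mode is pending, the default mode \<open>M\<close> applies.
  Choices come in pairs, of which the first belongs to the player who defends satisfiability.
\<close>

fun ar :: "nat \<Rightarrow> nat" where
  "ar t = (if t \<in> {3, 4} then 2 else if t \<in> {5, 6, 7, 8} then 1 else 0)"

text \<open>Both choices of a pair are drawn each time; a disjunction uses only the first, a diamond
  only the second.\<close>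

definition needs :: "nat \<Rightarrow> nat \<Rightarrow> bool" where
  "needs \<mu> t \<longleftrightarrow> \<mu> = 1 \<and> t = 4 \<or> \<mu> \<in> {4, 5} \<and> t = \<mu> + 3"

definition pushed :: "nat \<Rightarrow> nat \<Rightarrow> bool \<Rightarrow> bool \<Rightarrow> nat list" where
  "pushed \<mu> t e a = (if \<mu> = 1 then
       (if t = 3 then [1, 1] else if t = 4 then (if e then [3, 1] else [1, 3]) else replicate (ar t) 2)
     else if \<mu> \<in> {2, 3} then replicate (ar t) \<mu>
     else if \<mu> \<in> {4, 5} \<and> (t = \<mu> + 1 \<or> t = \<mu> + 3 \<and> a) \<or> \<mu> \<in> {6, 7} \<and> t = \<mu> - 1 then [2]
     else replicate (ar t) 3)"

definition outp :: "nat \<Rightarrow> nat \<Rightarrow> bool" where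
  "outp \<mu> t \<longleftrightarrow> \<mu> = 2 \<and> 0 < t \<or> \<mu> = 1 \<and> 5 \<le> t"

definition sel :: "nat \<Rightarrow> nat \<Rightarrow> bool \<Rightarrow> bool" where
  "sel \<mu> t a \<longleftrightarrow> \<mu> \<in> {4, 5} \<and> t = \<mu> + 3 \<and> a"

fun hb :: "bool list \<Rightarrow> bool" where "hb [] = False" | "hb (b # _) = b"

fun psr :: "nat \<Rightarrow> nat list \<Rightarrow> nat list \<Rightarrow> nat list \<Rightarrow> bool \<Rightarrow> bool list \<Rightarrow> nat \<times> nat list \<times> bool \<times> bool list" where
  "psr M P [] os l cs = (M, os, l, cs)"
| "psr M P (t # G) os l cs = (let \<mu> = (case P of [] \<Rightarrow> M | \<mu> # _ \<Rightarrow> \<mu>);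
      e = needs \<mu> t \<and> hb cs; a = needs \<mu> t \<and> hb (tl cs)
    in psr (if sel \<mu> t a then \<mu> + 2 else M) (pushed \<mu> t e a @ tl P) G (if outp \<mu> t then t # os else os)
      (l \<or> \<mu> = 1 \<and> t = 2) (if needs \<mu> t then tl (tl cs) else cs))"

lemma replicate_2: "replicate 2 x = [x, x]"
  by (simp add: numeral_2_eq_2)

lemmas psr_defs = replicate_2 needs_def pushed_def outp_def sel_def

lemma psr_copy: "psr M (2 # P) (tk a @ G) os l cs = psr M P G (rev (tk a) @ os) l cs"
  by (induction a arbitrary: P G os) (auto simp: psr_defs)

lemma psr_kill: "psr M (3 # P) (tk a @ G) os l cs = psr M P G os l cs"
  by (induction a arbitrary: P G) (auto simp: psr_defs)

lemma psr_default: "psr M [] (tk a @ G) os l cs = psr M [M] (tk a @ G) os l cs"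
  using tk_pos[of a] by (cases "tk a") auto

section \<open>Quantified choice sequences and the value of the game\<close>

fun qq :: "nat \<Rightarrow> (bool list \<Rightarrow> bool) \<Rightarrow> bool" where
  "qq 0 f = f []"
| "qq (Suc m) f = (\<exists>e. \<forall>a. qq m (\<lambda>bs. f (e # a # bs)))"

text \<open>Plays differ in the number of rounds they use, so the value is required for all numbers
  from \<open>N\<close> on instead of an exact one.\<close>

definition ev :: "nat \<Rightarrow> (bool list \<Rightarrow> bool) \<Rightarrow> bool \<Rightarrow> bool" where
  "ev N f v \<longleftrightarrow> (\<forall>m\<ge>N. qq m f = v)"

lemma ev_mono: "ev N f v \<Longrightarrow> N \<le> N' \<Longrightarrow> ev N' f v"
  by (simp add: ev_def)

lemma ev_const: "ev N (\<lambda>_. v) v"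
proof -
  have "qq m (\<lambda>_. v) = v" for m by (induction m) auto
  then show ?thesis by (simp add: ev_def)
qed

lemma ev_choice:
  assumes "\<And>e a. ev N (f e a) (v e a)"
  shows "ev (Suc N) (\<lambda>bs. f (hb bs) (hb (tl bs)) (tl (tl bs))) (\<exists>e. \<forall>a. v e a)"
  unfolding ev_def
proof (intro allI impI)
  fix m assume "Suc N \<le> m"
  then obtain m' where "m = Suc m'" "N \<le> m'" by (cases m) auto
  then show "qq m (\<lambda>bs. f (hb bs) (hb (tl bs)) (tl (tl bs))) = (\<exists>e. \<forall>a. v e a)"
    using assms unfolding ev_def by simp
qed

text \<open>\<open>\<Psi>\<close> is whatever follows the pass and \<open>\<phi>\<close> its value,
  so that passes compose. The budget is two rounds per symbol; the symbol of a resolved disjunction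
  pays for its round.\<close>

lemma ev_keep:
  assumes "\<And>\<Delta> l'. (\<Delta>, l') \<in> expa a \<Longrightarrow> ev (B + 2 * length (tks \<Delta>))
    (\<lambda>bs. \<Psi> (psr 1 P G (rev (tks \<Delta>) @ os) (l \<or> l') bs)) (\<phi> \<Delta> (l \<or> l'))"
  shows "ev (B + 2 * length (tk a)) (\<lambda>bs. \<Psi> (psr 1 (1 # P) (tk a @ G) os l bs))
    (\<exists>(\<Delta>, l') \<in> expa a. \<phi> \<Delta> (l \<or> l'))"
  using assms
proof (induction a arbitrary: B P G os l \<phi>)
  case HT
  from HT[of "[]" False] show ?case by (auto simp: psr_defs elim!: ev_mono)
next
  case HF
  from HF[of "[]" True] show ?case by (auto simp: psr_defs elim!: ev_mono)
next
  case (HA a b)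
  let ?\<phi> = "\<lambda>\<Delta> l. \<exists>(\<Delta>', l') \<in> expa b. \<phi> (\<Delta> @ \<Delta>') (l \<or> l')"
  have "ev (B + 2 * length (tk b) + 2 * length (tk a)) (\<lambda>bs. \<Psi> (psr 1 (1 # 1 # P) (tk a @ tk b @ G) os l bs))
      (\<exists>(\<Delta>, l') \<in> expa a. ?\<phi> \<Delta> (l \<or> l'))"
  proof (rule HA.IH(1)[where \<phi> = ?\<phi>])
    fix \<Delta> l' assume 1: "(\<Delta>, l') \<in> expa a"
    have "ev (B + 2 * length (tks \<Delta>) + 2 * length (tk b))
       (\<lambda>bs. \<Psi> (psr 1 (1 # P) (tk b @ G) (rev (tks \<Delta>) @ os) (l \<or> l') bs)) (?\<phi> \<Delta> (l \<or> l'))"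
    proof (rule HA.IH(2)[where \<phi> = "\<lambda>\<Delta>'. \<phi> (\<Delta> @ \<Delta>')"])
      fix \<Delta>2 l2 assume 2: "(\<Delta>2, l2) \<in> expa b"
      show "ev (B + 2 * length (tks \<Delta>) + 2 * length (tks \<Delta>2))
        (\<lambda>bs. \<Psi> (psr 1 P G (rev (tks \<Delta>2) @ rev (tks \<Delta>) @ os) ((l \<or> l') \<or> l2) bs))
        (\<phi> (\<Delta> @ \<Delta>2) ((l \<or> l') \<or> l2))"
        using HA.prems[of "\<Delta> @ \<Delta>2" "l' \<or> l2"] combI[OF 1 2] by (auto simp: algebra_simps)
    qed
    then show "ev (B + 2 * length (tk b) + 2 * length (tks \<Delta>))
       (\<lambda>bs. \<Psi> (psr 1 (1 # P) (tk b @ G) (rev (tks \<Delta>) @ os) (l \<or> l') bs)) (?\<phi> \<Delta> (l \<or> l'))"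
      by (simp add: algebra_simps)
  qed
  moreover have "(\<exists>(\<Delta>, l') \<in> expa a. ?\<phi> \<Delta> (l \<or> l')) \<longleftrightarrow>
      (\<exists>(\<Delta>, l') \<in> expa (HA a b). \<phi> \<Delta> (l \<or> l'))"
    by (simp add: comb_bex disj_assoc)
  ultimately show ?case by (auto simp: psr_defs elim!: ev_mono)
next
  case (HO a b)
  let ?v = "\<lambda>a. \<exists>(\<Delta>, l') \<in> expa a. \<phi> \<Delta> (l \<or> l')"
  define N where "N = B + 2 * length (tk a) + 2 * length (tk b)"
  have 1: "ev N (\<lambda>bs. \<Psi> (psr 1 (1 # 3 # P) (tk a @ tk b @ G) os l bs)) (?v a)"
    by (rule ev_mono[OF HO.IH(1)]) (use HO.prems in \<open>auto simp: psr_kill N_def\<close>)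
  have 2: "ev N (\<lambda>bs. \<Psi> (psr 1 (3 # 1 # P) (tk a @ tk b @ G) os l bs)) (?v b)"
    unfolding psr_kill by (rule ev_mono[OF HO.IH(2)]) (use HO.prems in \<open>auto simp: N_def\<close>)
  have "ev N (\<lambda>bs. \<Psi> (psr 1 ((if e then [3, 1] else [1, 3]) @ P) (tk a @ tk b @ G) os l bs)) (if e then ?v b else ?v a)" for e
    using 1 2 by (cases e) auto
  from ev_choice[of N "\<lambda>e x bs. \<Psi> (psr 1 ((if e then [3, 1] else [1, 3]) @ P) (tk a @ tk b @ G) os l bs)"
      "\<lambda>e x. if e then ?v b else ?v a", OF this]
  have "ev (Suc N) (\<lambda>bs. \<Psi> (psr 1 (1 # P) (tk (HO a b) @ G) os l bs)) (\<exists>e. if e then ?v b else ?v a)"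
    by (simp add: psr_defs)
  moreover have "(\<exists>e. if e then ?v b else ?v a) \<longleftrightarrow> ?v (HO a b)" by (auto; metis)
  ultimately have "ev (Suc N) (\<lambda>bs. \<Psi> (psr 1 (1 # P) (tk (HO a b) @ G) os l bs)) (?v (HO a b))" by (simp only:)
  then show ?case by (rule ev_mono) (simp add: N_def)
next
  case (HB c a)
  from HB.prems[of "[HB c a]" False] show ?case by (auto simp: psr_defs psr_copy elim!: ev_mono)
next
  case (HD c a)
  from HD.prems[of "[HD c a]" False] show ?case by (auto simp: psr_defs psr_copy elim!: ev_mono)
qed

lemma ev_keeps:
  assumes "\<And>\<Delta> l'. (\<Delta>, l') \<in> exps \<Gamma> \<Longrightarrow> ev (B + 2 * length (tks \<Delta>))
    (\<lambda>bs. \<Psi> (1, rev (tks \<Delta>) @ os, l \<or> l', bs)) (\<phi> \<Delta> (l \<or> l'))"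
  shows "ev (B + 2 * length (tks \<Gamma>)) (\<lambda>bs. \<Psi> (psr 1 [] (tks \<Gamma>) os l bs))
    (\<exists>(\<Delta>, l') \<in> exps \<Gamma>. \<phi> \<Delta> (l \<or> l'))"
  using assms
proof (induction \<Gamma> arbitrary: B os l \<phi>)
  case Nil
  from Nil[of "[]" False] show ?case by simp
next
  case (Cons a \<Gamma>)
  let ?\<phi> = "\<lambda>\<Delta> l. \<exists>(\<Delta>', l') \<in> exps \<Gamma>. \<phi> (\<Delta> @ \<Delta>') (l \<or> l')"
  have "ev (B + 2 * length (tks \<Gamma>) + 2 * length (tk a)) (\<lambda>bs. \<Psi> (psr 1 [1] (tk a @ tks \<Gamma>) os l bs))
      (\<exists>(\<Delta>, l') \<in> expa a. ?\<phi> \<Delta> (l \<or> l'))"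
  proof (rule ev_keep[where \<phi> = ?\<phi>])
    fix \<Delta> l' assume 1: "(\<Delta>, l') \<in> expa a"
    have "ev (B + 2 * length (tks \<Delta>) + 2 * length (tks \<Gamma>))
       (\<lambda>bs. \<Psi> (psr 1 [] (tks \<Gamma>) (rev (tks \<Delta>) @ os) (l \<or> l') bs)) (?\<phi> \<Delta> (l \<or> l'))"
    proof (rule Cons.IH[where \<phi> = "\<lambda>\<Delta>'. \<phi> (\<Delta> @ \<Delta>')"])
      fix \<Delta>2 l2 assume 2: "(\<Delta>2, l2) \<in> exps \<Gamma>"
      show "ev (B + 2 * length (tks \<Delta>) + 2 * length (tks \<Delta>2))
        (\<lambda>bs. \<Psi> (1, rev (tks \<Delta>2) @ rev (tks \<Delta>) @ os, (l \<or> l') \<or> l2, bs))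
        (\<phi> (\<Delta> @ \<Delta>2) ((l \<or> l') \<or> l2))"
        using Cons.prems[of "\<Delta> @ \<Delta>2" "l' \<or> l2"] combI[OF 1 2] by (auto simp: algebra_simps)
    qed
    then show "ev (B + 2 * length (tks \<Gamma>) + 2 * length (tks \<Delta>))
       (\<lambda>bs. \<Psi> (psr 1 [] (tks \<Gamma>) (rev (tks \<Delta>) @ os) (l \<or> l') bs)) (?\<phi> \<Delta> (l \<or> l'))"
      by (simp add: algebra_simps)
  qed
  moreover have "(\<exists>(\<Delta>, l') \<in> expa a. ?\<phi> \<Delta> (l \<or> l')) \<longleftrightarrow>
      (\<exists>(\<Delta>, l') \<in> exps (a # \<Gamma>). \<phi> \<Delta> (l \<or> l'))"
    by (simp add: comb_bex disj_assoc)
  ultimately show ?case by (simp add: psr_default algebra_simps)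
qed

lemma psr_selected: "modal \<Delta> \<Longrightarrow> psr (6 + of_bool b) [] (tks \<Delta>) os l cs = (6 + of_bool b, rev (tks (boxes b \<Delta>)) @ os, l, cs)"
proof (induction b \<Delta> arbitrary: os rule: boxes.induct)
qed (auto simp: modal_def psr_default[symmetric] psr_defs psr_copy psr_kill)

text \<open>At each diamond of modality \<open>b\<close> the opponent takes it or declines. If all
  are declined, the value is \<open>v\<close>. One round per member of \<open>\<Delta>\<close> is
  enough.\<close>

lemma ev_select:
  assumes "modal \<Delta>" and \<mu>: "\<mu> = 4 + of_bool b"
    and "ev N (\<lambda>bs. \<Psi> (\<mu>, rev (tks (boxes b \<Delta>)) @ os, l, bs)) v"
    and "\<And>\<Gamma>. \<Gamma> \<in> nexts b \<Delta> \<Longrightarrow> ev N (\<lambda>bs. \<Psi> (\<mu> + 2, rev (tks \<Gamma>) @ os, l, bs)) (\<phi> \<Gamma>)"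
  shows "ev (N + length \<Delta>) (\<lambda>bs. \<Psi> (psr \<mu> [] (tks \<Delta>) os l bs))
    (v \<and> (\<forall>\<Gamma>\<in>nexts b \<Delta>. \<phi> \<Gamma>))"
  using assms(1,3,4)
proof (induction \<Delta> arbitrary: os \<phi>)
  case Nil
  then show ?case by simp
next
  case (Cons d \<Delta>)
  have m: "modal \<Delta>" using Cons.prems(1) by (simp add: modal_def)
  consider (B) a where "d = HB b a" | (K) c a where "d = HB c a \<or> d = HD c a" "c \<noteq> b" | (D) a where "d = HD b a"
    using Cons.prems(1) by (auto simp: modal_def)
  then show ?case
  proof cases
    case B
    have "psr \<mu> [] (tks (d # \<Delta>)) os l bs = psr \<mu> [] (tks \<Delta>) (rev (tk a) @ os) l bs" for bs
      by (simp add: B \<mu> psr_defs psr_copy)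
    moreover have "ev (N + length \<Delta>) (\<lambda>bs. \<Psi> (psr \<mu> [] (tks \<Delta>) (rev (tk a) @ os) l bs))
      (v \<and> (\<forall>\<Gamma>\<in>nexts b \<Delta>. \<phi> (a # \<Gamma>)))"
      by (rule Cons.IH[OF m, where \<phi> = "\<lambda>\<Gamma>. \<phi> (a # \<Gamma>)"]) (use Cons.prems(2) Cons.prems(3)[of "a # _"] in \<open>simp_all add: B\<close>)
    ultimately show ?thesis by (auto simp: B elim!: ev_mono)
  next
    case K
    then have e: "psr \<mu> [] (tks (d # \<Delta>)) os l bs = psr \<mu> [] (tks \<Delta>) os l bs" for bs
      by (cases b; cases c) (auto simp: \<mu> psr_defs psr_kill)
    have "ev (N + length \<Delta>) (\<lambda>bs. \<Psi> (psr \<mu> [] (tks \<Delta>) os l bs))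
      (v \<and> (\<forall>\<Gamma>\<in>nexts b \<Delta>. \<phi> \<Gamma>))"
      by (rule Cons.IH[OF m]) (use Cons.prems(2,3) K in \<open>auto split: if_splits\<close>)
    moreover have "boxes b (d # \<Delta>) = boxes b \<Delta>" "nexts b (d # \<Delta>) = nexts b \<Delta>" using K by auto
    ultimately show ?thesis unfolding e by (auto elim!: ev_mono)
  next
    case D
    let ?o = "rev (tks (a # boxes b \<Delta>)) @ os"
    let ?v = "v \<and> (\<forall>\<Gamma>\<in>nexts b \<Delta>. \<phi> \<Gamma>)"
    have 1: "psr \<mu> [] (tks (d # \<Delta>)) os l bs = (if hb (tl bs) then (\<mu> + 2, ?o, l, tl (tl bs))
        else psr \<mu> [] (tks \<Delta>) os l (tl (tl bs)))" for bs
      using psr_selected[OF m, of b "rev (tk a) @ os" l "tl (tl bs)"]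
      by (cases b) (simp_all add: D \<mu> psr_defs psr_copy psr_kill)
    have "ev (N + length \<Delta>) (\<lambda>bs. \<Psi> (psr \<mu> [] (tks \<Delta>) os l bs)) ?v"
      by (rule Cons.IH[OF m]) (use Cons.prems(2,3) in \<open>auto simp: D\<close>)
    moreover have "ev (N + length \<Delta>) (\<lambda>bs. \<Psi> (\<mu> + 2, ?o, l, bs)) (\<phi> (a # boxes b \<Delta>))"
      using Cons.prems(3)[of "a # boxes b \<Delta>"] by (auto simp: D elim!: ev_mono)
    ultimately have "ev (N + length \<Delta>) (\<lambda>bs. \<Psi> (if x then (\<mu> + 2, ?o, l, bs) else psr \<mu> [] (tks \<Delta>) os l bs))
        (if x then \<phi> (a # boxes b \<Delta>) else ?v)" for x by (cases x) auto
    from ev_choice[of _ "\<lambda>e x bs. \<Psi> (if x then (\<mu> + 2, ?o, l, bs) else psr \<mu> [] (tks \<Delta>) os l bs)", OF this]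
    have "ev (Suc (N + length \<Delta>)) (\<lambda>bs. \<Psi> (psr \<mu> [] (tks (d # \<Delta>)) os l bs)) (\<forall>x. if x then \<phi> (a # boxes b \<Delta>) else ?v)"
      unfolding 1 by simp
    moreover have "(\<forall>x. if x then \<phi> (a # boxes b \<Delta>) else ?v) \<longleftrightarrow> v \<and> (\<forall>\<Gamma>\<in>nexts b (d # \<Delta>). \<phi> \<Gamma>)"
      by (auto simp: all_bool_eq D)
    ultimately show ?thesis by (simp only: list.size add_Suc_right add_0_right One_nat_def)
  qed
qed

lemma psr_length: "psr M P G os l cs = (M', os', l', cs') \<Longrightarrow> length os' \<le> length os + length G"
proof (induction G arbitrary: M P os l cs)
  case (Cons t G)
  from Cons.prems show ?case
    unfolding psr.simps Let_def by (elim Cons.IH[THEN order_trans]) auto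
qed simp

lemma psr_length_less:
  assumes "psr M [] G os l cs = (M', os', l', cs')" "M \<noteq> 1" "M \<noteq> 2" "G \<noteq> []"
  shows "length os' < length os + length G"
proof -
  obtain t G' where G: "G = t # G'" using assms(4) by (cases G) auto
  show ?thesis using assms unfolding G by (auto simp: Let_def outp_def dest!: psr_length)
qed

text \<open>A final mode 6 or 7 implies that there was a symbol to read, and the first symbol read
  in a searching mode is not copied.\<close>

lemma play_less:
  assumes "psr 1 [] G [] l cs = (M1, os1, l1, cs1)"
    and "psr (4 + of_bool b) [] (rev os1) [] l1 cs' = (M, os2, l2, cs2)" "M \<in> {6, 7}"
  shows "length os2 < length G"
proof -
  have "os1 \<noteq> []"
  proof
    assume "os1 = []"
    then have "M = 4 + of_bool b" using assms(2) by simp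
    then show False using assms(3) by (cases b) auto
  qed
  then show ?thesis
    using psr_length[OF assms(1)] psr_length_less[OF assms(2)] by (cases b) auto
qed

text \<open>Between the two passes one more pair is drawn, whose second choice lets the opponent fix
  the modality.\<close>

function play :: "nat list \<Rightarrow> bool \<Rightarrow> bool list \<Rightarrow> bool" where
  "play G l cs = (if G = [] then \<not> l else
     case psr 1 [] G [] l cs of (_, out1, l1, cs1) \<Rightarrow>
       (case psr (4 + of_bool (hb (tl cs1))) [] (rev out1) [] l1 (tl (tl cs1)) of (M, out2, l2, cs2) \<Rightarrow>
          if M \<in> {6, 7} then play (rev out2) l2 cs2 else \<not> l2))"
  by auto
termination
  by (relation "measure (\<lambda>(G, l, cs). length G)") (auto dest: play_less[unfolded One_nat_def, OF sym sym insertI1]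
      play_less[unfolded One_nat_def, OF sym sym insertI2[OF insertI1]])

declare play.simps [simp del]

text \<open>A modal step saves \<open>length \<Delta>\<close> symbols and spends at most
  \<open>length \<Delta>\<close> rounds on the selection and one on the modality. As
  \<open>\<Delta>\<close> is nonempty whenever the play goes on, two rounds per symbol
  suffice.\<close>

lemma ev_play: "ev (2 * length (tks \<Gamma>) + 1) (play (tks \<Gamma>) l) (\<not> l \<and> tsat \<Gamma>)"
proof (induction "length (tks \<Gamma>)" arbitrary: \<Gamma> l rule: less_induct)
  case less
  show ?case
  proof (cases "\<Gamma> = []")
    case True
    have "tsat []" by (simp add: tsat_def)
    moreover have "play [] l = (\<lambda>_. \<not> l)" by (rule ext) (simp add: play.simps)
    ultimately show ?thesis using True by (simp add: ev_const)
  next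
    case False
    then have ne: "tks \<Gamma> \<noteq> []" using tk_pos by (cases \<Gamma>) auto
    define \<Psi>2 :: "nat \<times> nat list \<times> bool \<times> bool list \<Rightarrow> bool" where
      "\<Psi>2 = (\<lambda>(M, out2, l2, cs2). if M \<in> {6, 7} then play (rev out2) l2 cs2 else \<not> l2)"
    define \<Psi>1 :: "nat \<times> nat list \<times> bool \<times> bool list \<Rightarrow> bool" where
      "\<Psi>1 = (\<lambda>(M, out1, l1, cs1). \<Psi>2 (psr (4 + of_bool (hb (tl cs1))) [] (rev out1) [] l1 (tl (tl cs1))))"
    have play: "play (tks \<Gamma>) l = (\<lambda>bs. \<Psi>1 (psr 1 [] (tks \<Gamma>) [] l bs))"
      using ne by (intro ext) (simp add: play.simps[of "tks \<Gamma>"] \<Psi>1_def \<Psi>2_def case_prod_beta)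
    have "ev (1 + 2 * length (tks \<Gamma>)) (\<lambda>bs. \<Psi>1 (psr 1 [] (tks \<Gamma>) [] l bs))
        (\<exists>(\<Delta>, l') \<in> exps \<Gamma>. \<not> (l \<or> l') \<and> tsat \<Delta>)"
    proof (rule ev_keeps[where \<phi> = "\<lambda>\<Delta> l. \<not> l \<and> tsat \<Delta>"])
      fix \<Delta> l' assume \<Delta>: "(\<Delta>, l') \<in> exps \<Gamma>"
      define m where "m = (l \<or> l')"
      have md: "modal \<Delta>" using modal_exps[OF \<Delta>] .
      \<comment> \<open>What remains after the selection; the 1 restores the \<open>+ 1\<close> of
        the claim for the next list.\<close>
      define N where "N = 2 * (length (tks \<Delta>) - length \<Delta>) + (if \<Delta> = [] then 0 else 1)"
      have N: "1 + (N + length \<Delta>) \<le> 1 + 2 * length (tks \<Delta>)"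
        using length_boxes[OF md, of True] unfolding N_def by (cases \<Delta>) auto
      have "ev (N + length \<Delta>) (\<lambda>bs. \<Psi>2 (psr (4 + of_bool b) [] (tks \<Delta>) [] m bs))
          (\<not> m \<and> (\<forall>\<Gamma>\<in>nexts b \<Delta>. \<not> m \<and> tsat \<Gamma>))" for b
      proof (rule ev_select[OF md refl, where \<phi> = "\<lambda>\<Gamma>. \<not> m \<and> tsat \<Gamma>"])
        show "ev N (\<lambda>bs. \<Psi>2 (4 + of_bool b, rev (tks (boxes b \<Delta>)) @ [], m, bs)) (\<not> m)"
          by (simp add: \<Psi>2_def ev_const)
        fix \<Gamma>' assume g: "\<Gamma>' \<in> nexts b \<Delta>"
        then have ne: "\<Delta> \<noteq> []" by auto
        have "length (tks \<Gamma>') + length \<Delta> \<le> length (tks \<Delta>)" "length (tks \<Delta>) \<le> length (tks \<Gamma>)" "0 < length \<Delta>"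
          using length_nexts[OF md g] length_exps[OF \<Delta>] ne by auto
        then have lt: "length (tks \<Gamma>') < length (tks \<Gamma>)" "2 * length (tks \<Gamma>') + 1 \<le> N"
          unfolding N_def using ne by (linarith, simp)
        show "ev N (\<lambda>bs. \<Psi>2 (4 + of_bool b + 2, rev (tks \<Gamma>') @ [], m, bs)) (\<not> m \<and> tsat \<Gamma>')"
          using ev_mono[OF less[OF lt(1), of m] lt(2)] by (simp add: \<Psi>2_def)
      qed
      from ev_choice[of _ "\<lambda>e b bs. \<Psi>2 (psr (4 + of_bool b) [] (tks \<Delta>) [] m bs)", OF this]
      have "ev (Suc (N + length \<Delta>)) (\<lambda>bs. \<Psi>1 (1, rev (tks \<Delta>) @ [], m, bs))
          (\<forall>b. \<not> m \<and> (\<forall>\<Gamma>\<in>nexts b \<Delta>. \<not> m \<and> tsat \<Gamma>))"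
        by (simp add: \<Psi>1_def)
      moreover have "(\<forall>b. \<not> m \<and> (\<forall>\<Gamma>\<in>nexts b \<Delta>. \<not> m \<and> tsat \<Gamma>)) \<longleftrightarrow> \<not> m \<and> tsat \<Delta>"
        using tsat_nexts[OF md] by blast
      ultimately show "ev (1 + 2 * length (tks \<Delta>)) (\<lambda>bs. \<Psi>1 (1, rev (tks \<Delta>) @ [], l \<or> l', bs)) (\<not> (l \<or> l') \<and> tsat \<Delta>)"
        unfolding m_def[symmetric] using N by (auto elim!: ev_mono)
    qed
    moreover have "(\<exists>(\<Delta>, l') \<in> exps \<Gamma>. \<not> (l \<or> l') \<and> tsat \<Delta>) \<longleftrightarrow> \<not> l \<and> tsat \<Gamma>"
    proof
      assume "\<exists>(\<Delta>, l') \<in> exps \<Gamma>. \<not> (l \<or> l') \<and> tsat \<Delta>"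
      then obtain \<Delta> where "(\<Delta>, False) \<in> exps \<Gamma>" "\<not> l" "tsat \<Delta>" by auto
      then show "\<not> l \<and> tsat \<Gamma>" using tsat_exps by blast
    next
      assume "\<not> l \<and> tsat \<Gamma>"
      then obtain \<Delta> where "(\<Delta>, False) \<in> exps \<Gamma>" "\<not> l" "tsat \<Delta>" using tsat_exps by blast
      then show "\<exists>(\<Delta>, l') \<in> exps \<Gamma>. \<not> (l \<or> l') \<and> tsat \<Delta>" by force
    qed
    ultimately show ?thesis by (simp add: play)
  qed
qed

section \<open>Deciding satisfiability in polynomial space\<close>

definition wpb :: "nat \<Rightarrow> com \<Rightarrow> store \<Rightarrow> (store \<Rightarrow> bool) \<Rightarrow> bool" where
  "wpb b c \<sigma> Q \<longleftrightarrow> wp (\<lambda>l. l \<le> b) c \<sigma> (\<lambda>_. Q)"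

lemma wpb_simps [simp]:
  "wpb b Skip \<sigma> Q = Q \<sigma>"
  "wpb b (Push i a) \<sigma> Q = (length (\<sigma> i) < b \<and> Q (\<sigma>(i := a # \<sigma> i)))"
  "wpb b (Pop i) \<sigma> Q = Q (\<sigma>(i := tl (\<sigma> i)))"
  "wpb b (c ;; d) \<sigma> Q = wpb b c \<sigma> (\<lambda>\<sigma>'. wpb b d \<sigma>' Q)"
  "wpb b (Case i f) \<sigma> Q = wpb b (f (hd0 (\<sigma> i))) \<sigma> Q"
  "wpb b (if x then c else d) \<sigma> Q = (if x then wpb b c \<sigma> Q else wpb b d \<sigma> Q)"
  "hd0 (\<sigma> i) \<notin> A \<Longrightarrow> wpb b (While i A c) \<sigma> Q = Q \<sigma>"
  by (simp_all add: wpb_def Suc_le_eq)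

lemma wpb_While: "hd0 (\<sigma> i) \<in> A \<Longrightarrow>
  wpb b (While i A c) \<sigma> Q = wpb b c \<sigma> (\<lambda>\<sigma>'. wpb b (While i A c) \<sigma>' Q)"
proof -
  assume "hd0 (\<sigma> i) \<in> A"
  then have "ex B (While i A c) \<sigma> t \<sigma>' \<longleftrightarrow>
      (\<exists>u \<rho> v. ex B c \<sigma> u \<rho> \<and> ex B (While i A c) \<rho> v \<sigma>' \<and> t = 1 + u + v)" for B t \<sigma>'
    by (subst ex.simps) force
  then show ?thesis unfolding wpb_def wp_def by (simp del: One_nat_def) metis
qed

fun pushall :: "nat \<Rightarrow> nat list \<Rightarrow> com" where
  "pushall i [] = Skip"
| "pushall i (x # xs) = (pushall i xs ;; Push i x)"

lemma wpb_pushall [simp]: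
  "length xs + length (\<sigma> i) \<le> b \<Longrightarrow> wpb b (pushall i xs) \<sigma> Q = Q (\<sigma>(i := xs @ \<sigma> i))"
  by (induction xs arbitrary: Q) auto

lemma wfc_pushall [simp]: "wfc k s (pushall i xs) \<longleftrightarrow> xs = [] \<or> i < k \<and> set xs \<subseteq> {0<..<s}"
  by (induction xs) auto

text \<open>Pushing 0 becomes a no-op, so that \<open>mv\<close> is well-formed in the branch of the
  blank.\<close>

definition psh :: "nat \<Rightarrow> nat \<Rightarrow> com" where "psh j a = (if a = 0 then Skip else Push j a)"

definition mv :: "nat \<Rightarrow> (nat \<Rightarrow> com) \<Rightarrow> com" where
  "mv i f = While i (- {0}) (Case i (\<lambda>a. Pop i ;; f a))"

definition clear :: "nat \<Rightarrow> com" where "clear i = mv i (\<lambda>_. Skip)"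

lemma wpb_mv [simp]:
  "0 \<notin> set (\<sigma> i) \<Longrightarrow> i \<noteq> j \<Longrightarrow> length (\<sigma> i) + length (\<sigma> j) \<le> b \<Longrightarrow>
    wpb b (mv i (psh j)) \<sigma> Q = Q (\<sigma>(i := [], j := rev (\<sigma> i) @ \<sigma> j))"
proof (induction "\<sigma> i" arbitrary: \<sigma>)
  case Nil
  then have "\<sigma>(i := [], j := rev (\<sigma> i) @ \<sigma> j) = \<sigma>" by (auto simp: fun_eq_iff)
  then show ?case using Nil.hyps[symmetric] by (simp add: mv_def del: fun_upd_apply)
next
  case (Cons x xs)
  let ?\<sigma> = "\<sigma>(i := xs, j := x # \<sigma> j)"
  have "wpb b (mv i (psh j)) \<sigma> Q = wpb b (mv i (psh j)) ?\<sigma> Q"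
    unfolding mv_def using Cons.prems Cons.hyps(2)[symmetric] by (subst wpb_While) (auto simp: psh_def)
  also have "\<dots> = Q (?\<sigma>(i := [], j := rev (?\<sigma> i) @ ?\<sigma> j))"
    by (rule Cons.hyps(1)) (use Cons.prems Cons.hyps(2)[symmetric] in auto)
  also have "?\<sigma>(i := [], j := rev (?\<sigma> i) @ ?\<sigma> j) = \<sigma>(i := [], j := rev (\<sigma> i) @ \<sigma> j)"
    using Cons.prems Cons.hyps(2)[symmetric] by (auto simp: fun_eq_iff)
  finally show ?case .
qed

lemma wpb_clear [simp]: "0 \<notin> set (\<sigma> i) \<Longrightarrow> wpb b (clear i) \<sigma> Q = Q (\<sigma>(i := []))"
proof (induction "\<sigma> i" arbitrary: \<sigma>)
  case Nil
  then have "\<sigma>(i := []) = \<sigma>" by (auto simp: fun_eq_iff)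
  then show ?case using Nil.hyps[symmetric] by (simp add: mv_def clear_def del: fun_upd_apply)
next
  case (Cons x xs)
  let ?\<sigma> = "\<sigma>(i := xs)"
  have "wpb b (clear i) \<sigma> Q = wpb b (clear i) ?\<sigma> Q"
    unfolding mv_def clear_def using Cons.prems Cons.hyps(2)[symmetric] by (subst wpb_While) auto
  also have "\<dots> = Q (?\<sigma>(i := []))"
    by (rule Cons.hyps(1)) (use Cons.prems Cons.hyps(2)[symmetric] in auto)
  finally show ?case by simp
qed

text \<open>Stacks: 0 input and result, 2 tokens, 3 pending modes, 4 default mode, 5 output, 6 choices to come,
  7 choices made, 8 lost, 9 the formula, 10 quantifiers to come, 11 loop control, 12 parse error, 13 auxiliary.
  The choices False and True of the existential player are coded by 1 and 2, those of the other player by 3 and 4.\<close>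

definition cv :: "nat \<Rightarrow> bool" where "cv x \<longleftrightarrow> x \<in> {2, 4}"

section \<open>One play under given choices\<close>

definition act1 :: "nat \<Rightarrow> nat \<Rightarrow> bool \<Rightarrow> bool \<Rightarrow> com" where
  "act1 \<mu> t e a = (pushall 3 (pushed \<mu> t e a) ;; (if outp \<mu> t then Push 5 t else Skip) ;;
     (if \<mu> = 1 \<and> t = 2 then Case 8 (\<lambda>w. if w = 0 then Push 8 1 else Skip) else Skip) ;;
     (if sel \<mu> t a then Pop 4 ;; Push 4 (\<mu> + 2) else Skip))"

definition draw :: "(bool \<Rightarrow> com) \<Rightarrow> com" where
  "draw f = Case 6 (\<lambda>x. (if x = 0 then Skip else Pop 6 ;; Push 7 x) ;; f (cv x))"

definition token :: "nat \<Rightarrow> com" where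
  "token \<mu> = Case 2 (\<lambda>t. Pop 2 ;;
     (if needs \<mu> t then draw (\<lambda>e. draw (\<lambda>a. act1 \<mu> t e a)) else act1 \<mu> t False False))"

definition pass :: com where
  "pass = While 2 (- {0}) (Case 3 (\<lambda>\<mu>. if \<mu> = 0 then Case 4 token else Pop 3 ;; token \<mu>))"

definition st :: "store \<Rightarrow> nat list \<Rightarrow> nat list \<Rightarrow> nat list \<Rightarrow> nat list \<Rightarrow> nat list \<Rightarrow> nat list \<Rightarrow> bool \<Rightarrow> store" where
  "st \<sigma> G P M os C D l = \<sigma>(2 := G, 3 := P, 4 := M, 5 := os, 6 := C, 7 := D, 8 := if l then [1] else [])"

lemma st_get [simp]:
  "st \<sigma> G P M os C D l 2 = G" "st \<sigma> G P M os C D l 3 = P" "st \<sigma> G P M os C D l 4 = M" "st \<sigma> G P M os C D l 5 = os"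
  "st \<sigma> G P M os C D l 6 = C" "st \<sigma> G P M os C D l 7 = D" "st \<sigma> G P M os C D l 8 = (if l then [1] else [])"
  by (simp_all add: st_def)

lemma st_upd [simp]:
  "(st \<sigma> G P M os C D l)(2 := G') = st \<sigma> G' P M os C D l" "(st \<sigma> G P M os C D l)(3 := P') = st \<sigma> G P' M os C D l"
  "(st \<sigma> G P M os C D l)(4 := M') = st \<sigma> G P M' os C D l" "(st \<sigma> G P M os C D l)(5 := os') = st \<sigma> G P M os' C D l"
  "(st \<sigma> G P M os C D l)(6 := C') = st \<sigma> G P M os C' D l" "(st \<sigma> G P M os C D l)(7 := D') = st \<sigma> G P M os C D' l"
  "(st \<sigma> G P M os C D l)(8 := [Suc 0]) = st \<sigma> G P M os C D True"
  "(st \<sigma> G P M os C D l)(8 := []) = st \<sigma> G P M os C D False"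
  by (simp_all add: st_def fun_eq_iff)

lemma zero_tl: "0 \<notin> set xs \<Longrightarrow> 0 \<notin> set (tl xs)" for xs :: "nat list"
  by (cases xs) auto

lemma wpb_draw:
  assumes "0 \<notin> set C" "length C + length D \<le> b"
  shows "wpb b (draw f) (st \<sigma> G P M os C D l) Q =
    wpb b (f (hb (map cv C))) (st \<sigma> G P M os (tl C) (rev (take 1 C) @ D) l) Q"
  using assms by (cases C) (auto simp: draw_def cv_def)

lemma pushed_bounds: "length (pushed \<mu> t e a) \<le> 2" "0 \<notin> set (pushed \<mu> t e a)"
  by (auto simp: pushed_def)

lemma pushed_range: "set (pushed \<mu> t e a) \<subseteq> {0<..<9}"
  by (auto simp: pushed_def)

lemma wpb_act1:
  assumes "length P + 2 \<le> b" "length os < b" "1 \<le> b"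
  shows "wpb b (act1 \<mu> t e a) (st \<sigma> G P [m] os C D l) Q =
    Q (st \<sigma> G (pushed \<mu> t e a @ P) [if sel \<mu> t a then \<mu> + 2 else m] (if outp \<mu> t then t # os else os) C D (l \<or> \<mu> = 1 \<and> t = 2))"
  using assms pushed_bounds(1)[of \<mu> t e a] by (cases "\<mu> = 1 \<and> t = 2") (auto simp: act1_def)

lemma wpb_token:
  fixes \<mu> t :: nat
  assumes "length P + 2 \<le> b" "length os < b" "1 \<le> b" "0 \<notin> set C" "length C + length D \<le> b"
  defines "n \<equiv> needs \<mu> t"
  defines "e \<equiv> n \<and> hb (map cv C)" and "a \<equiv> n \<and> hb (tl (map cv C))"
  shows "wpb b (token \<mu>) (st \<sigma> (t # G) P [m] os C D l) Q =
    Q (st \<sigma> G (pushed \<mu> t e a @ P) [if sel \<mu> t a then \<mu> + 2 else m] (if outp \<mu> t then t # os else os)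
      (if n then tl (tl C) else C) (if n then rev (take 2 C) @ D else D) (l \<or> \<mu> = 1 \<and> t = 2))"
proof (cases n)
  case False
  then show ?thesis using assms by (simp add: token_def wpb_act1)
next
  case True
  have e: "rev (take (Suc 0) (tl C)) @ rev (take (Suc 0) C) @ D = rev (take 2 C) @ D"
    by (cases C) (auto simp: numeral_2_eq_2)
  have "0 \<notin> set (tl C)" using assms(4) by (cases C) auto
  moreover have "length (tl C) + length (rev (take 1 C) @ D) \<le> b" using assms(5) by (cases C) auto
  ultimately have "wpb b (token \<mu>) (st \<sigma> (t # G) P [m] os C D l) Q =
      wpb b (act1 \<mu> t (hb (map cv C)) (hb (tl (map cv C)))) (st \<sigma> G P [m] os (tl (tl C)) (rev (take 2 C) @ D) l) Q"
    using assms(4,5) True by (simp add: token_def n_def wpb_draw map_tl e)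
  then show ?thesis
    using True assms(1-3) unfolding e_def a_def by (simp only: wpb_act1 if_True simp_thms)
qed

text \<open>Choices drawn from stack 6 are kept on stack 7, so \<open>rev D @ C\<close> is invariant
  and the sequence can be restored for the next play. Each symbol replaces at most one pending mode
  by at most two, hence the bound on \<open>P\<close> and \<open>G\<close>.\<close>

lemma wpb_pass:
  assumes "psr m P G os l (map cv C) = (m', os', l', cs')" "0 < m"
    "length P + 2 * length G + 2 \<le> b" "length os + length G \<le> b" "length C + length D \<le> b"
    "0 \<notin> set P" "0 \<notin> set G" "0 \<notin> set C" "0 \<notin> set os"
    and Q: "\<And>P' C' D'. map cv C' = cs' \<Longrightarrow> rev D' @ C' = rev D @ C \<Longrightarrow> length C' + length D' = length C + length D \<Longrightarrow>
      0 \<notin> set C' \<Longrightarrow> 0 \<notin> set P' \<Longrightarrow> 0 \<notin> set os' \<Longrightarrow> Q (st \<sigma> [] P' [m'] os' C' D' l')"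
  shows "wpb b pass (st \<sigma> G P [m] os C D l) Q"
  using assms
proof (induction G arbitrary: m P os l C D)
  case Nil
  then show ?case by (simp add: pass_def)
next
  case (Cons t G)
  define \<mu> where "\<mu> = (case P of [] \<Rightarrow> m | \<mu> # _ \<Rightarrow> \<mu>)"
  define n where "n \<longleftrightarrow> needs \<mu> t"
  define e where "e \<longleftrightarrow> n \<and> hb (map cv C)"
  define a where "a \<longleftrightarrow> n \<and> hb (tl (map cv C))"
  let ?C = "if n then tl (tl C) else C" and ?D = "if n then rev (take 2 C) @ D else D"
  let ?st = "st \<sigma> G (pushed \<mu> t e a @ tl P) [if sel \<mu> t a then \<mu> + 2 else m]
      (if outp \<mu> t then t # os else os) ?C ?D (l \<or> \<mu> = 1 \<and> t = 2)"
  have C2: "take 2 C @ tl (tl C) = C" by (metis append_take_drop_id drop_Suc numeral_2_eq_2 drop_0)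
  have C: "rev ?D @ ?C = rev D @ C" using C2 by simp
  then have CD: "length ?C + length ?D = length C + length D" by (metis add.commute length_append length_rev)
  have sC: "set ?C \<subseteq> set C" using C2 by (metis Un_upper2 order_refl set_append)
  have t0: "t \<noteq> 0" using Cons.prems by auto
  have "psr (if sel \<mu> t a then \<mu> + 2 else m) (pushed \<mu> t e a @ tl P) G (if outp \<mu> t then t # os else os)
      (l \<or> \<mu> = 1 \<and> t = 2) (map cv ?C) = (m', os', l', cs')"
  proof -
    have "map cv ?C = (if n then tl (tl (map cv C)) else map cv C)" by (simp add: map_tl)
    then show ?thesis
      using Cons.prems(1) by (simp only: psr.simps Let_def \<mu>_def[symmetric] n_def[symmetric] e_def[symmetric] a_def[symmetric])
  qed
  moreover have "length (pushed \<mu> t e a @ tl P) + 2 * length G + 2 \<le> b"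
    using pushed_bounds(1)[of \<mu> t e a] Cons.prems(3) by simp
  moreover have "0 \<notin> set (pushed \<mu> t e a @ tl P)"
    using pushed_bounds(2)[of \<mu> t e a] Cons.prems(6) by (cases P) auto
  ultimately have "wpb b pass ?st Q"
    using Cons.prems C CD sC by (intro Cons.IH) (auto simp: t0)
  moreover have "wpb b (token \<mu>) (st \<sigma> (t # G) (tl P) [m] os C D l) Q' = Q' ?st" for Q'
    using Cons.prems(3-5,8) wpb_token[of "tl P" b os C D \<mu> \<sigma> t G m l Q'] by (simp add: n_def e_def a_def)
  moreover have "wpb b (Case 3 (\<lambda>\<mu>. if \<mu> = 0 then Case 4 token else Pop 3 ;; token \<mu>)) (st \<sigma> (t # G) P [m] os C D l) Q' =
      wpb b (token \<mu>) (st \<sigma> (t # G) (tl P) [m] os C D l) Q'" for Q'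
    using Cons.prems(6) by (cases P) (auto simp: \<mu>_def)
  ultimately show ?case
    unfolding pass_def by (subst wpb_While) (auto simp: t0)
qed

definition game :: com where
  "game = While 2 (- {0}) (Push 4 1 ;; pass ;; clear 3 ;; Pop 4 ;; mv 5 (psh 2) ;;
     draw (\<lambda>e. draw (\<lambda>a. Push 4 (4 + of_bool a))) ;; pass ;; clear 3 ;;
     Case 4 (\<lambda>m. Pop 4 ;; (if m \<in> {6, 7} then mv 5 (psh 2) else clear 5)))"

text \<open>The loss flag ends up as the negated value of the play: once no symbol is left or no
  diamond has been selected, the defender wins iff nothing has been lost.\<close>

lemma wpb_game:
  assumes "0 \<notin> set G" "0 \<notin> set C" "2 * length G + 2 \<le> b" "length C + length D \<le> b"
    and Q: "\<And>C' D'. rev D' @ C' = rev D @ C \<Longrightarrow> length C' + length D' = length C + length D \<Longrightarrow> 0 \<notin> set C' \<Longrightarrow>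
      Q (st \<sigma> [] [] [] [] C' D' (\<not> play G l (map cv C)))"
  shows "wpb b game (st \<sigma> G [] [] [] C D l) Q"
  using assms
proof (induction "length G" arbitrary: G C D l rule: less_induct)
  case less
  show ?case
  proof (cases "G = []")
    case True
    then show ?thesis using less.prems(5)[of D C] less.prems(2) by (simp add: game_def play.simps)
  next
    case False
    obtain m1 os1 l1 cs1 where p1: "psr 1 [] G [] l (map cv C) = (m1, os1, l1, cs1)" by (metis prod_cases4)
    define a where "a = hb (tl cs1)"
    obtain m2 os2 l2 cs2 where p2: "psr (4 + of_bool a) [] (rev os1) [] l1 (tl (tl cs1)) = (m2, os2, l2, cs2)"
      by (metis prod_cases4)
    have play: "play G l (map cv C) = (if m2 \<in> {6, 7} then play (rev os2) l2 cs2 else \<not> l2)"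
      using False p1 p2 by (simp add: play.simps[of G] a_def)
    have len1: "length os1 \<le> length G" using psr_length[OF p1] by simp
    have len2: "length os2 \<le> length os1" using psr_length[OF p2] by simp
    have h: "hd0 (st \<sigma> G [] [] [] C D l 2) \<in> - {0}" using False less.prems(1) by (cases G) auto
    show ?thesis
      unfolding game_def
      apply (subst wpb_While, rule h)
      apply (unfold wpb_simps(4))
      apply (fold game_def)
      apply (simp only: wpb_simps(2) st_get st_upd)
      apply (rule conjI, use less.prems(3) in simp)
      apply (rule wpb_pass[OF p1])
      using less.prems apply simp_all[8]
      subgoal premises q for P' C' D'
      proof -
        have C': "0 \<notin> set (tl C')" "0 \<notin> set (tl (tl C'))" using q(4) zero_tl by blast+
        have 1: "length C' + length D' \<le> b" using q(3) less.prems(4) by simp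
        have 2: "length (tl C') + length (rev (take 1 C') @ D') = length C + length D"
          using q(3) by (cases C') auto
        have 3: "rev (take (Suc 0) (tl C')) @ rev (take (Suc 0) C') @ D' = rev (take 2 C') @ D'"
          by (cases C') (auto simp: numeral_2_eq_2)
        have 4: "take 2 C' @ tl (tl C') = C'" by (metis append_take_drop_id drop_Suc numeral_2_eq_2 drop_0)
        have a: "hb (map cv (tl C')) = a" unfolding a_def q(1)[symmetric] by (simp add: map_tl)
        have 5: "map cv (tl (tl C')) = tl (tl cs1)" using q(1) by (metis map_tl)
        have 6: "length (tl (tl C')) + length (rev (take 2 C') @ D') = length C + length D"
          using q(3) 4 by (metis add.assoc add.commute length_append length_rev)
        have 7: "rev (rev (take 2 C') @ D') @ tl (tl C') = rev D @ C" using q(2) 4 by simp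
        \<comment> \<open>What follows the choice of the modality, with the drawn pair already moved
          to stack 7.\<close>
        have next_pass: "wpb b pass (st \<sigma> (rev os1) [] [4 + of_bool a] [] (tl (tl C')) (rev (take 2 C') @ D') l1)
          (\<lambda>\<sigma>'. wpb b (clear 3) \<sigma>' (\<lambda>\<sigma>'. wpb b (Case 4 (\<lambda>m. Pop 4 ;; (if m \<in> {6, 7} then mv 5 (psh 2) else clear 5)))
            \<sigma>' (\<lambda>\<sigma>'. wpb b game \<sigma>' Q)))"
        proof (rule wpb_pass[OF p2[folded 5]])
          fix P2 C2 D2 :: "nat list"
          assume r: "map cv C2 = cs2" "rev D2 @ C2 = rev (rev (take 2 C') @ D') @ tl (tl C')"
            "length C2 + length D2 = length (tl (tl C')) + length (rev (take 2 C') @ D')" "0 \<notin> set C2" "0 \<notin> set P2" "0 \<notin> set os2"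
          show "wpb b (clear 3) (st \<sigma> [] P2 [m2] os2 C2 D2 l2) (\<lambda>\<sigma>'. wpb b (Case 4 (\<lambda>m. Pop 4 ;;
              (if m \<in> {6, 7} then mv 5 (psh 2) else clear 5))) \<sigma>' (\<lambda>\<sigma>'. wpb b game \<sigma>' Q))"
          proof (cases "m2 \<in> {6, 7}")
            case True
            have lt: "length (rev os2) < length G"
              using play_less[OF p1 p2 True] by simp
            have "wpb b game (st \<sigma> (rev os2) [] [] [] C2 D2 l2) Q"
              by (rule less.hyps[OF lt]) (use less.prems r 6 7 lt play True in auto)
            then show ?thesis using r True lt less.prems(3) by simp
          next
            case False
            have "Q (st \<sigma> [] [] [] [] C2 D2 (\<not> play G l (map cv C)))"
              by (rule less.prems(5)) (use r 6 7 in auto)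
            then show ?thesis using r False play by (simp add: game_def)
          qed
        qed (use len1 less.prems C' 6 q in auto)
        show ?thesis
          using q(4-6) C' 1 2 len1 less.prems(3) next_pass by (cases a) (simp_all add: wpb_draw 3 a)
      qed
      done
  qed
qed

section \<open>Backtracking over all choice sequences\<close>

definition q :: "nat list \<Rightarrow> nat list \<Rightarrow> nat list \<Rightarrow> nat list \<Rightarrow> nat list \<Rightarrow> store" where
  "q F B R V Z = (\<lambda>_. [])(9 := F, 7 := B, 10 := R, 0 := V, 11 := Z)"

lemma q_get [simp]:
  "q F B R V Z 9 = F" "q F B R V Z 7 = B" "q F B R V Z 10 = R" "q F B R V Z 0 = V" "q F B R V Z 11 = Z"
  "q F B R V Z 13 = []" "q F B R V Z 2 = []" "q F B R V Z 6 = []" "q F B R V Z 5 = []"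
  by (simp_all add: q_def)

lemma q_upd [simp]:
  "(q F B R V Z)(7 := B') = q F B' R V Z" "(q F B R V Z)(10 := R') = q F B R' V Z"
  "(q F B R V Z)(0 := V') = q F B R V' Z" "(q F B R V Z)(11 := Z') = q F B R V Z'"
  by (simp_all add: q_def fun_eq_iff)

lemma wpb_mv2:
  "0 \<notin> set (\<sigma> i) \<Longrightarrow> i \<noteq> j \<Longrightarrow> i \<noteq> j' \<Longrightarrow> j \<noteq> j' \<Longrightarrow> length (\<sigma> i) + length (\<sigma> j) \<le> b \<Longrightarrow>
    length (\<sigma> i) + length (\<sigma> j') \<le> b \<Longrightarrow>
    wpb b (mv i (\<lambda>a. psh j a ;; psh j' a)) \<sigma> Q = Q (\<sigma>(i := [], j := rev (\<sigma> i) @ \<sigma> j, j' := rev (\<sigma> i) @ \<sigma> j'))"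
proof (induction "\<sigma> i" arbitrary: \<sigma>)
  case Nil
  then have "\<sigma>(i := [], j := rev (\<sigma> i) @ \<sigma> j, j' := rev (\<sigma> i) @ \<sigma> j') = \<sigma>" by (auto simp: fun_eq_iff)
  then show ?case using Nil.hyps[symmetric] by (simp add: mv_def del: fun_upd_apply)
next
  case (Cons x xs)
  let ?\<sigma> = "\<sigma>(i := xs, j := x # \<sigma> j, j' := x # \<sigma> j')"
  have "wpb b (mv i (\<lambda>a. psh j a ;; psh j' a)) \<sigma> Q = wpb b (mv i (\<lambda>a. psh j a ;; psh j' a)) ?\<sigma> Q"
    unfolding mv_def using Cons.prems Cons.hyps(2)[symmetric] by (subst wpb_While) (auto simp: psh_def)
  also have "\<dots> = Q (?\<sigma>(i := [], j := rev (?\<sigma> i) @ ?\<sigma> j, j' := rev (?\<sigma> i) @ ?\<sigma> j'))"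
    by (rule Cons.hyps(1)) (use Cons.prems Cons.hyps(2)[symmetric] in auto)
  also have "?\<sigma>(i := [], j := rev (?\<sigma> i) @ ?\<sigma> j, j' := rev (?\<sigma> i) @ ?\<sigma> j') =
      \<sigma>(i := [], j := rev (\<sigma> i) @ \<sigma> j, j' := rev (\<sigma> i) @ \<sigma> j')"
    using Cons.prems Cons.hyps(2)[symmetric] by (auto simp: fun_eq_iff)
  finally show ?case .
qed

text \<open>Every leaf needs the formula again, so it is copied, by way of stack 13 because one move
  reverses a stack. Moving stack 7 to 6 puts the oldest choice on top; the last move brings unread
  choices back.\<close>

definition leafc :: com where
  "leafc = (mv 9 (psh 13) ;; mv 13 (\<lambda>a. psh 9 a ;; psh 2 a) ;; mv 7 (psh 6) ;; game ;; mv 6 (psh 7) ;;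
     Case 8 (\<lambda>w. if w = 0 then Push 0 2 else Pop 8 ;; Push 0 1))"

lemma wpb_leafc:
  assumes F: "0 \<notin> set F" "2 * length F + 2 \<le> b" and B: "0 \<notin> set B" "length B \<le> b"
    and Q: "Q (q F B R [if play F False (map cv (rev B)) then 2 else 1] Z)"
  shows "wpb b leafc (q F B R [] Z) Q"
proof -
  let ?\<sigma> = "q F [] R [] Z"
  have 1: "((q F B R [] Z)(9 := [], 13 := rev F @ q F B R [] Z 13))(13 := [], 9 := rev (rev F @ q F B R [] Z 13) @ [],
      2 := rev (rev F @ q F B R [] Z 13) @ q F B R [] Z 2, 7 := [], 6 := rev B @ q F B R [] Z 6) = st ?\<sigma> F [] [] [] (rev B) [] False"
    by (auto simp: q_def st_def fun_eq_iff)
  have z: "q F B R [] Z 13 = []" "q F B R [] Z 2 = []" "q F B R [] Z 6 = []"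
    "\<And>V. st ?\<sigma> G P M os C D l 0 = []" for G P M os C D l by (simp_all add: q_def st_def)
  have "wpb b (game ;; mv 6 (psh 7) ;; Case 8 (\<lambda>w. if w = 0 then Push 0 2 else Pop 8 ;; Push 0 1))
      (st ?\<sigma> F [] [] [] (rev B) [] False) Q"
    unfolding wpb_simps(4)
  proof (rule wpb_game)
    fix C' D' assume C: "rev D' @ C' = rev [] @ rev B" "length C' + length D' = length (rev B) + length ([] :: nat list)" "0 \<notin> set C'"
    have "rev C' @ D' = B" using C(1) by (metis append.left_neutral rev.simps(1) rev_append rev_rev_ident)
    moreover have "(st ?\<sigma> [] [] [] [] [] B False)(0 := v) = q F B R v Z" for v
      by (auto simp: q_def st_def fun_eq_iff)
    ultimately show "wpb b (mv 6 (psh 7)) (st ?\<sigma> [] [] [] [] C' D' (\<not> play F False (map cv (rev B)))) (\<lambda>\<sigma>'. wpb b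
        (Case 8 (\<lambda>w. if w = 0 then Push 0 2 else Pop 8 ;; Push 0 1)) \<sigma>' Q)"
      using C Q F(2) B(2) by (cases "play F False (map cv (rev B))") (simp_all add: z)
  qed (use F B in auto)
  then show ?thesis
    unfolding leafc_def using F B 1 by (simp add: z wpb_mv2)
qed

fun val :: "nat list \<Rightarrow> nat list \<Rightarrow> nat list \<Rightarrow> bool" where
  "val F [] B = play F False (map cv (rev B))"
| "val F (r # R) B = (if r = 1 then val F R (1 # B) \<or> val F R (2 # B) else val F R (3 # B) \<and> val F R (4 # B))"

text \<open>The code of the last choice tells its quantifier and whether the alternative is still
  open, so no recursion stack is needed. A result that settles the quantifier skips the alternative;
  going up puts the quantifier back on stack 10.\<close>

definition retreat :: "nat \<Rightarrow> nat \<Rightarrow> com" where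
  "retreat v x = (if x = 0 then Pop 11 else Pop 7 ;;
     (if x = 1 then (if v = 2 then Push 10 1 else Pop 0 ;; Push 7 2)
      else if x = 2 then Push 10 1
      else if x = 3 then (if v = 1 then Push 10 2 else Pop 0 ;; Push 7 4)
      else Push 10 2))"

definition search :: com where
  "search = While 11 (- {0}) (Case 0 (\<lambda>v. if v = 0
     then Case 10 (\<lambda>r. if r = 0 then leafc else Pop 10 ;; Push 7 (if r = 1 then 1 else 3))
     else Case 7 (retreat v)))"

abbreviation "res v \<equiv> [if v then 2 else (1 :: nat)]"

lemma wpb_search_step:
  "wpb b search (q F B R V [1]) Q = wpb b (Case 0 (\<lambda>v. if v = 0
     then Case 10 (\<lambda>r. if r = 0 then leafc else Pop 10 ;; Push 7 (if r = 1 then 1 else 3))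
     else Case 7 (retreat v))) (q F B R V [1]) (\<lambda>\<sigma>. wpb b search \<sigma> Q)"
  unfolding search_def by (rule wpb_While) simp

text \<open>The search is one flat loop, so a subtree is not a terminating subprogram. Instead the
  loop that enters a subtree is reduced to the same loop leaving it with the result.\<close>

lemma wpb_search:
  assumes "0 \<notin> set F" "2 * length F + 2 \<le> b" "0 \<notin> set B" "length B + length R \<le> b" "set R \<subseteq> {1, 2}"
    and "wpb b search (q F B R (res (val F R B)) [1]) Q"
  shows "wpb b search (q F B R [] [1]) Q"
  using assms(3-6)
proof (induction R arbitrary: B)
  case Nil
  then have "wpb b leafc (q F B [] [] [1]) (\<lambda>\<sigma>. wpb b search \<sigma> Q)"
    using assms(1,2) by (intro wpb_leafc) auto
  then show ?case by (subst wpb_search_step) simp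
next
  case (Cons r R)
  define x y where "x = (if r = 1 then 1 else 3 :: nat)" and "y = (if r = 1 then 2 else 4 :: nat)"
  have r: "r = 1 \<or> r = 2" using Cons.prems(3) by auto
  have len: "length B + length R < b" using Cons.prems(2) by simp
  \<comment> \<open>The condition says that the first choice has not settled the value.\<close>
  have 2: "wpb b search (q F (y # B) R [] [1]) Q"
    if "val F (r # R) B = val F R (y # B)"
  proof (rule Cons.IH)
    have "wpb b search (q F B (r # R) (res (val F R (y # B))) [1]) Q" using Cons.prems(4) that by simp
    then show "wpb b search (q F (y # B) R (res (val F R (y # B))) [1]) Q"
      using r len by (subst wpb_search_step) (auto simp: retreat_def x_def y_def)
  qed (use Cons.prems in \<open>auto simp: x_def y_def\<close>)
  have 1: "wpb b search (q F (x # B) R [] [1]) Q"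
  proof (rule Cons.IH)
    show "wpb b search (q F (x # B) R (res (val F R (x # B))) [1]) Q"
    proof (cases "val F R (x # B) = (r = 1)")
      case True
      then have "val F (r # R) B = val F R (x # B)" by (auto simp: x_def y_def)
      then show ?thesis
        using True r len Cons.prems(4) by (subst wpb_search_step) (auto simp: retreat_def x_def y_def)
    next
      case False
      then have "val F (r # R) B = val F R (y # B)" using r by (auto simp: x_def y_def)
      from 2[OF this] show ?thesis
        using False r len by (subst wpb_search_step) (auto simp: retreat_def x_def y_def)
    qed
  qed (use Cons.prems in \<open>auto simp: x_def y_def\<close>)
  then show ?case
    using r len by (subst wpb_search_step) (auto simp: x_def y_def)
qed

definition quants :: "nat \<Rightarrow> nat list" where "quants m = concat (replicate m [1, 2])"

lemma val_qq: "val F (quants m) B = qq m (\<lambda>bs. play F False (map cv (rev B) @ bs))"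
  by (induction m arbitrary: B) (auto simp: quants_def cv_def ex_bool_eq all_bool_eq)

lemma val_tsat: "2 * length (tks \<Gamma>) + 1 \<le> m \<Longrightarrow> val (tks \<Gamma>) (quants m) [] = tsat \<Gamma>"
  using ev_play[of \<Gamma> False] by (simp add: val_qq ev_def)

text \<open>Two rounds per symbol and one more, the number required by
  \<open>ev_play\<close>.\<close>

definition main :: com where
  "main = (mv 5 (\<lambda>a. psh 9 a ;; pushall 10 [1, 2, 1, 2]) ;; pushall 10 [1, 2] ;; Push 11 1 ;; search)"

lemma wpb_count:
  assumes "0 \<notin> set os" "length os + length F \<le> b" "4 * length os + length R \<le> b"
  shows "wpb b (mv 5 (\<lambda>a. psh 9 a ;; pushall 10 [1, 2, 1, 2])) ((q F [] R [] [])(5 := os)) Q =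
    Q (q (rev os @ F) [] (quants (2 * length os) @ R) [] [])"
  using assms
proof (induction os arbitrary: F R)
  case Nil
  have "(q F [] R [] [])(5 := []) = q F [] R [] []" by (auto simp: q_def fun_eq_iff)
  then show ?case by (simp add: mv_def quants_def del: fun_upd_apply)
next
  case (Cons x xs)
  have u: "((q F [] R [] [])(5 := xs, 9 := F', 10 := R')) = (q F' [] R' [] [])(5 := xs)" for F' R'
    by (auto simp: q_def fun_eq_iff)
  have 2: "quants (2 * length xs) @ [1, 2, 1, 2] @ R = quants (2 * length (x # xs)) @ R"
  proof -
    have "quants (m + 2) = quants m @ [1, 2, 1, 2]" for m
      unfolding quants_def replicate_add concat_append by (simp add: numeral_2_eq_2)
    from this[of "2 * length xs"] show ?thesis by (simp add: mult_2)
  qed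
  have "wpb b (mv 5 (\<lambda>a. psh 9 a ;; pushall 10 [1, 2, 1, 2])) ((q F [] R [] [])(5 := x # xs)) Q =
      wpb b (mv 5 (\<lambda>a. psh 9 a ;; pushall 10 [1, 2, 1, 2])) ((q (x # F) [] ([1, 2, 1, 2] @ R) [] [])(5 := xs)) Q"
    unfolding mv_def using Cons.prems
    by (subst wpb_While) (auto simp: psh_def u simp del: pushall.simps)
  also have "\<dots> = Q (q (rev xs @ x # F) [] (quants (2 * length xs) @ [1, 2, 1, 2] @ R) [] [])"
    by (rule Cons.IH) (use Cons.prems in auto)
  finally show ?case unfolding 2 by (simp del: fun_upd_apply pushall.simps)
qed

lemma wpb_main:
  assumes F: "F = tks \<Gamma>" "0 \<notin> set F" "4 * length F + 10 \<le> b"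
    and Q: "Q (q F [] (quants (2 * length F + 1)) (res (tsat \<Gamma>)) [])"
  shows "wpb b main ((\<lambda>_. [])(5 := rev F)) Q"
proof -
  let ?R = "quants (2 * length F + 1)"
  have s: "(\<lambda>_. [])(5 := rev F) = (q [] [] [] [] [])(5 := rev F)" by (auto simp: q_def fun_eq_iff)
  have R: "?R = [1, 2] @ quants (2 * length F)" by (simp add: quants_def)
  have lR: "length ?R = 4 * length F + 2" by (simp add: quants_def length_concat sum_list_replicate)
  have "set ?R \<subseteq> {1, 2}" by (auto simp: quants_def)
  moreover have "wpb b search (q F [] ?R (res (val F ?R [])) [1]) Q"
    using Q F val_tsat[of \<Gamma> "2 * length F + 1"]
    by (subst wpb_search_step) (simp add: retreat_def search_def)
  ultimately have "wpb b search (q F [] ?R [] [1]) Q"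
    using F lR by (intro wpb_search) auto
  then show ?thesis
    using F lR wpb_count[of "rev F" "[]" b "[]"] unfolding main_def s R by (simp del: pushall.simps)
qed

section \<open>Parser and translation\<close>

text \<open>Parse modes: 1 and 2 for a formula to be translated with sign True and False, 3 and 4 for the
  index of a variable; 5 and 6 for an index that must not be 0.\<close>

definition tab :: "connective set \<Rightarrow> nat \<Rightarrow> bool list \<Rightarrow> (nat list \<times> nat list) option" where
  "tab S \<mu> w = (let t = (\<lambda>a b. if \<mu> = 1 then a else (b :: nat)) in
     if w = [False, False, False, False] then Some ([t 3 4], [t 8 6])
     else if w = [False, False, False, True] \<and> ATNEG \<in> S then Some ([t 4 3], [t 6 8])
     else if w = [False, False, True, False] \<and> NEG \<in> S then Some ([t 2 1], [])
     else if w = [False, False, True, True] \<and> AND \<in> S then Some ([\<mu>, \<mu>], [t 3 4])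
     else if w = [False, True, False, False] \<and> OR \<in> S then Some ([\<mu>, \<mu>], [t 4 3])
     else if w = [False, True, False, True] \<and> BOX \<in> S then Some ([\<mu>], [t 5 7])
     else if w = [False, True, True, False] \<and> DIA \<in> S then Some ([\<mu>], [t 7 5])
     else if w = [False, True, True, True] \<and> TRUE \<in> S then Some ([], [t 1 2])
     else if w = [True, False, False, False] \<and> FALSE \<in> S then Some ([], [t 2 1])
     else None)"

text \<open>After the digit \<open>False\<close> the rest must be positive, as the most significant
  digit written by \<open>enc_nat\<close> is never \<open>False\<close>. Otherwise strings outside
  the range of \<open>enc\<close> would be accepted.\<close>

definition digit :: "nat \<Rightarrow> bool \<Rightarrow> nat list \<times> nat list" where
  "digit \<mu> d = (let t = (\<lambda>a b. if \<mu> \<in> {3, 5} then a else (b :: nat)) in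
     ([if d then t 3 4 else t 5 6], [t 8 6, t 7 5 + of_bool d]))"

definition stop :: "nat \<Rightarrow> (nat list \<times> nat list) option" where
  "stop \<mu> = (if \<mu> = 3 then Some ([], [7, 1]) else if \<mu> = 4 then Some ([], [5, 2]) else None)"

fun pstep :: "connective set \<Rightarrow> nat \<Rightarrow> bool list \<Rightarrow> (nat list \<times> nat list \<times> bool list) option" where
  "pstep S \<mu> X = (if \<mu> \<in> {1, 2} then
     (case X of a # b # c # d # X' \<Rightarrow> (case tab S \<mu> [a, b, c, d] of None \<Rightarrow> None | Some (pu, ou) \<Rightarrow> Some (pu, ou, X')) | _ \<Rightarrow> None)
   else case X of [] \<Rightarrow> None
     | x # X' \<Rightarrow> (if x then (case X' of [] \<Rightarrow> None | d # X'' \<Rightarrow> Some (fst (digit \<mu> d), snd (digit \<mu> d), X''))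
         else (case stop \<mu> of None \<Rightarrow> None | Some (pu, ou) \<Rightarrow> Some (pu, ou, X'))))"

text \<open>The 1 is offset by the mode that the step removes: output, pending modes and unread
  input together never get longer, so parsing takes linear space.\<close>

lemma pstep_shape:
  assumes "pstep S \<mu> X = Some (pu, ou, X')"
  shows "length X' < length X" "0 \<notin> set pu" "0 \<notin> set ou" "length ou + length pu + length X' \<le> length X + 1"
  using assms
  by (auto simp: tab_def digit_def stop_def Let_def split: if_splits list.splits option.splits prod.splits)

function prs :: "connective set \<Rightarrow> nat list \<Rightarrow> bool list \<Rightarrow> nat list \<Rightarrow> (bool list \<times> nat list) option" where
  "prs S [] X os = Some (X, os)"
| "prs S (\<mu> # P) X os = (case pstep S \<mu> X of None \<Rightarrow> None | Some (pu, ou, X') \<Rightarrow> prs S (pu @ P) X' (rev ou @ os))"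
  by pat_completeness auto
termination
  by (relation "measures [\<lambda>(S, P, X, os). length X]") (auto dest: pstep_shape(1)[OF sym] pstep_shape(1) simp del: pstep.simps)

lemma prs_length: "prs S P X os = Some (X', os') \<Longrightarrow> length os' \<le> length os + length P + length X"
proof (induction S P X os rule: prs.induct)
  case (2 S \<mu> P X os)
  then obtain pu ou Y where r: "pstep S \<mu> X = Some (pu, ou, Y)" "prs S (pu @ P) Y (rev ou @ os) = Some (X', os')"
    by (auto simp del: pstep.simps split: option.splits)
  show ?case using "2.IH"[OF r(1) refl refl r(2)] pstep_shape(4)[OF r(1)] by simp
qed simp

declare pstep.simps [simp del]

text \<open>Emptying the pending modes ends the loop of \<open>parse\<close>.\<close>

definition fail :: com where "fail = (Push 12 1 ;; clear 3)"

definition rdb :: "(bool \<Rightarrow> com) \<Rightarrow> com" where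
  "rdb f = Case 0 (\<lambda>x. if x = 0 then fail else Pop 0 ;; f (x = 2))"

fun finishc :: "(nat list \<times> nat list) option \<Rightarrow> com" where
  "finishc None = fail"
| "finishc (Some (pu, ou)) = (pushall 3 pu ;; pushall 5 (rev ou))"

definition pact :: "connective set \<Rightarrow> nat \<Rightarrow> com" where
  "pact S \<mu> = (if \<mu> \<in> {1, 2} then rdb (\<lambda>a. rdb (\<lambda>b. rdb (\<lambda>c. rdb (\<lambda>d. finishc (tab S \<mu> [a, b, c, d])))))
     else rdb (\<lambda>x. if x then rdb (\<lambda>d. finishc (Some (digit \<mu> d))) else finishc (stop \<mu>)))"

definition ps :: "bool list \<Rightarrow> nat list \<Rightarrow> nat list \<Rightarrow> store" where
  "ps X P os = (\<lambda>_. [])(0 := map bsym X, 3 := P, 5 := os)"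

lemma ps_get [simp]: "ps X P os 0 = map bsym X" "ps X P os 3 = P" "ps X P os 5 = os" "ps X P os 12 = []"
  by (simp_all add: ps_def)

lemma ps_upd [simp]: "(ps X P os)(0 := map bsym X') = ps X' P os" "(ps X P os)(3 := P') = ps X P' os" "(ps X P os)(5 := os') = ps X P os'"
  by (simp_all add: ps_def fun_eq_iff)

definition failed :: "bool list \<Rightarrow> nat list \<Rightarrow> store" where
  "failed X os = (ps X [] os)(12 := [1])"

lemma wpb_fail:
  assumes "0 \<notin> set P" "1 \<le> b" "Q (failed X os)"
  shows "wpb b fail (ps X P os) Q"
proof -
  have e: "(ps X P os)(12 := [1], 3 := []) = failed X os" by (auto simp: ps_def failed_def fun_eq_iff)
  have "((ps X P os)(12 := [1])) 3 = P" by simp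
  then have "wpb b (clear 3) ((ps X P os)(12 := [1])) Q" using assms e by (subst wpb_clear) (simp_all del: fun_upd_apply)
  then show ?thesis using assms(2) by (simp add: fail_def del: fun_upd_apply)
qed

lemma wpb_rdb:
  assumes "0 \<notin> set P" "1 \<le> b" "X = [] \<Longrightarrow> Q (failed [] os)"
    and "\<And>x X'. X = x # X' \<Longrightarrow> wpb b (f x) (ps X' P os) Q"
  shows "wpb b (rdb f) (ps X P os) Q"
proof (cases X)
  case Nil
  then show ?thesis using wpb_fail[OF assms(1,2)] assms(3) by (simp add: rdb_def)
next
  case (Cons x X')
  have "bsym x \<noteq> 0" by (simp add: bsym_def)
  then show ?thesis using assms(4)[OF Cons] by (simp add: rdb_def Cons)
qed

lemma wpb_finishc:
  assumes "0 \<notin> set P" "1 \<le> b" "r = None \<Longrightarrow> Q (failed X os)"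
    and "\<And>pu ou. r = Some (pu, ou) \<Longrightarrow> length pu + length P \<le> b \<and> length ou + length os \<le> b \<and> Q (ps X (pu @ P) (rev ou @ os))"
  shows "wpb b (finishc r) (ps X P os) Q"
proof (cases r)
  case None
  then show ?thesis using wpb_fail[OF assms(1,2)] assms(3) by simp
next
  case (Some a)
  then show ?thesis using assms(4) by (cases a) auto
qed

lemma wpb_pact:
  assumes "0 \<notin> set P" "1 \<le> b" "\<And>X'. pstep S \<mu> X = None \<Longrightarrow> Q (failed X' os)"
    and "\<And>pu ou X'. pstep S \<mu> X = Some (pu, ou, X') \<Longrightarrow>
      length pu + length P \<le> b \<and> length ou + length os \<le> b \<and> Q (ps X' (pu @ P) (rev ou @ os))"
  shows "wpb b (pact S \<mu>) (ps X P os) Q"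
proof (cases "\<mu> \<in> {1, 2}")
  case True
  then show ?thesis
    unfolding pact_def using assms
    by (simp only: if_True) (intro wpb_rdb wpb_finishc, auto simp: pstep.simps)
next
  case False
  have "wpb b (rdb (\<lambda>x. if x then rdb (\<lambda>d. finishc (Some (digit \<mu> d))) else finishc (stop \<mu>))) (ps X P os) Q"
  proof (rule wpb_rdb[OF assms(1,2)])
    fix x X' assume X: "X = x # X'"
    show "wpb b (if x then rdb (\<lambda>d. finishc (Some (digit \<mu> d))) else finishc (stop \<mu>)) (ps X' P os) Q"
    proof (cases x)
      case True
      then show ?thesis
        using False X assms(3,4) unfolding if_True
        by (simp only: if_True) (intro wpb_rdb wpb_finishc assms(1,2); auto simp: pstep.simps)
    next
      case x: False
      then show ?thesis
        using False X assms(3,4)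
        by (simp only: if_False) (intro wpb_finishc assms(1,2); auto simp: pstep.simps)
    qed
  qed (use False assms(3) in \<open>auto simp: pstep.simps\<close>)
  then show ?thesis using False by (simp only: pact_def if_False)
qed

definition parse :: "connective set \<Rightarrow> com" where
  "parse S = While 3 (- {0}) (Case 3 (\<lambda>\<mu>. Pop 3 ;; pact S \<mu>))"

lemma wpb_parse:
  assumes "0 \<notin> set P" "0 \<notin> set os" "1 \<le> b" "length os + length P + length X \<le> b"
    and "prs S P X os = None \<Longrightarrow> (\<And>X os. Q (failed X os))"
    and "\<And>X' os'. prs S P X os = Some (X', os') \<Longrightarrow> 0 \<notin> set os' \<Longrightarrow> length os' \<le> b \<Longrightarrow> Q (ps X' [] os')"
  shows "wpb b (parse S) (ps X P os) Q"
  using assms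
proof (induction S P X os rule: prs.induct)
  case (1 S X os)
  then show ?case by (simp add: parse_def)
next
  case (2 S \<mu> P X os)
  have "wpb b (pact S \<mu>) (ps X P os) (\<lambda>\<sigma>. wpb b (parse S) \<sigma> Q)"
  proof (cases "pstep S \<mu> X")
    case None
    then have "Q (failed X os)" for X using "2.prems"(5) by simp
    then have "wpb b (parse S) (failed X os) Q" for X by (simp add: parse_def failed_def)
    then show ?thesis using "2.prems" None by (intro wpb_pact) auto
  next
    case (Some r)
    then obtain pu ou X' where r: "pstep S \<mu> X = Some (pu, ou, X')" by (cases r) auto
    have sh: "length X' < length X" "0 \<notin> set pu" "0 \<notin> set ou" "length ou + length pu + length X' \<le> length X + 1"
      using pstep_shape[OF r] by auto
    have "wpb b (parse S) (ps X' (pu @ P) (rev ou @ os)) Q"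
      by (rule "2.IH"[OF r refl refl]) (use "2.prems" r sh in auto)
    then show ?thesis using "2.prems" r sh by (intro wpb_pact) auto
  qed
  then show ?case
    using "2.prems"(1) unfolding parse_def by (subst wpb_While) auto
qed

section \<open>Correctness of the parser\<close>

definition translates :: "connective set \<Rightarrow> bool \<Rightarrow> bool list \<Rightarrow> nat list \<Rightarrow> bool" where
  "translates S s u w \<longleftrightarrow> (\<exists>a. connectives a \<subseteq> S \<and> u = enc a \<and> w = tk (tr s a))"

lemma translates_intros:
  "translates S s ([False, False, False, False] @ enc_nat n) (tk (chain s (True # enc_nat n)))"
  "ATNEG \<in> S \<Longrightarrow> translates S s ([False, False, False, True] @ enc_nat n) (tk (chain (\<not> s) (True # enc_nat n)))"
  "NEG \<in> S \<Longrightarrow> translates S (\<not> s) u w \<Longrightarrow> translates S s ([False, False, True, False] @ u) w"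
  "AND \<in> S \<Longrightarrow> translates S s u w \<Longrightarrow> translates S s u' w' \<Longrightarrow> translates S s ([False, False, True, True] @ u @ u') ((if s then 3 else 4) # w @ w')"
  "OR \<in> S \<Longrightarrow> translates S s u w \<Longrightarrow> translates S s u' w' \<Longrightarrow> translates S s ([False, True, False, False] @ u @ u') ((if s then 4 else 3) # w @ w')"
  "BOX \<in> S \<Longrightarrow> translates S s u w \<Longrightarrow> translates S s ([False, True, False, True] @ u) ((if s then 5 else 7) # w)"
  "DIA \<in> S \<Longrightarrow> translates S s u w \<Longrightarrow> translates S s ([False, True, True, False] @ u) ((if s then 7 else 5) # w)"
  "TRUE \<in> S \<Longrightarrow> translates S s [False, True, True, True] [if s then 1 else 2]"
  "FALSE \<in> S \<Longrightarrow> translates S s [True, False, False, False] [if s then 2 else 1]"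
  unfolding translates_def
  subgoal by (rule exI[of _ "Var n"]) simp
  subgoal by (rule exI[of _ "NVar n"]) simp
  subgoal by (elim exE, rule_tac x = "Neg a" in exI) simp
  subgoal by (elim exE, rule_tac x = "Conj a aa" in exI) simp
  subgoal by (elim exE, rule_tac x = "Disj a aa" in exI) simp
  subgoal by (elim exE, rule_tac x = "Box a" in exI) simp
  subgoal by (elim exE, rule_tac x = "Dia a" in exI) simp
  subgoal by (rule exI[of _ Tru]) simp
  subgoal by (rule exI[of _ Fls]) simp
  done

definition is_index :: "bool \<Rightarrow> bool \<Rightarrow> bool list \<Rightarrow> nat list \<Rightarrow> bool" where
  "is_index s z u w \<longleftrightarrow> (\<exists>n. (z \<or> n \<noteq> 0) \<and> u = enc_nat n \<and> w = tk (chain s u))"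

text \<open>The meaning of a mode: a relation between the text it consumes and the symbols it
  produces.\<close>

definition item :: "connective set \<Rightarrow> nat \<Rightarrow> bool list \<times> nat list \<Rightarrow> bool" where
  "item S \<mu> = (\<lambda>(u, w). if \<mu> \<in> {1, 2} then translates S (\<mu> = 1) u w else is_index (\<mu> \<in> {3, 5}) (\<mu> \<in> {3, 4}) u w)"

lemma enc_nat_0: "enc_nat 0 = [False]" by (simp add: enc_nat.simps)

lemma enc_nat_pos: "n \<noteq> 0 \<Longrightarrow> enc_nat n = True # odd n # enc_nat (n div 2)"
  by (subst enc_nat.simps) simp

lemma enc_nat_step: "d \<or> m \<noteq> 0 \<Longrightarrow> enc_nat (2 * m + of_bool d) = True # d # enc_nat m"
  by (subst enc_nat_pos) (cases d, auto)+

lemma prs_steps: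
  "\<mu> \<in> {1, 2} \<Longrightarrow> prs S (\<mu> # P) (a # b # c # d # X) os =
    (case tab S \<mu> [a, b, c, d] of None \<Rightarrow> None | Some (pu, ou) \<Rightarrow> prs S (pu @ P) X (rev ou @ os))"
  "\<mu> \<notin> {1, 2} \<Longrightarrow> prs S (\<mu> # P) (True # d # X) os = prs S (fst (digit \<mu> d) @ P) X (rev (snd (digit \<mu> d)) @ os)"
  "\<mu> \<notin> {1, 2} \<Longrightarrow> prs S (\<mu> # P) (False # X) os =
    (case stop \<mu> of None \<Rightarrow> None | Some (pu, ou) \<Rightarrow> prs S (pu @ P) X (rev ou @ os))"
  by (auto simp: pstep.simps split: option.splits)

lemma prs_index:
  "\<mu> \<in> {3, 4} \<or> \<mu> \<in> {5, 6} \<and> n \<noteq> 0 \<Longrightarrow>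
    prs S (\<mu> # P) (enc_nat n @ X) os = prs S P X (rev (tk (chain (\<mu> \<in> {3, 5}) (enc_nat n))) @ os)"
proof (induction n arbitrary: \<mu> os rule: less_induct)
  case (less n)
  show ?case
  proof (cases "n = 0")
    case True
    then show ?thesis using less.prems by (auto simp: enc_nat_0 prs_steps stop_def simp del: prs.simps(2))
  next
    case False
    define \<nu> :: nat where "\<nu> = (if odd n then if \<mu> \<in> {3, 5} then 3 else 4 else if \<mu> \<in> {3, 5} then 5 else 6)"
    have m: "\<mu> \<notin> {1, 2}" using less.prems by auto
    \<comment> \<open>The most significant digit is 1, so the stricter mode after a digit
      \<open>False\<close> meets a positive rest.\<close>
    have "n div 2 = 0 \<Longrightarrow> odd n" using False by presburger
    then have "\<nu> \<in> {3, 4} \<or> \<nu> \<in> {5, 6} \<and> n div 2 \<noteq> 0" by (auto simp: \<nu>_def)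
    then have "prs S (\<nu> # P) (enc_nat (n div 2) @ X) os' =
        prs S P X (rev (tk (chain (\<nu> \<in> {3, 5}) (enc_nat (n div 2)))) @ os')" for os'
      using False by (intro less.IH) auto
    moreover have "(\<nu> \<in> {3, 5}) = (\<mu> \<in> {3, 5})" by (auto simp: \<nu>_def)
    moreover have "digit \<mu> (odd n) = ([\<nu>], if \<mu> \<in> {3, 5} then [8, 7 + of_bool (odd n)] else [6, 5 + of_bool (odd n)])"
      by (auto simp: digit_def \<nu>_def Let_def)
    ultimately show ?thesis
      unfolding enc_nat_pos[OF False] append_Cons prs_steps(2)[OF m] by (cases "\<mu> \<in> {3, 5}") (simp_all del: prs.simps(2))
  qed
qed

lemma prs_formula:
  "connectives a \<subseteq> S \<Longrightarrow> \<mu> \<in> {1, 2} \<Longrightarrow>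
    prs S (\<mu> # P) (enc a @ X) os = prs S P X (rev (tk (tr (\<mu> = 1) a)) @ os)"
proof (induction a arbitrary: \<mu> P X os)
qed (auto simp: tab_def Let_def prs_index prs_steps simp del: prs.simps(2))

text \<open>Read backwards: if the modes pushed by a step are served correctly, so is the mode that
  they replace.\<close>

lemma item_step:
  assumes p: "pstep S \<mu> X = Some (pu, ou, Y)" and \<mu>: "\<mu> \<in> {1..6}" and us: "list_all2 (item S) pu us"
  shows "\<exists>v. X = v @ Y \<and> item S \<mu> (v @ concat (map fst us), ou @ concat (map snd us))"
proof (cases "\<mu> \<in> {1, 2}")
  case True
  then obtain a b c d where X: "X = [a, b, c, d] @ Y" and t: "tab S \<mu> [a, b, c, d] = Some (pu, ou)"
    using p by (auto simp: pstep.simps split: list.splits option.splits)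
  have ix: "translates S s ([False, False, False, False] @ u) ((if s then 8 else 6) # w)" if "is_index s True u w" for s u w
    using that translates_intros(1)[of S s] by (auto simp: is_index_def)
  have iy: "translates S s ([False, False, False, True] @ u) ((if s then 6 else 8) # w)" if "is_index (\<not> s) True u w" "ATNEG \<in> S" for s u w
    using that translates_intros(2)[of S s] by (auto simp: is_index_def)
  have "item S \<mu> ([a, b, c, d] @ concat (map fst us), ou @ concat (map snd us))"
    using t True us translates_intros(3)[of S "\<mu> = 1"] translates_intros(4,5)[of S "\<mu> = 1"] translates_intros(6,7)[of S "\<mu> = 1"]
      translates_intros(8,9)[of S "\<mu> = 1"] ix[of "\<mu> = 1"] iy[of "\<mu> = 1"]
    by (auto simp: tab_def Let_def item_def list_all2_Cons1 split: if_splits)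
  then show ?thesis using X by blast
next
  case False
  show ?thesis
  proof (cases "\<exists>d. X = [True, d] @ Y \<and> digit \<mu> d = (pu, ou)")
    case True
    then obtain d where X: "X = [True, d] @ Y" and d: "digit \<mu> d = (pu, ou)" by blast
    obtain \<nu> where pu: "pu = [\<nu>]" "\<nu> \<in> {3, 5} \<longleftrightarrow> \<mu> \<in> {3, 5}" "\<nu> \<in> {3, 4} \<longleftrightarrow> d" "\<nu> \<notin> {1, 2}"
      using d by (auto simp: digit_def Let_def split: if_splits)
    then obtain u w where uw: "us = [(u, w)]" "is_index (\<mu> \<in> {3, 5}) d u w"
      using us by (auto simp: list_all2_Cons1 item_def)
    then obtain m where m: "d \<or> m \<noteq> 0" "u = enc_nat m" "w = tk (chain (\<mu> \<in> {3, 5}) u)" by (auto simp: is_index_def)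
    have "is_index (\<mu> \<in> {3, 5}) (\<mu> \<in> {3, 4}) ([True, d] @ u) (ou @ w)"
      unfolding is_index_def
      by (rule exI[of _ "2 * m + of_bool d"]) (use m d in \<open>auto simp: enc_nat_step digit_def Let_def split: if_splits\<close>)
    then show ?thesis using X uw False by (intro exI[of _ "[True, d]"]) (auto simp: item_def)
  next
    case nd: False
    then have X: "X = [False] @ Y" and t: "stop \<mu> = Some (pu, ou)"
      using p False by (auto simp: pstep.simps split: list.splits option.splits if_splits)
    have "is_index (\<mu> \<in> {3, 5}) (\<mu> \<in> {3, 4}) [False] ou" "pu = []"
      using t by (auto simp: stop_def is_index_def enc_nat_0 intro!: exI[of _ 0] split: if_splits)
    then show ?thesis using X us False by (intro exI[of _ "[False]"]) (auto simp: item_def)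
  qed
qed

lemma prs_sound:
  "prs S P X os = Some (X', os') \<Longrightarrow> set P \<subseteq> {1..6} \<Longrightarrow>
    \<exists>us. list_all2 (item S) P us \<and> X = concat (map fst us) @ X' \<and> os' = rev (concat (map snd us)) @ os"
proof (induction S P X os rule: prs.induct)
  case (1 S X os)
  then show ?case by (intro exI[of _ "[]"]) simp
next
  case (2 S \<mu> P X os)
  then obtain pu ou Y where r: "pstep S \<mu> X = Some (pu, ou, Y)" "prs S (pu @ P) Y (rev ou @ os) = Some (X', os')"
    by (auto split: option.splits)
  have "set pu \<subseteq> {1..6}"
    using r(1) "2.prems"(2)
    by (auto simp: pstep.simps tab_def digit_def stop_def Let_def split: if_splits list.splits option.splits prod.splits)
  then obtain us where us: "list_all2 (item S) (pu @ P) us" "Y = concat (map fst us) @ X'"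
    "os' = rev (concat (map snd us)) @ rev ou @ os"
    using "2.IH"[OF r(1) refl refl r(2)] "2.prems"(2) by auto
  obtain us1 us2 where u: "us = us1 @ us2" "list_all2 (item S) pu us1" "list_all2 (item S) P us2"
    using us(1) by (auto simp: list_all2_append1)
  obtain v where v: "X = v @ Y" "item S \<mu> (v @ concat (map fst us1), ou @ concat (map snd us1))"
    using item_step[OF r(1) _ u(2)] "2.prems"(2) by auto
  show ?case
    using v u us by (intro exI[of _ "(v @ concat (map fst us1), ou @ concat (map snd us1)) # us2"]) auto
qed

lemma prs_complete: "connectives a \<subseteq> S \<Longrightarrow> prs S [1] (enc a) [] = Some ([], rev (tk (tr True a)))"
  using prs_formula[of a S 1 "[]" "[]" "[]"] by simp

lemma prs_formula_sound:
  assumes "prs S [1] x [] = Some ([], os)"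
  shows "\<exists>a. connectives a \<subseteq> S \<and> x = enc a \<and> rev os = tk (tr True a)"
  using prs_sound[OF assms] by (auto simp: list_all2_Cons1 item_def translates_def)

text \<open>A parse error or trailing input empties stack 0 and thereby rejects.\<close>

definition decider :: "connective set \<Rightarrow> com" where
  "decider S = (Push 3 1 ;; parse S ;; Case 12 (\<lambda>e. if e = 0 then Case 0 (\<lambda>x. if x = 0 then main else clear 0) else clear 0))"

text \<open>The translation has at most one symbol more than the input has bits, and each symbol
  contributes two rounds, that is four quantifiers.\<close>

lemma wpb_decider:
  assumes b: "4 * (length x + 1) + 10 \<le> b" and inf: "infinite (UNIV :: 'w set)"
  shows "wpb b (decider S) (start x) (\<lambda>\<sigma>. hd0 (\<sigma> 0) = 2 \<longleftrightarrow> x \<in> sat_problem TYPE('w) S)"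
proof -
  let ?Q = "\<lambda>\<sigma>. hd0 (\<sigma> 0) = 2 \<longleftrightarrow> x \<in> sat_problem TYPE('w) S"
  have s: "start x = ps x [] []" by (auto simp: start_def ps_def fun_eq_iff)
  have no: "0 \<notin> set (map bsym X)" for X by (auto simp: bsym_def)
  have "wpb b (parse S) (ps x [1] []) (\<lambda>\<sigma>. wpb b (Case 12 (\<lambda>e. if e = 0 then Case 0 (\<lambda>x. if x = 0 then main else clear 0) else clear 0)) \<sigma> ?Q)"
  proof (rule wpb_parse)
    fix X os assume n: "prs S [1] x [] = None"
    have "x \<notin> sat_problem TYPE('w) S"
      using n prs_complete[of _ S] by (auto simp: sat_problem_def modal_lang_def)
    moreover have "failed X os 12 = [1]" "failed X os 0 = map bsym X" by (simp_all add: failed_def)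
    ultimately show "wpb b (Case 12 (\<lambda>e. if e = 0 then Case 0 (\<lambda>x. if x = 0 then main else clear 0) else clear 0)) (failed X os) ?Q"
      using no by simp
  next
    fix X' os' assume p: "prs S [1] x [] = Some (X', os')" "0 \<notin> set os'"
    show "wpb b (Case 12 (\<lambda>e. if e = 0 then Case 0 (\<lambda>x. if x = 0 then main else clear 0) else clear 0)) (ps X' [] os') ?Q"
    proof (cases X')
      case (Cons y Y)
      have "x \<notin> sat_problem TYPE('w) S"
        using p Cons prs_complete[of _ S] by (auto simp: sat_problem_def modal_lang_def)
      moreover have "bsym y \<noteq> 0" by (simp add: bsym_def)
      ultimately show ?thesis using no[of X'] Cons by simp
    next
      case Nil
      then obtain a where a: "connectives a \<subseteq> S" "x = enc a" "rev os' = tk (tr True a)"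
        using prs_formula_sound p by blast
      have sat: "x \<in> sat_problem TYPE('w) S \<longleftrightarrow> tsat [tr True a]"
        using a inj_image_mem_iff[OF inj_enc] satisfiable_tsat[OF inf, of a]
        by (simp add: sat_problem_def modal_lang_def)
      have "length os' \<le> length x + 1" using prs_length[OF p(1)] by simp
      moreover have "length (rev os') = length os'" "0 \<notin> set (rev os')" using p(2) by simp_all
      ultimately have "wpb b main ((\<lambda>_. [])(5 := rev (rev os'))) ?Q"
        unfolding a(3) using b sat by (intro wpb_main[of _ "[tr True a]"]) auto
      moreover have "ps [] [] os' = (\<lambda>_. [])(5 := rev (rev os'))" by (auto simp: ps_def fun_eq_iff)
      ultimately show ?thesis using Nil by simp
    qed
  qed (use b in auto)
  then show ?thesis using b by (simp add: decider_def s)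
qed

section \<open>Well-formedness of the decision procedure, and completeness for PSPACE\<close>

lemma wfc_mv: "i < k \<Longrightarrow> (\<And>a. a < s \<Longrightarrow> wfc k s (f a)) \<Longrightarrow> wfc k s (mv i f)"
  by (simp add: mv_def)

lemma wfc_psh: "j < k \<Longrightarrow> a < s \<Longrightarrow> wfc k s (psh j a)"
  by (simp add: psh_def)

lemma wfc_clear: "i < k \<Longrightarrow> wfc k s (clear i)"
  by (simp add: clear_def mv_def)

lemma wfc_draw: "(\<And>a. wfc 14 9 (f a)) \<Longrightarrow> wfc 14 9 (draw f)"
  by (simp add: draw_def)

lemma wfc_pass: "wfc 14 9 pass"
proof -
  have "wfc 14 9 (act1 \<mu> t e a)" if "t < 9" for \<mu> t e a
    using that pushed_range[of \<mu> t e a] by (auto simp: act1_def outp_def sel_def)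
  then have "wfc 14 9 (token \<mu>)" for \<mu>
    by (simp add: token_def wfc_draw)
  then show ?thesis by (simp add: pass_def)
qed

lemma wfc_search: "wfc 14 9 search"
proof -
  have "wfc 14 9 game"
    using wfc_pass by (auto simp: game_def intro!: wfc_mv wfc_psh wfc_clear wfc_draw)
  then have "wfc 14 9 leafc"
    by (auto simp: leafc_def intro!: wfc_mv wfc_psh)
  then show ?thesis by (simp add: search_def retreat_def)
qed

lemma wfc_parse: "wfc 14 9 (parse S)"
proof -
  have fail: "wfc 14 9 fail" by (simp add: fail_def wfc_clear)
  have rdb: "wfc 14 9 (rdb f)" if "\<And>a. wfc 14 9 (f a)" for f
    using that by (simp add: rdb_def fail_def wfc_clear)
  have fin: "wfc 14 9 (finishc r)" if "\<And>pu ou. r = Some (pu, ou) \<Longrightarrow> set pu \<subseteq> {0<..<9} \<and> set ou \<subseteq> {0<..<9}" for r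
    using that by (cases r) (auto simp: fail_def wfc_clear)
  have "wfc 14 9 (pact S \<mu>)" if \<mu>: "\<mu> < 9" for \<mu>
  proof -
    have 1: "set pu \<subseteq> {0<..<9} \<and> set ou \<subseteq> {0<..<9}" if "tab S \<mu> w = Some (pu, ou)" "\<mu> \<in> {1, 2}" for w pu ou
      using that by (auto simp: tab_def Let_def split: if_splits)
    have 2: "set pu \<subseteq> {0<..<9} \<and> set ou \<subseteq> {0<..<9}" if "digit \<mu> d = (pu, ou) \<or> stop \<mu> = Some (pu, ou)" for d pu ou
      using that by (auto simp: digit_def stop_def Let_def split: if_splits)
    show ?thesis
    proof (cases "\<mu> \<in> {1, 2}")
      case True
      then show ?thesis unfolding pact_def by (simp only: if_True) (intro rdb fin 1; assumption)
    next
      case False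
      have "wfc 14 9 (if x then rdb (\<lambda>d. finishc (Some (digit \<mu> d))) else finishc (stop \<mu>))" for x
        by (cases x) (auto intro!: rdb fin 2 simp del: finishc.simps)
      then show ?thesis using False unfolding pact_def by (simp only: if_False) (rule rdb)
    qed
  qed
  then show ?thesis by (simp add: parse_def)
qed

theorem sat_problem_in_PSPACE:
  assumes inf: "infinite (UNIV :: 'w set)"
  shows "sat_problem TYPE('w) S \<in> PSPACE"
proof (rule PSPACE_I)
  have "wfc 14 9 main"
    using wfc_search by (auto simp: main_def intro!: wfc_mv wfc_psh)
  then show "wfc 14 9 (decider S)"
    using wfc_parse by (simp add: decider_def wfc_clear)
  show "wp (\<lambda>l. l \<le> poly [:14, 4:] (length x)) (decider S) (start x)
      (\<lambda>_ \<sigma>. hd0 (\<sigma> 0) = 2 \<longleftrightarrow> x \<in> sat_problem TYPE('w) S)" for x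
    using wpb_decider[OF _ inf, of x "poly [:14, 4:] (length x)" S] by (simp add: wpb_def)
qed auto

theorem theorem11:
  fixes S :: "connective set"
  assumes "{AND, OR, BOX, DIA, FALSE} \<subseteq> S"
    and "infinite (UNIV :: 'w set)"
  shows "PSPACE_complete (sat_problem TYPE('w) S)"
proof -
  have "A \<le>\<^sub>p sat_problem TYPE('w) S" if A: "A \<in> PSPACE" for A
  proof -
    obtain M p where "wf_tm M" "decides M A" "runs_in_space M (poly p)"
      using A unfolding PSPACE_def by blast
    then interpret space_machine M A p by unfold_locales
    show ?thesis using assms by (rule reducible)
  qed
  then show ?thesis
    unfolding PSPACE_complete_def PSPACE_hard_def using sat_problem_in_PSPACE[OF assms(2)] by blast
qed

end
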